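(* Consider a liquid crystal flow with Lagrangian fluid path $\mathbf X(\mathbf x_0,t)$ and rotation-matrix field $\mathcal R(\mathbf x_0,t)$, and let $\boldsymbol u,\rho,\widehat\nu,Q,\widehat\gamma$ be the associated Eulerian velocity, density, angular velocity matrix, order tensor and wryness tensor (all defined in the context), so that $\partial_iQ=[Q,\widehat\gamma_i]$. Write $\mathcal F(Q,[Q,\widehat\gamma])=\Psi(Q,\widehat\gamma)$ and $p=\rho^2\,\mathcal U'(\rho)-\Psi$. Then the wryness tensor and its variation satisfy $$\partial_t\widehat\gamma_i+(\boldsymbol u\cdot\nabla)\widehat\gamma_i+(\partial_iu^k)\widehat\gamma_k=[\widehat\nu,\widehat\gamma_i]-\partial_i\widehat\nu,$$ $$\delta\widehat\gamma_i+(\boldsymbol w\cdot\nabla)\widehat\gamma_i+(\partial_iw^k)\widehat\gamma_k=[\widehat\eta,\widehat\gamma_i]-\partial_i\widehat\eta,$$ and the action principle $$\delta\int_{t_1}^{t_2}\!\!\int\Big(\frac12\rho\|\boldsymbol u\|^2+\frac J2\rho\|[\widehat\nu,Q]\|^2-\rho\,\mathcal U(\rho)-\Psi(Q,\widehat\gamma)\Big)\,\mathrm d^3x\,\mathrm dt=0$$ yields the equations of motion $$\rho D_tu_i=-\partial_ip-\partial_l\operatorname{Tr}\Big(\widehat\gamma_i\,\frac{\partial\Psi}{\partial\widehat\gamma_l}\Big),\qquad D_tQ=[\widehat\nu,Q],$$ $$\rho J\,D_t\big[[\widehat\nu,Q],Q\big]=\Big[Q,\frac{\partial\Psi}{\partial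 Q}\Big]+\Big[\frac{\partial\Psi}{\partial\widehat\gamma_i},\widehat\gamma_i\Big]-\partial_i\frac{\partial\Psi}{\partial\widehat\gamma_i},$$ $$D_t\widehat\gamma_i+(\partial_iu^k)\widehat\gamma_k=[\widehat\nu,\widehat\gamma_i]-\partial_i\widehat\nu .$$
   Context: Notation: $[A,B]=AB-BA$; $D_t=\partial_t+\boldsymbol u\cdot\nabla$; repeated indices are summed; $\|\cdot\|$ is the Euclidean norm of vectors and matrices; $J$ is the moment of inertia constant; $\mathcal U(\rho)$ is the internal energy function. All fields are assumed sufficiently smooth. Lagrangian variables: $\mathbf X(\mathbf x_0,t)$ is the Lagrangian fluid path (an invertible map for each $t$), $\rho_0(\mathbf x_0)$ a fixed reference density, $\mathcal R(\mathbf x_0,t)$ a rotation matrix, and $\mathcal Q=\mathcal R\mathcal Q_0\mathcal R^{-1}$ with $\mathcal Q_0(\mathbf x_0)$ a symmetric traceless $3\times3$ matrix field. There is an initial wryness tensor $\widehat\xi_{0i}$ (antisymmetric $3\times3$ matrices, $i=1,2,3$) such that $\partial_i\mathcal Q_0=[\mathcal Q_0,\widehat\xi_{0i}]$, and one sets $$\widehat\xi_i:=-\partial_i\mathcal R\,\mathcal R^{-1}+\mathcal R\,\widehat\xi_{0i}\,\mathcal R^{-1}.$$ Eulerian variables: $\boldsymbol u=\dot{\mathbf X}\circ\mathbf X^{-1}$, $\rho(\mathbf x,t)=\int\rho_0(\mathbf x_0)\,\delta(\mathbf x-\mathbf X(\mathbf x_0,t))\,\mathrm d^3x_0$, $Q=\mathcal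 Q\circ\mathbf X^{-1}$, $\widehat\nu=(\partial_t\mathcal R\,\mathcal R^{-1})\circ\mathbf X^{-1}$, and $\widehat\gamma$ is defined by $$\rho\,\widehat\gamma:=\int\rho_0(\mathbf x_0)\,\widehat\xi(\mathbf x_0)\,\delta(\mathbf x-\mathbf X(\mathbf x_0,t))\,\mathrm d^3x_0 .$$ Variations: with $\boldsymbol w=\delta\mathbf X\circ\mathbf X^{-1}$ and $\widehat\eta=(\delta\mathcal R\,\mathcal R^{-1})\circ\mathbf X^{-1}$ arbitrary and vanishing at the endpoints $t_1,t_2$, the variations in the action principle are the one for $\widehat\gamma_i$ given in the claim together with $$\delta\boldsymbol u=\partial_t\boldsymbol w+(\boldsymbol u\cdot\nabla)\boldsymbol w-(\boldsymbol w\cdot\nabla)\boldsymbol u,\quad \delta\rho=-\operatorname{div}(\rho\boldsymbol w),\quad \delta Q=[\widehat\eta,Q]-(\boldsymbol w\cdot\nabla)Q,$$ $$\delta\widehat\nu=\partial_t\widehat\eta-(\boldsymbol w\cdot\nabla)\widehat\nu+(\boldsymbol u\cdot\nabla)\widehat\eta+[\widehat\eta,\widehat\nu].$$ $\mathcal F(Q,\nabla Q)$ is the Landau--de Gennes free energy $$\mathcal F=\tfrac12\big(\alpha Q_{ij}^2+L_1Q_{ij,k}^2+L_2Q_{ij,j}Q_{ik,k}\big)+\tfrac{4\pi}{P}L_1\varepsilon_{ijk}Q_{il}\partial_jQ_{kl}-\beta Q_{ij}Q_{jk}Q_{ki}+\gamma(Q_{ij}^2)^2$$ with phenomenological constants $\alpha,L_1,L_2,\beta,\gamma,P$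 (the constant $\gamma$ is unrelated to $\widehat\gamma$), and $\mathcal F(Q,[Q,\widehat\gamma])$ means that $\partial_iQ$ is replaced by $[Q,\widehat\gamma_i]$. $\partial\Psi/\partial Q$ and $\partial\Psi/\partial\widehat\gamma_i$ are the matrix-valued partial derivatives of $\Psi$ (symmetric and antisymmetric matrices respectively), derivatives being identified with matrices through the trace pairing.
   Formalization: In the momentum equation Tr(γ_i ∂Ψ/∂γ_l) is corrected to Tr(γ_i^T ∂Ψ/∂γ_l), with gradients taken for Tr(A^T B); in the integral defining γ, the label components of ξ are replaced by its one-form components in Eulerian coordinates, (∂_i (X^{-1})^k) ξ_k. *)

theory Defs
  imports "HOL-Analysis.Analysis"
begin

type_synonym vec3 = "real^3"
type_synonym mat3 = "real^3^3"

text \<open>A wryness tensor is a matrix-valued covector: \<open>g $ i\<close> is its \<open>i\<close>-th (matrix) component.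
  Fields on space-time take the time as first argument.\<close>

type_synonym wryness = "real^3^3^3"


subsection \<open>Differential operators\<close>

text \<open>Functions of class \<open>C\<^sup>k\<close> on an open set.\<close>

primrec Ck_on :: "nat \<Rightarrow> 'a::real_normed_vector set \<Rightarrow> ('a \<Rightarrow> 'b::real_normed_vector) \<Rightarrow> bool" where
  "Ck_on 0 S f = continuous_on S f"
| "Ck_on (Suc k) S f =
    ((\<forall>x\<in>S. f differentiable (at x)) \<and> (\<forall>v. Ck_on k S (\<lambda>x. frechet_derivative f (at x) v)))"

definition partial_x :: "3 \<Rightarrow> (vec3 \<Rightarrow> 'b::real_normed_vector) \<Rightarrow> vec3 \<Rightarrow> 'b" where
  "partial_x i f x = vector_derivative (\<lambda>s. f (x + s *\<^sub>R axis i 1)) (at 0)"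

definition partial_t :: "(real \<Rightarrow> vec3 \<Rightarrow> 'b::real_normed_vector) \<Rightarrow> real \<Rightarrow> vec3 \<Rightarrow> 'b" where
  "partial_t f t x = vector_derivative (\<lambda>s. f s x) (at t)"

text \<open>\<open>advect v f x\<close> is \<open>((v \<cdot> \<nabla>) f)(x)\<close>, where \<open>v\<close> is the value of the vector field at \<open>x\<close>.\<close>

definition advect :: "vec3 \<Rightarrow> (vec3 \<Rightarrow> 'b::real_normed_vector) \<Rightarrow> vec3 \<Rightarrow> 'b" where
  "advect v f x = (\<Sum>k\<in>UNIV. v $ k *\<^sub>R partial_x k f x)"

definition material_derivative ::
  "(real \<Rightarrow> vec3 \<Rightarrow> vec3) \<Rightarrow> (real \<Rightarrow> vec3 \<Rightarrow> 'b::real_normed_vector) \<Rightarrow> real \<Rightarrow> vec3 \<Rightarrow> 'b" where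
  "material_derivative u f t x = partial_t f t x + advect (u t x) (f t) x"

definition divergence :: "(vec3 \<Rightarrow> vec3) \<Rightarrow> vec3 \<Rightarrow> real" where
  "divergence v x = (\<Sum>k\<in>UNIV. partial_x k (\<lambda>y. v y $ k) x)"


subsection \<open>Matrices\<close>

definition commutator :: "mat3 \<Rightarrow> mat3 \<Rightarrow> mat3" where
  "commutator A B = A ** B - B ** A"

definition symmetric :: "mat3 \<Rightarrow> bool" where
  "symmetric A \<longleftrightarrow> transpose A = A"

definition antisymmetric :: "mat3 \<Rightarrow> bool" where
  "antisymmetric A \<longleftrightarrow> transpose A = - A"

text \<open>The trace pairing is \<open>\<langle>A, B\<rangle> = Tr (A\<^sup>T B)\<close>, the inner product of the Euclidean matrix norm.
  It identifies derivatives with matrices, and it is also what is meant by the trace of the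
  product of \<open>\<gamma>\<^sub>i\<close> and \<open>\<partial>\<Psi>/\<partial>\<gamma>\<^sub>l\<close> in the momentum equation.  The transpose matters there: both
  matrices are antisymmetric, so \<open>Tr (A B) = - \<langle>A, B\<rangle>\<close>, and with the bare trace the sign of the
  stress in the momentum equation and the signs of the \<open>\<partial>\<Psi>/\<partial>\<gamma>\<^sub>i\<close> terms in the angular
  momentum equation could not both be those of the action principle.\<close>

definition trace_pairing :: "mat3 \<Rightarrow> mat3 \<Rightarrow> real" where
  "trace_pairing A B = trace (transpose A ** B)"

text \<open>\<open>\<partial>\<Psi>/\<partial>Q\<close> and \<open>\<partial>\<Psi>/\<partial>\<gamma>\<^sub>l\<close>: symmetric and antisymmetric gradients, tested on symmetric and
  antisymmetric increments respectively.\<close>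

definition dPsi_dQ :: "(mat3 \<Rightarrow> wryness \<Rightarrow> real) \<Rightarrow> mat3 \<Rightarrow> wryness \<Rightarrow> mat3" where
  "dPsi_dQ Psi Q g =
    (THE A. symmetric A \<and>
      (\<forall>H. symmetric H \<longrightarrow>
        ((\<lambda>s. Psi (Q + s *\<^sub>R H) g) has_real_derivative trace_pairing A H) (at 0)))"

definition dPsi_dgamma :: "(mat3 \<Rightarrow> wryness \<Rightarrow> real) \<Rightarrow> 3 \<Rightarrow> mat3 \<Rightarrow> wryness \<Rightarrow> mat3" where
  "dPsi_dgamma Psi l Q g =
    (THE A. antisymmetric A \<and>
      (\<forall>H. antisymmetric H \<longrightarrow>
        ((\<lambda>s. Psi Q (g + s *\<^sub>R axis l H)) has_real_derivative trace_pairing A H) (at 0)))"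


subsection \<open>Landau--de Gennes free energy\<close>

definition levi_civita :: "3 \<Rightarrow> 3 \<Rightarrow> 3 \<Rightarrow> real" where
  "levi_civita i j k =
    (if (i, j, k) \<in> {(1, 2, 3), (2, 3, 1), (3, 1, 2)} then 1
     else if (i, j, k) \<in> {(3, 2, 1), (2, 1, 3), (1, 3, 2)} then - 1 else 0)"

text \<open>The argument \<open>dQ\<close> stands for \<open>\<nabla>Q\<close>, with \<open>dQ $ k $ i $ j = \<partial>\<^sub>k Q\<^sub>i\<^sub>j\<close>.\<close>

definition landau_de_gennes ::
  "real \<Rightarrow> real \<Rightarrow> real \<Rightarrow> real \<Rightarrow> real \<Rightarrow> real \<Rightarrow> mat3 \<Rightarrow> real^3^3^3 \<Rightarrow> real" where
  "landau_de_gennes \<alpha> L1 L2 P \<beta> c Q dQ =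
     1 / 2 * (\<alpha> * (\<Sum>i\<in>UNIV. \<Sum>j\<in>UNIV. (Q $ i $ j)\<^sup>2)
            + L1 * (\<Sum>i\<in>UNIV. \<Sum>j\<in>UNIV. \<Sum>k\<in>UNIV. (dQ $ k $ i $ j)\<^sup>2)
            + L2 * (\<Sum>i\<in>UNIV. \<Sum>j\<in>UNIV. \<Sum>k\<in>UNIV. dQ $ j $ i $ j * dQ $ k $ i $ k))
     + 4 * pi / P * L1 *
         (\<Sum>i\<in>UNIV. \<Sum>j\<in>UNIV. \<Sum>k\<in>UNIV. \<Sum>l\<in>UNIV. levi_civita i j k * Q $ i $ l * dQ $ j $ k $ l)
     - \<beta> * (\<Sum>i\<in>UNIV. \<Sum>j\<in>UNIV. \<Sum>k\<in>UNIV. Q $ i $ j * Q $ j $ k * Q $ k $ i)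
     + c * (\<Sum>i\<in>UNIV. \<Sum>j\<in>UNIV. (Q $ i $ j)\<^sup>2)\<^sup>2"


subsection \<open>Lagrangian and Eulerian variables\<close>

text \<open>\<open>X\<close> and \<open>R\<close> are the fluid path and the rotation field, defined for times in the open set
  \<open>T\<close>.  Smoothness of the inverse makes each \<open>X t\<close> a diffeomorphism.\<close>

definition lagrangian_path ::
  "real set \<Rightarrow> (real \<Rightarrow> vec3 \<Rightarrow> vec3) \<Rightarrow> (real \<Rightarrow> vec3 \<Rightarrow> mat3) \<Rightarrow> bool" where
  "lagrangian_path T X R \<longleftrightarrow> open T \<and>
     (\<forall>t\<in>T. bij (X t)) \<and>
     Ck_on 2 (T \<times> UNIV) (\<lambda>(t, x0). X t x0) \<and>
     Ck_on 2 (T \<times> UNIV) (\<lambda>(t, x). inv (X t) x) \<and>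
     Ck_on 2 (T \<times> UNIV) (\<lambda>(t, x0). R t x0) \<and>
     (\<forall>t\<in>T. \<forall>x0. rotation_matrix (R t x0))"

text \<open>A deformation of \<open>(X, R)\<close>: a family of paths with parameter in a neighbourhood \<open>E\<close> of 0.\<close>

definition path_variation ::
  "real set \<Rightarrow> real set \<Rightarrow> (real \<Rightarrow> vec3 \<Rightarrow> vec3) \<Rightarrow> (real \<Rightarrow> vec3 \<Rightarrow> mat3) \<Rightarrow>
   (real \<Rightarrow> real \<Rightarrow> vec3 \<Rightarrow> vec3) \<Rightarrow> (real \<Rightarrow> real \<Rightarrow> vec3 \<Rightarrow> mat3) \<Rightarrow> bool" where
  "path_variation E T X R XV RV \<longleftrightarrow> open E \<and> 0 \<in> E \<and>
     (\<forall>t\<in>T. XV 0 t = X t \<and> RV 0 t = R t) \<and>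
     (\<forall>e\<in>E. \<forall>t\<in>T. bij (XV e t)) \<and>
     Ck_on 2 (E \<times> T \<times> UNIV) (\<lambda>(e, t, x0). XV e t x0) \<and>
     Ck_on 2 (E \<times> T \<times> UNIV) (\<lambda>(e, t, x). inv (XV e t) x) \<and>
     Ck_on 2 (E \<times> T \<times> UNIV) (\<lambda>(e, t, x0). RV e t x0) \<and>
     (\<forall>e\<in>E. \<forall>t\<in>T. \<forall>x0. rotation_matrix (RV e t x0))"

text \<open>\<open>is_delta_integral X g f\<close> says \<open>f(x) = \<integral> g(x\<^sub>0) \<delta>(x - X(x\<^sub>0)) d\<^sup>3x\<^sub>0\<close>, with the Dirac delta
  understood as usual by testing against continuous functions of compact support.\<close>

definition is_delta_integral ::
  "(vec3 \<Rightarrow> vec3) \<Rightarrow> (vec3 \<Rightarrow> 'b::euclidean_space) \<Rightarrow> (vec3 \<Rightarrow> 'b) \<Rightarrow> bool" where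
  "is_delta_integral X g f \<longleftrightarrow>
     (\<forall>\<phi>::vec3 \<Rightarrow> real. continuous_on UNIV \<phi> \<and> bounded {x. \<phi> x \<noteq> 0} \<longrightarrow>
        integral UNIV (\<lambda>x. \<phi> x *\<^sub>R f x) = integral UNIV (\<lambda>x0. \<phi> (X x0) *\<^sub>R g x0))"

definition eulerian_velocity :: "(real \<Rightarrow> vec3 \<Rightarrow> vec3) \<Rightarrow> real \<Rightarrow> vec3 \<Rightarrow> vec3" where
  "eulerian_velocity X t x = partial_t X t (inv (X t) x)"

definition eulerian_angular_velocity ::
  "(real \<Rightarrow> vec3 \<Rightarrow> vec3) \<Rightarrow> (real \<Rightarrow> vec3 \<Rightarrow> mat3) \<Rightarrow> real \<Rightarrow> vec3 \<Rightarrow> mat3" where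
  "eulerian_angular_velocity X R t x =
     partial_t R t (inv (X t) x) ** matrix_inv (R t (inv (X t) x))"

definition eulerian_order_tensor ::
  "(real \<Rightarrow> vec3 \<Rightarrow> vec3) \<Rightarrow> (real \<Rightarrow> vec3 \<Rightarrow> mat3) \<Rightarrow> (vec3 \<Rightarrow> mat3) \<Rightarrow> real \<Rightarrow> vec3 \<Rightarrow> mat3" where
  "eulerian_order_tensor X R Q0 t x =
     (let x0 = inv (X t) x in R t x0 ** Q0 x0 ** matrix_inv (R t x0))"

text \<open>The Lagrangian wryness tensor at one instant; the derivatives are in the label \<open>x\<^sub>0\<close>.\<close>

definition lagrangian_wryness :: "(vec3 \<Rightarrow> mat3) \<Rightarrow> (vec3 \<Rightarrow> wryness) \<Rightarrow> vec3 \<Rightarrow> wryness" where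
  "lagrangian_wryness R xi0 x0 =
     (\<chi> i. - (partial_x i R x0 ** matrix_inv (R x0)) + R x0 ** (xi0 x0 $ i) ** matrix_inv (R x0))"

text \<open>The index \<open>i\<close> of a wryness tensor is that of a covector (\<open>\<xi> = \<xi>\<^sub>k dx\<^sub>0\<^sup>k\<close>).  The components of
  \<open>\<xi>\<close> at \<open>x\<^sub>0\<close> with respect to the Eulerian covectors \<open>dx\<^sup>i\<close> are \<open>(\<partial>(X\<^sup>-\<^sup>1)\<^sup>k/\<partial>x\<^sup>i) \<xi>\<^sub>k\<close>.  It is these
  components that enter the delta integral: with the unchanged label components neither
  \<open>\<partial>\<^sub>i Q = [Q, \<gamma>\<^sub>i]\<close> nor the term \<open>(\<partial>\<^sub>i u\<^sup>k) \<gamma>\<^sub>k\<close> in the transport equation would be true.\<close>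

definition eulerian_components :: "(vec3 \<Rightarrow> vec3) \<Rightarrow> (vec3 \<Rightarrow> wryness) \<Rightarrow> vec3 \<Rightarrow> wryness" where
  "eulerian_components X xi x0 =
     (\<chi> i. \<Sum>k\<in>UNIV. partial_x i (\<lambda>x. inv X x $ k) (X x0) *\<^sub>R (xi x0 $ k))"

definition is_eulerian_density :: "(vec3 \<Rightarrow> vec3) \<Rightarrow> (vec3 \<Rightarrow> real) \<Rightarrow> (vec3 \<Rightarrow> real) \<Rightarrow> bool" where
  "is_eulerian_density X rho0 rho \<longleftrightarrow> is_delta_integral X rho0 rho"

definition is_eulerian_wryness ::
  "(vec3 \<Rightarrow> vec3) \<Rightarrow> (vec3 \<Rightarrow> mat3) \<Rightarrow> (vec3 \<Rightarrow> real) \<Rightarrow> (vec3 \<Rightarrow> wryness) \<Rightarrow>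
   (vec3 \<Rightarrow> real) \<Rightarrow> (vec3 \<Rightarrow> wryness) \<Rightarrow> bool" where
  "is_eulerian_wryness X R rho0 xi0 rho gam \<longleftrightarrow>
     is_delta_integral X
       (\<lambda>x0. rho0 x0 *\<^sub>R eulerian_components X (lagrangian_wryness R xi0) x0)
       (\<lambda>x. rho x *\<^sub>R gam x)"


subsection \<open>The action principle\<close>

definition lagrangian_density ::
  "real \<Rightarrow> (real \<Rightarrow> real) \<Rightarrow> (mat3 \<Rightarrow> wryness \<Rightarrow> real) \<Rightarrow>
   vec3 \<Rightarrow> real \<Rightarrow> mat3 \<Rightarrow> mat3 \<Rightarrow> wryness \<Rightarrow> real" where
  "lagrangian_density J U Psi u rho nu Q gam =
     1 / 2 * rho * (norm u)\<^sup>2 + J / 2 * rho * (norm (commutator nu Q))\<^sup>2 - rho * U rho - Psi Q gam"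

definition action ::
  "real \<Rightarrow> (real \<Rightarrow> real) \<Rightarrow> (mat3 \<Rightarrow> wryness \<Rightarrow> real) \<Rightarrow> real \<Rightarrow> real \<Rightarrow> vec3 set \<Rightarrow>
   (real \<Rightarrow> vec3 \<Rightarrow> vec3) \<Rightarrow> (real \<Rightarrow> vec3 \<Rightarrow> real) \<Rightarrow> (real \<Rightarrow> vec3 \<Rightarrow> mat3) \<Rightarrow>
   (real \<Rightarrow> vec3 \<Rightarrow> mat3) \<Rightarrow> (real \<Rightarrow> vec3 \<Rightarrow> wryness) \<Rightarrow> real" where
  "action J U Psi t1 t2 B u rho nu Q gam =
     integral {t1..t2} (\<lambda>t. integral B (\<lambda>x.
       lagrangian_density J U Psi (u t x) (rho t x) (nu t x) (Q t x) (gam t x)))"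

text \<open>The variations of the Eulerian fields generated by \<open>w = \<delta>X \<circ> X\<^sup>-\<^sup>1\<close> and
  \<open>\<eta> = (\<delta>R R\<^sup>-\<^sup>1) \<circ> X\<^sup>-\<^sup>1\<close>.\<close>

definition constrained_variation ::
  "real set \<Rightarrow>
   (real \<Rightarrow> vec3 \<Rightarrow> vec3) \<Rightarrow> (real \<Rightarrow> vec3 \<Rightarrow> real) \<Rightarrow> (real \<Rightarrow> vec3 \<Rightarrow> mat3) \<Rightarrow>
   (real \<Rightarrow> vec3 \<Rightarrow> mat3) \<Rightarrow> (real \<Rightarrow> vec3 \<Rightarrow> wryness) \<Rightarrow>
   (real \<Rightarrow> vec3 \<Rightarrow> vec3) \<Rightarrow> (real \<Rightarrow> vec3 \<Rightarrow> mat3) \<Rightarrow>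
   (real \<Rightarrow> vec3 \<Rightarrow> vec3) \<Rightarrow> (real \<Rightarrow> vec3 \<Rightarrow> real) \<Rightarrow> (real \<Rightarrow> vec3 \<Rightarrow> mat3) \<Rightarrow>
   (real \<Rightarrow> vec3 \<Rightarrow> mat3) \<Rightarrow> (real \<Rightarrow> vec3 \<Rightarrow> wryness) \<Rightarrow> bool" where
  "constrained_variation T u rho nu Q gam w eta du drho dnu dQ dgam \<longleftrightarrow>
     (\<forall>t\<in>T. \<forall>x.
        du t x = partial_t w t x + advect (u t x) (w t) x - advect (w t x) (u t) x \<and>
        drho t x = - divergence (\<lambda>y. rho t y *\<^sub>R w t y) x \<and>
        dQ t x = commutator (eta t x) (Q t x) - advect (w t x) (Q t) x \<and>
        dnu t x = partial_t eta t x - advect (w t x) (nu t) x + advect (u t x) (eta t) x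
                  + commutator (eta t x) (nu t x) \<and>
        (\<forall>i. dgam t x $ i + advect (w t x) (\<lambda>y. gam t y $ i) x
               + (\<Sum>k\<in>UNIV. partial_x i (\<lambda>y. w t y $ k) x *\<^sub>R (gam t x $ k))
             = commutator (eta t x) (gam t x $ i) - partial_x i (eta t) x))"

text \<open>The fields \<open>w\<close> and \<open>\<eta>\<close> vanish at \<open>t\<^sub>1\<close> and \<open>t\<^sub>2\<close> and outside some ball.  The action over that
  ball is differentiated: the fields outside are not varied, and the action over the whole space
  need not converge.\<close>

definition stationary_action ::
  "real \<Rightarrow> (real \<Rightarrow> real) \<Rightarrow> (mat3 \<Rightarrow> wryness \<Rightarrow> real) \<Rightarrow> real set \<Rightarrow> real \<Rightarrow> real \<Rightarrow>
   (real \<Rightarrow> vec3 \<Rightarrow> vec3) \<Rightarrow> (real \<Rightarrow> vec3 \<Rightarrow> real) \<Rightarrow> (real \<Rightarrow> vec3 \<Rightarrow> mat3) \<Rightarrow>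
   (real \<Rightarrow> vec3 \<Rightarrow> mat3) \<Rightarrow> (real \<Rightarrow> vec3 \<Rightarrow> wryness) \<Rightarrow> bool" where
  "stationary_action J U Psi T t1 t2 u rho nu Q gam \<longleftrightarrow>
     (\<forall>w eta du drho dnu dQ dgam r.
        Ck_on 2 (T \<times> UNIV) (\<lambda>(t, x). w t x) \<and>
        Ck_on 2 (T \<times> UNIV) (\<lambda>(t, x). eta t x) \<and>
        (\<forall>t\<in>T. \<forall>x. antisymmetric (eta t x)) \<and>
        (\<forall>x. w t1 x = 0 \<and> w t2 x = 0 \<and> eta t1 x = 0 \<and> eta t2 x = 0) \<and>
        (\<forall>t\<in>T. \<forall>x. x \<notin> cball 0 r \<longrightarrow> w t x = 0 \<and> eta t x = 0) \<and>
        constrained_variation T u rho nu Q gam w eta du drho dnu dQ dgam \<longrightarrow>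
        ((\<lambda>e. action J U Psi t1 t2 (cball 0 r)
                (\<lambda>t x. u t x + e *\<^sub>R du t x) (\<lambda>t x. rho t x + e * drho t x)
                (\<lambda>t x. nu t x + e *\<^sub>R dnu t x) (\<lambda>t x. Q t x + e *\<^sub>R dQ t x)
                (\<lambda>t x. gam t x + e *\<^sub>R dgam t x))
          has_real_derivative 0) (at 0))"

end

(* In Lagrangian labels the wryness tensor is the 1-form
     xi = - dR R^T + R xi0 R^T,
   and gamma is its push-forward under X.  So gamma(D_v X) = xi(v) along every fluid path, and
   differentiating this in time (mixed partial derivatives of X and R commute) gives the transport
   equation; a deformation parameter in place of the time gives the variation formula.

   For the equations of motion put w = phi e_j and eta = phi H with a scalar test function phi and
   a constant antisymmetric H.  Each choice turns stationarity into a scalar weak equation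
   a phi_t + b_k d_k phi + c phi.  For w = phi e_j all fields z = (u, rho, nu, Q, gamma) vary by
   - phi d_j z plus terms containing derivatives of phi, so that the variation of the Lagrangian L
   is - phi d_j L plus such terms, and L - rho dL/drho is the pressure p.  The continuity equation
   is the weak equation obtained by pulling D_t phi back to the labels. *)

theory Submission
  imports Defs
begin

subsection \<open>Functions of class \<open>C\<^sup>k\<close>\<close>

text \<open>The fields \<open>rho\<close> and \<open>gam\<close> are known only through delta
  integrals, so pointwise facts have to be extracted from them: a change of variables along the
  inverse path gives \<open>rho > 0\<close>, and then \<open>rho\<close> can be cancelled to obtain
  the push-forward formula for \<open>gam\<close>. Regularity is tight: \<open>X\<close> and
  \<open>R\<close> are of class C^2, all Eulerian fields are C^1, and their derivatives are merely
  continuous. Hence the symmetry of second derivatives is applied in label coordinates, to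
  \<open>X\<close> and \<open>R\<close>; the coefficients \<open>a\<close> and \<open>b\<close> of a
  weak equation are C^1, while \<open>c\<close> is only continuous and is never differentiated, so
  it can absorb a derivative of the Lagrangian along the solution. In labels the direction
  \<open>(1, u)\<close> becomes \<open>(1, 0)\<close>, which turns each transport law into an
  ordinary time derivative. Constant matrices \<open>H\<close> suffice for the angular momentum
  because the equation is pointwise: its defect at a point is itself an antisymmetric matrix and can
  be paired with itself.\<close>

abbreviation "fderiv f x \<equiv> frechet_derivative f (at x)"

lemma Ck_on_cong:
  assumes "open S" "\<And>x. x \<in> S \<Longrightarrow> f x = g x" "Ck_on k S f"
  shows "Ck_on k S g"
  using assms(2,3)
proof (induction k arbitrary: f g)
  case 0
  then show ?case by (simp cong: continuous_on_cong)
next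
  case (Suc k)
  have d: "(g has_derivative fderiv f x) (at x)" if "x \<in> S" for x
    using Suc.prems that assms(1)
    by (auto simp: frechet_derivative_works intro: has_derivative_transform_within_open)
  then have e: "fderiv g x = fderiv f x" if "x \<in> S" for x
    using that frechet_derivative_at by metis
  show ?case
    using Suc.IH[of "\<lambda>x. fderiv f x v" "\<lambda>x. fderiv g x v" for v]
      Suc.prems e differentiableI[OF d] by auto
qed

text \<open>Lets a computed derivative \<open>f'\<close> stand in for \<open>fderiv\<close>, since
  the two agree on \<open>S\<close> by uniqueness; most closure rules below go through it.\<close>

lemma Ck_on_SucI:
  assumes "open S" "\<And>x. x \<in> S \<Longrightarrow> (f has_derivative f' x) (at x)" "\<And>v. Ck_on k S (\<lambda>x. f' x v)"
  shows "Ck_on (Suc k) S f"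
proof -
  have e: "f' x = fderiv f x" if "x \<in> S" for x
    using assms(2)[OF that] frechet_derivative_at by metis
  have "Ck_on k S (\<lambda>x. fderiv f x v)" for v
    by (rule Ck_on_cong[OF assms(1) _ assms(3)[of v]]) (simp add: e)
  then show ?thesis using assms(2) by (auto simp: differentiable_def)
qed

lemma Ck_on_Suc_deriv: "Ck_on (Suc k) S f \<Longrightarrow> Ck_on k S (\<lambda>x. fderiv f x v)"
  by simp

lemma Ck_on_has_derivative:
  "Ck_on (Suc k) S f \<Longrightarrow> x \<in> S \<Longrightarrow> (f has_derivative fderiv f x) (at x)"
  by (simp add: frechet_derivative_works)

lemma Ck_on_SucD: "Ck_on (Suc k) S f \<Longrightarrow> Ck_on k S f"
proof (induction k arbitrary: f)
  case 0
  then show ?case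
    by (auto intro!: continuous_at_imp_continuous_on differentiable_imp_continuous_within)
next
  case (Suc k)
  then show ?case by (metis Ck_on.simps(2))
qed

lemma Ck_on_le: "Ck_on k S f \<Longrightarrow> j \<le> k \<Longrightarrow> Ck_on j S f"
  by (induction k) (use Ck_on_SucD le_Suc_eq in \<open>auto simp del: Ck_on.simps(2)\<close>)

lemma Ck_on_continuous: "Ck_on k S f \<Longrightarrow> continuous_on S f"
  using Ck_on_le[of k S f 0] by simp

lemma Ck_on_subset: "Ck_on k S f \<Longrightarrow> T \<subseteq> S \<Longrightarrow> Ck_on k T f"
  by (induction k arbitrary: f) (auto intro: continuous_on_subset)

lemma Ck_on_const: "Ck_on k S (\<lambda>x. c)"
  by (induction k arbitrary: c) auto

lemma Ck_on_linear: assumes "open S" "bounded_linear L" shows "Ck_on k S L"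
proof (cases k)
  case 0 then show ?thesis using assms by (auto intro: linear_continuous_on)
next
  case (Suc j)
  show ?thesis unfolding Suc
    by (rule Ck_on_SucI[OF assms(1), where f'="\<lambda>_. L"])
      (auto intro: Ck_on_const bounded_linear_imp_has_derivative assms)
qed

lemma Ck_on_linear_comp:
  assumes "open S" "bounded_linear L" "Ck_on k S f"
  shows "Ck_on k S (\<lambda>x. L (f x))"
  using assms(3)
proof (induction k arbitrary: f)
  case 0
  then show ?case using assms by (auto intro: bounded_linear.continuous_on)
next
  case (Suc k)
  show ?case
  proof (rule Ck_on_SucI[OF assms(1), where f'="\<lambda>x v. L (fderiv f x v)"])
    show "((\<lambda>x. L (f x)) has_derivative (\<lambda>v. L (fderiv f x v))) (at x)" if "x \<in> S" for x
      by (rule bounded_linear.has_derivative[OF assms(2) Ck_on_has_derivative[OF Suc.prems that]])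
  qed (rule Suc.IH[OF Ck_on_Suc_deriv[OF Suc.prems]])
qed

lemma Ck_on_add:
  assumes "open S" "Ck_on k S f" "Ck_on k S g"
  shows "Ck_on k S (\<lambda>x. f x + g x)"
  using assms(2,3)
proof (induction k arbitrary: f g)
  case 0
  then show ?case by (auto intro: continuous_intros)
next
  case (Suc k)
  show ?case
  proof (rule Ck_on_SucI[OF assms(1), where f'="\<lambda>x v. fderiv f x v + fderiv g x v"])
    show "((\<lambda>x. f x + g x) has_derivative (\<lambda>v. fderiv f x v + fderiv g x v)) (at x)"
      if "x \<in> S" for x
      by (rule has_derivative_add[OF Ck_on_has_derivative[OF Suc.prems(1) that] Ck_on_has_derivative[OF Suc.prems(2) that]])
    show "Ck_on k S (\<lambda>x. fderiv f x v + fderiv g x v)" for v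
      by (rule Suc.IH[OF Ck_on_Suc_deriv[OF Suc.prems(1)] Ck_on_Suc_deriv[OF Suc.prems(2)]])
  qed
qed

lemma Ck_on_sum:
  assumes "open S" "\<And>i. i \<in> I \<Longrightarrow> Ck_on k S (f i)"
  shows "Ck_on k S (\<lambda>x. \<Sum>i\<in>I. f i x)"
  using assms(2)
  by (induction I rule: infinite_finite_induct) (auto intro: Ck_on_const Ck_on_add[OF assms(1)])

text \<open>One induction serves real and scalar multiplication, inner products, matrix products and
  commutators, all of which are bounded bilinear.\<close>

lemma Ck_on_bilinear:
  assumes "open S" "bounded_bilinear bp" "Ck_on k S f" "Ck_on k S g"
  shows "Ck_on k S (\<lambda>x. bp (f x) (g x))"
  using assms(3,4)
proof (induction k arbitrary: f g)
  case 0
  then show ?case using assms by (auto intro: bounded_bilinear.continuous_on)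
next
  case (Suc k)
  show ?case
  proof (rule Ck_on_SucI[OF assms(1), where f'="\<lambda>x v. bp (f x) (fderiv g x v) + bp (fderiv f x v) (g x)"])
    fix x assume "x \<in> S"
    then show "((\<lambda>x. bp (f x) (g x)) has_derivative
       (\<lambda>v. bp (f x) (fderiv g x v) + bp (fderiv f x v) (g x))) (at x)"
      using Suc.prems by (intro bounded_bilinear.FDERIV[OF assms(2)] Ck_on_has_derivative) 
  next
    fix v
    show "Ck_on k S (\<lambda>x. bp (f x) (fderiv g x v) + bp (fderiv f x v) (g x))"
      using Suc.prems
      by (intro Ck_on_add[OF assms(1)] Suc.IH Ck_on_Suc_deriv Ck_on_SucD[of k S f] Ck_on_SucD[of k S g])
  qed
qed

text \<open>\<open>Ck_on\<close> controls derivatives in fixed directions; a direction that depends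
  on the point is therefore expanded in the basis, whose vectors are fixed.\<close>

lemma frechet_derivative_expand:
  fixes f :: "'a::euclidean_space \<Rightarrow> 'b::real_normed_vector"
  assumes "f differentiable (at x)"
  shows "fderiv f x v = (\<Sum>b\<in>Basis. (v \<bullet> b) *\<^sub>R fderiv f x b)"
proof -
  have l: "linear (fderiv f x)" using linear_frechet_derivative[OF assms] .
  have "fderiv f x v = fderiv f x (\<Sum>b\<in>Basis. (v \<bullet> b) *\<^sub>R b)"
    by (simp add: euclidean_representation)
  then show ?thesis by (simp add: linear_sum[OF l] linear_cmul[OF l])
qed

lemma Ck_on_compose:
  fixes f :: "'a::real_normed_vector \<Rightarrow> 'b::euclidean_space" and g :: "'b \<Rightarrow> 'c::real_normed_vector"
  assumes "open S" "Ck_on k T g" "Ck_on k S f" "f ` S \<subseteq> T"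
  shows "Ck_on k S (\<lambda>x. g (f x))"
  using assms(2,3)
proof (induction k arbitrary: g)
  case 0
  then show ?case using assms(4) by (auto intro: continuous_on_compose2)
next
  case (Suc k)
  show ?case
  \<comment> \<open>The chain rule gives \<open>fderiv g (f x) (fderiv f x v)\<close>, whose inner
    direction moves with \<open>x\<close>. In the basis expansion each
    \<open>fderiv g (f x) b\<close> is the composition of \<open>f\<close> with a fixed-direction
    derivative, and the induction hypothesis applies to it.\<close>
  proof (rule Ck_on_SucI[OF assms(1), where f'="\<lambda>x v. \<Sum>b\<in>Basis. (fderiv f x v \<bullet> b) *\<^sub>R fderiv g (f x) b"])
    fix x assume x: "x \<in> S"
    then have gd: "g differentiable at (f x)" using Suc.prems assms(4) by auto
    have "((\<lambda>x. g (f x)) has_derivative (\<lambda>v. fderiv g (f x) (fderiv f x v))) (at x)"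
      using x Suc.prems gd
      by (intro has_derivative_compose[where f=f and g=g] Ck_on_has_derivative) (use assms(4) in \<open>auto simp: frechet_derivative_works\<close>)
    then show "((\<lambda>x. g (f x)) has_derivative (\<lambda>v. \<Sum>b\<in>Basis. (fderiv f x v \<bullet> b) *\<^sub>R fderiv g (f x) b)) (at x)"
      by (simp add: frechet_derivative_expand[OF gd, symmetric])
  next
    fix v
    have 1: "Ck_on k S (\<lambda>x. fderiv g (f x) b)" for b
      by (rule Suc.IH[OF Ck_on_Suc_deriv[OF Suc.prems(1)] Ck_on_SucD[OF Suc.prems(2)]])
    have 2: "Ck_on k S (\<lambda>x. fderiv f x v \<bullet> b)" for b
      by (rule Ck_on_linear_comp[OF assms(1) bounded_linear_inner_left Ck_on_Suc_deriv[OF Suc.prems(2)]])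
    show "Ck_on k S (\<lambda>x. \<Sum>b\<in>Basis. (fderiv f x v \<bullet> b) *\<^sub>R fderiv g (f x) b)"
      by (rule Ck_on_sum[OF assms(1) Ck_on_bilinear[OF assms(1) bounded_bilinear_scaleR 2 1]])
  qed
qed

lemma frechet_derivative_chain:
  assumes "f differentiable (at x)" "g differentiable (at (f x))"
  shows "fderiv (\<lambda>x. g (f x)) x v
    = fderiv g (f x) (fderiv f x v)"
  using frechet_derivative_compose[of f x g] assms by (simp add: o_def)

text \<open>Joint continuity in base point and direction, again by basis expansion; it covers
  integrands such as \<open>fderiv \<phi> z (1, uf z)\<close>.\<close>

lemma continuous_on_frechet_derivative:
  fixes f :: "'a::euclidean_space \<Rightarrow> 'b::real_normed_vector"
  assumes f: "Ck_on (Suc k) S f" and g: "continuous_on A g" "g ` A \<subseteq> S" and h: "continuous_on A h"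
  shows "continuous_on A (\<lambda>a. fderiv f (g a) (h a))"
proof -
  have "continuous_on A (\<lambda>a. fderiv f (g a) b)" for b
    using continuous_on_compose2[OF Ck_on_continuous[OF Ck_on_Suc_deriv[OF f, of b]] g] .
  then have "continuous_on A (\<lambda>a. \<Sum>b\<in>Basis. (h a \<bullet> b) *\<^sub>R fderiv f (g a) b)"
    by (intro continuous_intros h)
  moreover have "fderiv f (g a) (h a)
      = (\<Sum>b\<in>Basis. (h a \<bullet> b) *\<^sub>R fderiv f (g a) b)" if "a \<in> A" for a
    by (rule frechet_derivative_expand) (use f g that in auto)
  ultimately show ?thesis by (simp cong: continuous_on_cong)
qed

lemma Ck_on_Pair:
  assumes "open S" "Ck_on k S f" "Ck_on k S g"
  shows "Ck_on k S (\<lambda>x. (f x, g x))"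
  using assms(2,3)
proof (induction k arbitrary: f g)
  case 0
  then show ?case by (auto intro: continuous_intros)
next
  case (Suc k)
  show ?case
  proof (rule Ck_on_SucI[OF assms(1), where f'="\<lambda>x v. (fderiv f x v, fderiv g x v)"])
    show "((\<lambda>x. (f x, g x)) has_derivative (\<lambda>v. (fderiv f x v, fderiv g x v))) (at x)"
      if "x \<in> S" for x
      by (rule has_derivative_Pair[OF Ck_on_has_derivative[OF Suc.prems(1) that] Ck_on_has_derivative[OF Suc.prems(2) that]])
    show "Ck_on k S (\<lambda>x. (fderiv f x v, fderiv g x v))" for v
      by (rule Suc.IH[OF Ck_on_Suc_deriv[OF Suc.prems(1)] Ck_on_Suc_deriv[OF Suc.prems(2)]])
  qed
qed

lemma has_vector_derivative_along:
  assumes "(f has_derivative f') (at (x + s *\<^sub>R v))"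
  shows "((\<lambda>s. f (x + s *\<^sub>R v)) has_vector_derivative f' v) (at s)"
proof -
  have "((\<lambda>s. x + s *\<^sub>R v) has_derivative (\<lambda>h. h *\<^sub>R v)) (at s)"
    by (auto intro!: derivative_eq_intros)
  from has_derivative_compose[OF this assms]
  have "((\<lambda>s. f (x + s *\<^sub>R v)) has_derivative (\<lambda>h. f' (h *\<^sub>R v))) (at s)" by simp
  then show ?thesis
    using linear_cmul[OF has_derivative_linear[OF assms]] by (simp add: has_vector_derivative_def)
qed

subsection \<open>Integrals over compact sets\<close>

lemma integrable_on_compact:
  fixes f :: "'a::euclidean_space \<Rightarrow> 'b::euclidean_space"
  assumes "compact K" "continuous_on K f"
  shows "f absolutely_integrable_on K" "f integrable_on K"
proof -
  have i: "set_integrable lborel K f"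
    unfolding set_integrable_def using borel_integrable_compact[OF assms] .
  then show "f integrable_on K" by (rule set_borel_integral_eq_integral)
  from i show "f absolutely_integrable_on K"
    by (auto simp: set_integrable_def integrable_completion)
qed

lemma continuous_on_slice:
  assumes "continuous_on (U \<times> K) (\<lambda>(t, x). f t x)" "t \<in> U"
  shows "continuous_on K (f t)"
proof -
  have "continuous_on K (\<lambda>x. (\<lambda>(t, x). f t x) (t, x))"
    by (rule continuous_on_compose2[OF assms(1)]) (use assms(2) in \<open>auto intro!: continuous_intros\<close>)
  then show ?thesis by simp
qed

lemma integral_const_compact:
  fixes K :: "'a::euclidean_space set" and c :: real
  assumes "compact K"
  shows "integral K (\<lambda>x. c) = c * measure lebesgue K"
  using lmeasure_integral[OF lmeasurable_compact[OF assms]] integral_mult_right[of K c "\<lambda>x. 1"] by simp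

text \<open>On a compact \<open>K\<close> joint continuity makes \<open>f t\<close> uniformly close
  to \<open>f s\<close> for \<open>t\<close> near \<open>s\<close>, so the integrals differ by at
  most that error times the measure of \<open>K\<close>.\<close>

lemma continuous_on_integral_compact:
  fixes f :: "'c::topological_space \<Rightarrow> 'a::euclidean_space \<Rightarrow> 'b::euclidean_space"
  assumes K: "compact K" and f: "continuous_on (U \<times> K) (\<lambda>(t, x). f t x)"
  shows "continuous_on U (\<lambda>t. integral K (f t))"
  unfolding continuous_on_def
proof (intro ballI tendstoI)
  fix s e assume s: "s \<in> U" and e: "(0::real) < e"
  have fc: "continuous_on K (f t)" if "t \<in> U" for t
    using continuous_on_slice[OF f that] .
  define m where "m = measure lebesgue K"
  have lm: "K \<in> lmeasurable" using K by (rule lmeasurable_compact)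
  have m: "m \<ge> 0" unfolding m_def by simp
  \<comment> \<open>The summand 1 keeps the quotient meaningful when \<open>K\<close> is a null
    set.\<close>
  define e' where "e' = e / (m + 1)"
  have e': "e' > 0" "e' * m < e" using e m by (auto simp: e'_def field_simps)
  obtain X0 where X0: "s \<in> X0" "open X0" "\<forall>t\<in>X0 \<inter> U. \<forall>x\<in>K. dist (f t x) (f s x) \<le> e'"
    by (rule continuous_on_prod_compactE[OF f K s e'(1)]) simp
  have "dist (integral K (f t)) (integral K (f s)) < e" if t: "t \<in> X0 \<inter> U" for t
  proof -
    have i: "f t integrable_on K" "f s integrable_on K"
      using integrable_on_compact(2)[OF K] fc t s by auto
    have "norm (integral K (\<lambda>x. f t x - f s x)) \<le> integral K (\<lambda>x. e')"
      by (rule integral_norm_bound_integral[OF integrable_diff[OF i] integrable_on_const[OF lm]])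
        (use X0(3) t in \<open>auto simp: dist_norm\<close>)
    also have "\<dots> = e' * m" unfolding m_def by (rule integral_const_compact[OF K])
    finally show ?thesis using e' i by (simp add: dist_norm integral_diff)
  qed
  with X0(1,2) show "\<forall>\<^sub>F t in at s within U. dist (integral K (f t)) (integral K (f s)) < e"
    unfolding eventually_at_topological by blast
qed

text \<open>Near \<open>e0\<close> the derivative is within \<open>e'\<close> of
  \<open>f' e0\<close>, uniformly on \<open>K\<close>. The mean value inequality turns this into a
  linearization error of \<open>norm (y - e0) * e'\<close> at each point, and integrating over
  \<open>K\<close> multiplies it by a constant only.\<close>

lemma has_vector_derivative_integral_compact:
  fixes f :: "real \<Rightarrow> 'a::euclidean_space \<Rightarrow> 'b::euclidean_space"
  assumes K: "compact K" and U: "open U" "e0 \<in> U"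
    and f: "\<And>e. e \<in> U \<Longrightarrow> continuous_on K (f e)"
    and d: "\<And>e x. e \<in> U \<Longrightarrow> x \<in> K \<Longrightarrow> ((\<lambda>e. f e x) has_vector_derivative f' e x) (at e)"
    and f': "continuous_on (U \<times> K) (\<lambda>(e, x). f' e x)"
  shows "((\<lambda>e. integral K (f e)) has_vector_derivative integral K (f' e0)) (at e0)"
proof -
  have f'c: "continuous_on K (f' e0)"
    using continuous_on_slice[OF f' U(2)] .
  define m where "m = measure lebesgue K"
  have lm: "K \<in> lmeasurable" using K by (rule lmeasurable_compact)
  have m: "m \<ge> 0" unfolding m_def by simp
  have "\<exists>d>0. \<forall>y. norm (y - e0) < d \<longrightarrow> norm (integral K (f y) - integral K (f e0) - (y - e0) *\<^sub>R integral K (f' e0)) \<le> e * norm (y - e0)"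
    if e: "e > 0" for e
  proof -
    define e' where "e' = e / (m + 1)"
    have e': "e' > 0" "e' * m \<le> e" using e m by (auto simp: e'_def field_simps)
    obtain X0 where X0: "e0 \<in> X0" "open X0" "\<forall>t\<in>X0 \<inter> U. \<forall>x\<in>K. dist (f' t x) (f' e0 x) \<le> e'"
      by (rule continuous_on_prod_compactE[OF f' K U(2) e'(1)]) simp
    obtain r where r: "r > 0" "ball e0 r \<subseteq> X0 \<inter> U" using X0 U open_Int by (meson IntI openE)
    have "norm (integral K (f y) - integral K (f e0) - (y - e0) *\<^sub>R integral K (f' e0)) \<le> e * norm (y - e0)"
      if y: "norm (y - e0) < r" for y
    proof -
      have yb: "y \<in> ball e0 r" "e0 \<in> ball e0 r" using y r by (auto simp: dist_norm norm_minus_commute)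
      then have yU: "y \<in> U" using r by auto
      have i: "f y integrable_on K" "f e0 integrable_on K" "f' e0 integrable_on K"
        using integrable_on_compact(2)[OF K] f f'c yU U by auto
      have p: "norm (f y x - f e0 x - (y - e0) *\<^sub>R f' e0 x) \<le> norm (y - e0) * e'" if x: "x \<in> K" for x
      proof (rule vector_differentiable_bound_linearization[where S="ball e0 r"])
        show "((\<lambda>e. f e x) has_vector_derivative f' z x) (at z within ball e0 r)" if "z \<in> ball e0 r" for z
          using d[of z x] that r(2) x by (blast intro: has_vector_derivative_at_within)
        show "closed_segment e0 y \<subseteq> ball e0 r" using yb closed_segment_subset convex_ball by blast
        show "norm (f' z x - f' e0 x) \<le> e'" if "z \<in> ball e0 r" for z
          using X0(3) r(2) that x unfolding dist_norm by blast
      qed (use yb in auto)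
      have "norm (integral K (\<lambda>x. f y x - f e0 x - (y - e0) *\<^sub>R f' e0 x)) \<le> integral K (\<lambda>x. norm (y - e0) * e')"
        by (rule integral_norm_bound_integral[OF integrable_diff[OF integrable_diff[OF i(1,2)] integrable_cmul[OF i(3)]] integrable_on_const[OF lm] p])
      also have "\<dots> = norm (y - e0) * (e' * m)"
        unfolding m_def by (simp add: integral_const_compact[OF K])
      also have "\<dots> \<le> norm (y - e0) * e" using e' by (intro mult_left_mono) auto
      also have "integral K (\<lambda>x. f y x - f e0 x - (y - e0) *\<^sub>R f' e0 x)
          = integral K (f y) - integral K (f e0) - (y - e0) *\<^sub>R integral K (f' e0)"
        using i by (simp add: integral_diff integrable_diff integrable_cmul)
      finally show ?thesis by (simp add: mult.commute)
    qed
    then show ?thesis using r(1) by blast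
  qed
  then show ?thesis
    unfolding has_vector_derivative_def has_derivative_at_alt
    using bounded_linear_scaleR_left by blast
qed

section \<open>Symmetry of second derivatives\<close>

lemma frechet_derivative_eqI: "(f has_derivative f') (at x) \<Longrightarrow> fderiv f x v = f' v"
  using frechet_derivative_at by metis

text \<open>Differentiating \<open>\<integral>\<^sub>0\<^sup>h D\<^sub>v f(x + s v + t w) ds = f(x + h v + t w) - f(x + t w)\<close> in \<open>t\<close>
  shows that both mixed derivatives have the same integral over \<open>{0..h}\<close> for all small \<open>h\<close>.\<close>

lemma frechet_derivative_commute:
  fixes f :: "'a::euclidean_space \<Rightarrow> 'b::euclidean_space"
  assumes S: "open S" "x \<in> S" and f: "Ck_on 2 S f"
  shows "fderiv (\<lambda>y. fderiv f y v) x w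
       = fderiv (\<lambda>y. fderiv f y w) x v"
proof -
  define g where "g v = (\<lambda>y. fderiv f y v)" for v
  have f2: "Ck_on (Suc (Suc 0)) S f" using f by (simp only: numeral_2_eq_2)
  have g: "Ck_on (Suc 0) S (g v)" for v unfolding g_def by (rule Ck_on_Suc_deriv[OF f2])
  obtain r where r: "r > 0" "ball x r \<subseteq> S" using S openE by blast
  \<comment> \<open>With this \<open>d\<close> the whole parallelogram of points
    \<open>x + s v + t w\<close>, \<open>s\<close> and \<open>t\<close> at most \<open>d\<close> in
    absolute value, stays inside \<open>ball x r\<close>.\<close>
  define d where "d = r / (norm v + norm w + 1)"
  have np: "norm v + norm w + 1 > 0" by (simp add: add_nonneg_pos)
  then have d: "d > 0" using r by (simp add: d_def)
  have "d * (norm v + norm w + 1) = r" using np by (simp add: d_def)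
  then have dr: "d * (norm v + norm w) < r" using d by (simp add: algebra_simps)
  have inS: "x + s *\<^sub>R v + t *\<^sub>R w \<in> S" if "\<bar>s\<bar> \<le> d" "\<bar>t\<bar> \<le> d" for s t
  proof -
    have "norm (s *\<^sub>R v + t *\<^sub>R w) \<le> \<bar>s\<bar> * norm v + \<bar>t\<bar> * norm w"
      by (metis norm_scaleR norm_triangle_ineq)
    also have "\<dots> \<le> d * norm v + d * norm w"
      by (intro add_mono mult_right_mono) (use that in auto)
    finally have "norm (s *\<^sub>R v + t *\<^sub>R w) < r" using dr by (simp add: algebra_simps)
    then have "x + s *\<^sub>R v + t *\<^sub>R w \<in> ball x r"
      by (metis add.assoc add_diff_cancel_left' dist_commute dist_norm mem_ball)
    then show ?thesis using r by blast
  qed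
  have inS1: "x + s *\<^sub>R v \<in> S" if "\<bar>s\<bar> \<le> d" for s
    using inS[of s 0] that d by simp
  define A where "A s = fderiv (g v) (x + s *\<^sub>R v) w" for s
  define B where "B s = fderiv (g w) (x + s *\<^sub>R v) v" for s
  have Ac: "continuous_on {0..d} A" unfolding A_def
    by (rule continuous_on_frechet_derivative[OF g])
      (use inS1 in \<open>auto intro!: continuous_intros\<close>)
  have Bc: "continuous_on {0..d} B" unfolding B_def
    by (rule continuous_on_frechet_derivative[OF g])
      (use inS1 in \<open>auto intro!: continuous_intros\<close>)
  have eq: "integral {0..h} A = integral {0..h} B" if h: "h \<in> {0..d}" for h
  proof -
    have fd: "(f has_derivative fderiv f y) (at y)" if "y \<in> S" for y
      by (rule Ck_on_has_derivative[OF f2 that])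
    have gd: "(g v' has_derivative fderiv (g v') y) (at y)" if "y \<in> S" for y v'
      by (rule Ck_on_has_derivative[OF g that])
    have B: "(B has_integral g w (x + h *\<^sub>R v) - g w (x + 0 *\<^sub>R v)) {0..h}"
    proof (rule fundamental_theorem_of_calculus)
      show "((\<lambda>s. g w (x + s *\<^sub>R v)) has_vector_derivative B s) (at s within {0..h})" if "s \<in> {0..h}" for s
        unfolding B_def
        by (rule has_vector_derivative_at_within, rule has_vector_derivative_along, rule gd, rule inS1)
          (use that h in auto)
    qed (use h in auto)
    define U where "U = {-d<..<d}"
    have FT: "integral {0..h} (\<lambda>s. g v (x + s *\<^sub>R v + t *\<^sub>R w)) = f (x + h *\<^sub>R v + t *\<^sub>R w) - f (x + t *\<^sub>R w)"
      if t: "t \<in> U" for t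
    proof -
      have "((\<lambda>s. g v ((x + t *\<^sub>R w) + s *\<^sub>R v)) has_integral f ((x + t *\<^sub>R w) + h *\<^sub>R v) - f ((x + t *\<^sub>R w) + 0 *\<^sub>R v)) {0..h}"
      proof (rule fundamental_theorem_of_calculus)
        show "((\<lambda>s. f (x + t *\<^sub>R w + s *\<^sub>R v)) has_vector_derivative g v (x + t *\<^sub>R w + s *\<^sub>R v)) (at s within {0..h})"
          if "s \<in> {0..h}" for s
          unfolding g_def
          by (rule has_vector_derivative_at_within, rule has_vector_derivative_along, rule fd)
            (use that h t inS[of s t] in \<open>auto simp: U_def algebra_simps\<close>)
      qed (use h in auto)
      then show ?thesis by (simp add: integral_unique add.commute add.left_commute)
    qed
    have L: "((\<lambda>t. integral {0..h} (\<lambda>s. g v (x + s *\<^sub>R v + t *\<^sub>R w))) has_vector_derivative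
        integral {0..h} (\<lambda>s. fderiv (g v) (x + s *\<^sub>R v + 0 *\<^sub>R w) w)) (at 0)"
    proof (rule has_vector_derivative_integral_compact[where U=U])
      show "continuous_on {0..h} (\<lambda>s. g v (x + s *\<^sub>R v + e *\<^sub>R w))" if "e \<in> U" for e
        by (rule continuous_on_compose2[OF Ck_on_continuous[OF g[of v]]])
          (use that h inS in \<open>auto intro!: continuous_intros simp: U_def\<close>)
      show "((\<lambda>e. g v (x + s *\<^sub>R v + e *\<^sub>R w)) has_vector_derivative
          fderiv (g v) (x + s *\<^sub>R v + e *\<^sub>R w) w) (at e)" if "e \<in> U" "s \<in> {0..h}" for e s
        by (rule has_vector_derivative_along, rule gd) (use that h inS[of s e] in \<open>auto simp: U_def\<close>)
      show "continuous_on (U \<times> {0..h}) (\<lambda>(e, s). fderiv (g v) (x + s *\<^sub>R v + e *\<^sub>R w) w)"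
        unfolding case_prod_beta
        by (rule continuous_on_frechet_derivative[OF g])
          (use inS h in \<open>auto intro!: continuous_intros simp: U_def\<close>)
    qed (use d in \<open>auto simp: U_def\<close>)
    \<comment> \<open>By \<open>FT\<close> the integral is a difference of two values of
      \<open>f\<close>, so its derivative in \<open>t\<close> at 0 is the increment of
      \<open>g w\<close>, which is the integral of \<open>B\<close>.\<close>
    have "((\<lambda>t. f (x + h *\<^sub>R v + t *\<^sub>R w) - f (x + t *\<^sub>R w)) has_vector_derivative
        fderiv f (x + h *\<^sub>R v + 0 *\<^sub>R w) w - fderiv f (x + 0 *\<^sub>R w) w) (at 0)"
      by (intro has_vector_derivative_diff has_vector_derivative_along fd)
        (use S h inS1 in auto)
    moreover have "open U" "0 \<in> U" using d by (auto simp: U_def)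
    ultimately have "((\<lambda>t. integral {0..h} (\<lambda>s. g v (x + s *\<^sub>R v + t *\<^sub>R w))) has_vector_derivative
        fderiv f (x + h *\<^sub>R v + 0 *\<^sub>R w) w - fderiv f (x + 0 *\<^sub>R w) w) (at 0)"
      using FT by (auto intro: has_vector_derivative_transform_within_open)
    from vector_derivative_unique_at[OF L this]
    have "integral {0..h} A = g w (x + h *\<^sub>R v) - g w x"
      unfolding A_def g_def by simp
    then show ?thesis using B by (simp add: integral_unique)
  qed
  \<comment> \<open>Differentiating the equal integrals in their upper limit at
    \<open>h = 0\<close>, one-sidedly because \<open>eq\<close> covers \<open>{0..d}\<close>,
    recovers the integrands at the base point.\<close>
  have "((\<lambda>h. integral {0..h} A) has_vector_derivative A 0) (at 0 within cbox 0 d)"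
    using integral_has_vector_derivative[OF Ac, of 0] d by simp
  moreover have "((\<lambda>h. integral {0..h} B) has_vector_derivative B 0) (at 0 within cbox 0 d)"
    using integral_has_vector_derivative[OF Bc, of 0] d by simp
  then have "((\<lambda>h. integral {0..h} A) has_vector_derivative B 0) (at 0 within cbox 0 d)"
    by (rule has_vector_derivative_transform[rotated 2]) (use d eq in simp_all)
  ultimately have "A 0 = B 0"
    using d by (intro vector_derivative_unique_within_closed_interval[of 0 d 0]) simp_all
  then show ?thesis by (simp add: A_def B_def g_def)
qed

section \<open>Integrals of derivatives with compact support\<close>

lemma integral_eq_integral_UNIV:
  fixes f :: "'n::euclidean_space \<Rightarrow> 'a::banach"
  assumes "\<And>x. x \<notin> S \<Longrightarrow> f x = 0"
  shows "integral S f = integral UNIV f"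
proof -
  have "(\<lambda>x. if x \<in> S then f x else 0) = f" using assms by auto
  then show ?thesis using integral_restrict_UNIV[of S f] by simp
qed

text \<open>The gap of 1 between the radius of the support and that of the ball absorbs the shift,
  so both sides are integrals over the whole space. These are compared through boxes, the sets to
  which the shift rule is applied.\<close>

lemma integral_cball_translate:
  fixes f :: "'n::euclidean_space \<Rightarrow> 'a::banach"
  assumes f: "\<And>x. x \<notin> cball 0 (r - 1) \<Longrightarrow> f x = 0" and c: "norm c \<le> 1"
  shows "integral (cball 0 r) (\<lambda>x. f (x + c)) = integral (cball 0 r) f"
proof -
  obtain a b where ab: "cball (0::'n) r \<subseteq> cbox a b"
    using bounded_subset_cbox_symmetric[OF bounded_cball] by blast
  have z: "f (x + c) = 0" if "x \<notin> cball 0 r" for x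
  proof (rule f)
    have "norm x \<le> norm (x + c) + norm c" by (metis add_diff_cancel_right' norm_triangle_ineq4)
    then show "x + c \<notin> cball 0 (r - 1)" using that c by auto
  qed
  have z': "f x = 0" if "x \<notin> cbox (a + c) (b + c)" for x
  proof (rule f, rule notI)
    assume "x \<in> cball 0 (r - 1)"
    then have "norm (x - c) \<le> r" using c norm_triangle_ineq4[of x c] by simp
    then have "x - c \<in> cbox a b" using ab by auto
    then have "x - c + c \<in> cbox (a + c) (b + c)"
      unfolding mem_box by (simp add: inner_add_left inner_diff_left algebra_simps)
    then show False using that by simp
  qed
  have "integral (cball 0 r) (\<lambda>x. f (x + c)) = integral UNIV (\<lambda>x. f (x + c))"
    by (rule integral_eq_integral_UNIV[OF z])
  also have "\<dots> = integral (cbox a b) (\<lambda>x. f (x + c))"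
    by (rule integral_eq_integral_UNIV[symmetric]) (use z ab in blast)
  also have "\<dots> = integral (cbox (a + c) (b + c)) f"
    using integral_shift_cbox_plus[of a b f c] by (simp add: o_def add.commute)
  also have "\<dots> = integral UNIV f" by (rule integral_eq_integral_UNIV[OF z'])
  also have "\<dots> = integral (cball 0 r) f"
    by (rule integral_eq_integral_UNIV[symmetric]) (use f in auto)
  finally show ?thesis .
qed

text \<open>The integral of \<open>f(x + s v)\<close> does not depend on \<open>s\<close>.\<close>

lemma integral_derivative_compact_support:
  fixes f :: "'n::euclidean_space \<Rightarrow> 'a::euclidean_space"
  assumes f: "Ck_on 1 UNIV f" and z: "\<And>x. x \<notin> cball 0 (r - 1) \<Longrightarrow> f x = 0"
  shows "integral (cball 0 r) (\<lambda>x. fderiv f x v) = 0"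
proof -
  have f1: "Ck_on (Suc 0) UNIV f" using f by simp
  \<comment> \<open>Chosen so that a shift by \<open>s *\<^sub>R v\<close> with \<open>s\<close> in
    \<open>U\<close> has norm at most 1.\<close>
  define d where "d = 1 / (norm v + 1)"
  have np: "norm v + 1 > 0" by (simp add: add_nonneg_pos)
  then have d: "d > 0" by (simp add: d_def)
  have dr: "d * norm v \<le> 1" using np by (simp add: d_def pos_divide_le_eq)
  define U where "U = {-d<..<d}"
  have U: "open U" "0 \<in> U" using d by (auto simp: U_def)
  have "((\<lambda>s. integral (cball 0 r) (\<lambda>x. f (x + s *\<^sub>R v))) has_vector_derivative
      integral (cball 0 r) (\<lambda>x. fderiv f (x + 0 *\<^sub>R v) v)) (at 0)"
  proof (rule has_vector_derivative_integral_compact[OF _ U])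
    show "continuous_on (cball 0 r) (\<lambda>x. f (x + s *\<^sub>R v))" for s
      by (rule continuous_on_compose2[OF Ck_on_continuous[OF f1]]) (auto intro!: continuous_intros)
    show "((\<lambda>e. f (x + e *\<^sub>R v)) has_vector_derivative fderiv f (x + e *\<^sub>R v) v) (at e)" for x e
      by (intro has_vector_derivative_along Ck_on_has_derivative[OF f1]) simp
    show "continuous_on (U \<times> cball 0 r) (\<lambda>(e, x). fderiv f (x + e *\<^sub>R v) v)"
      unfolding case_prod_beta
      by (rule continuous_on_frechet_derivative[OF f1]) (auto intro!: continuous_intros)
  qed auto
  from vector_derivative_unique_at[OF this]
  have "integral (cball 0 r) (\<lambda>x. fderiv f x v) = D"
    if "((\<lambda>s. integral (cball 0 r) (\<lambda>x. f (x + s *\<^sub>R v))) has_vector_derivative D) (at 0)" for D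
    using that by simp
  moreover have "((\<lambda>s. integral (cball 0 r) (\<lambda>x. f (x + s *\<^sub>R v))) has_vector_derivative 0) (at 0)"
  proof (rule has_vector_derivative_transform_within_open[OF has_vector_derivative_const U])
    fix s assume s: "s \<in> U"
    have "norm (s *\<^sub>R v) \<le> d * norm v" using s by (auto simp: U_def intro!: mult_right_mono)
    then show "integral (cball 0 r) f = integral (cball 0 r) (\<lambda>x. f (x + s *\<^sub>R v))"
      using integral_cball_translate[where f=f and r=r and c="s *\<^sub>R v"] z dr by simp
  qed
  ultimately show ?thesis by blast
qed

subsection \<open>Test functions\<close>

text \<open>At the kink the difference quotient is bounded by \<open>\<bar>h\<bar> ^ Suc n\<close>,
  which tends to 0; away from it the function is a power or zero. Each differentiation costs one
  power.\<close>

lemma has_real_derivative_max_power: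
  "((\<lambda>s::real. max 0 s ^ Suc (Suc n)) has_real_derivative real (Suc (Suc n)) * max 0 s ^ Suc n) (at s)"
proof -
  consider "s > 0" | "s < 0" | "s = 0" by linarith
  then show ?thesis
  proof cases
    case 1
    have "((\<lambda>s::real. s ^ Suc (Suc n)) has_real_derivative real (Suc (Suc n)) * max 0 s ^ Suc n) (at s)"
      using 1 DERIV_pow[of "Suc (Suc n)" s] by simp
    then show ?thesis
      by (rule has_field_derivative_transform_within_open[where S="{0<..}"]) (use 1 in auto)
  next
    case 2
    have "((\<lambda>s::real. 0) has_real_derivative real (Suc (Suc n)) * max 0 s ^ Suc n) (at s)"
      using 2 by (auto intro!: derivative_eq_intros)
    then show ?thesis
      by (rule has_field_derivative_transform_within_open[where S="{..<0}"]) (use 2 in auto)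
  next
    case 3
    have l: "((\<lambda>h::real. \<bar>h\<bar> ^ Suc n) \<longlongrightarrow> 0) (at 0)" by (auto intro!: tendsto_eq_intros)
    have "((\<lambda>h::real. max 0 h ^ Suc (Suc n) / h) \<longlongrightarrow> 0) (at 0)"
    proof (rule Lim_null_comparison[OF always_eventually l], rule allI)
      show "norm (max 0 h ^ Suc (Suc n) / h) \<le> \<bar>h\<bar> ^ Suc n" for h :: real
      proof (cases "h > 0")
        case False
        then have m: "max 0 h = 0" by simp
        show ?thesis unfolding m by simp
      qed simp
    qed
    then show ?thesis using 3 by (simp add: has_field_derivative_iff)
  qed
qed

lemma Ck_on_max_cube: "Ck_on 2 UNIV (\<lambda>s::real. max 0 s ^ 3)"
proof -
  have 1: "((\<lambda>s::real. max 0 s ^ 3) has_derivative (\<lambda>v. 3 * max 0 s ^ 2 * v)) (at s)" for s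
    using has_real_derivative_max_power[of 1 s] by (simp add: has_field_derivative_def numeral_eq_Suc)
  have 2: "((\<lambda>s::real. 3 * max 0 s ^ 2 * v) has_derivative (\<lambda>w. 3 * (2 * max 0 s) * v * w)) (at s)" for s v
  proof -
    have "((\<lambda>s::real. 3 * max 0 s ^ 2 * v) has_real_derivative 3 * (2 * max 0 s) * v) (at s)"
    using DERIV_cmult[OF has_real_derivative_max_power[of 0 s], of "3 * v"]
      by (simp add: numeral_eq_Suc mult_ac)
    then show ?thesis unfolding has_field_derivative_def .
  qed
  show ?thesis unfolding numeral_2_eq_2
    by (rule Ck_on_SucI[OF open_UNIV 1], rule Ck_on_SucI[OF open_UNIV 2])
      (auto intro!: continuous_intros)
qed

text \<open>The truncated paraboloid, cubed: 3 is the least integer power giving class C^2, the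
  class that \<open>stationary_action\<close> asks of \<open>w\<close> and
  \<open>eta\<close>.\<close>

definition bump :: "'a::real_inner \<Rightarrow> real \<Rightarrow> 'a \<Rightarrow> real" where
  "bump z0 \<delta> z = max 0 (\<delta>\<^sup>2 - (z - z0) \<bullet> (z - z0)) ^ 3"

lemma Ck_on_bump: "Ck_on 2 UNIV (bump (z0::'a::euclidean_space) \<delta>)"
proof -
  have t: "Ck_on 2 UNIV (\<lambda>z. z + - z0)"
    by (intro Ck_on_add Ck_on_const Ck_on_linear bounded_linear_ident open_UNIV)
  have "Ck_on 2 UNIV (\<lambda>z. \<delta>\<^sup>2 + - ((z + - z0) \<bullet> (z + - z0)))"
    by (intro Ck_on_add Ck_on_const Ck_on_linear_comp[OF _ bounded_linear_minus[OF bounded_linear_ident]]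
        Ck_on_bilinear[OF _ bounded_bilinear_inner t t] open_UNIV)
  from Ck_on_compose[OF open_UNIV Ck_on_max_cube this]
  show ?thesis by (simp add: bump_def[abs_def])
qed

lemma bump_nonneg: "bump z0 \<delta> z \<ge> 0" by (simp add: bump_def)

lemma bump_center: "\<delta> > 0 \<Longrightarrow> bump z0 \<delta> z0 > 0" by (simp add: bump_def)

lemma bump_eq_0: 
  assumes "\<delta> > 0" "\<delta> \<le> dist z0 z" shows "bump z0 \<delta> z = 0"
proof -
  have "\<delta>\<^sup>2 \<le> (dist z0 z)\<^sup>2" using assms by (intro power_mono) auto
  then show ?thesis by (simp add: bump_def dist_norm norm_minus_commute dot_square_norm)
qed

text \<open>The closed ball is the closure of the open one and has the same finite positive measure,
  so the zero set extends from the interior to the sphere.\<close>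

lemma integral_0_imp_0_cball:
  fixes f :: "'n::euclidean_space \<Rightarrow> real"
  assumes "continuous_on (cball a r) f" "\<And>x. x \<in> cball a r \<Longrightarrow> f x \<ge> 0" "integral (cball a r) f = 0"
    and "r > 0" "x \<in> cball a r"
  shows "f x = 0"
proof -
  have c: "closure (ball a r) = cball a r" using assms(4) by simp
  have i: "f integrable_on cball a r" by (rule integrable_on_compact) (use assms in auto)
  show ?thesis
  proof (rule has_integral_0_closure_imp_0[of "ball a r" f])
    show "(f has_integral 0) (closure (ball a r))"
      unfolding c using i assms(3) by (metis has_integral_integral)
    show "0 < emeasure lborel (ball a r)"
      using content_ball_pos[OF assms(4), of a] emeasure_lborel_ball_finite[of a r]
      by (simp add: measure_def enn2real_positive_iff)
    show "emeasure lborel (ball a r) < \<infinity>" using emeasure_lborel_ball_finite[of a r] .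
    show "emeasure lborel (closure (ball a r)) = emeasure lborel (ball a r)"
      unfolding c using assms(4) by (simp add: emeasure_cball emeasure_ball)
  qed (use assms c ball_subset_cball in \<open>auto simp: subset_iff\<close>)
qed


subsection \<open>The weak Euler--Lagrange equation\<close>

lemma has_derivative_slice:
  assumes "(F has_derivative F') (at (t, x))"
  shows "((\<lambda>x. F (t, x)) has_derivative (\<lambda>v. F' (0, v))) (at x)"
proof -
  have "((\<lambda>x. (t, x)) has_derivative (\<lambda>v. (0, v))) (at x)" by (auto intro!: derivative_eq_intros)
  from has_derivative_compose[OF this assms] show ?thesis by simp
qed

lemma has_vector_derivative_slice:
  assumes "(F has_derivative F') (at (t, x))"
  shows "((\<lambda>s. F (s, x)) has_vector_derivative F' (1, 0)) (at t)"
proof -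
  have "((\<lambda>s. (s, x)) has_derivative (\<lambda>h. h *\<^sub>R (1, 0))) (at t)" by (auto intro!: derivative_eq_intros)
  from has_derivative_compose[OF this assms] show ?thesis
    unfolding linear_cmul[OF has_derivative_linear[OF assms]] has_vector_derivative_def .
qed

lemma Ck_on_slice:
  fixes F :: "'a::euclidean_space \<times> 'b::euclidean_space \<Rightarrow> 'c::real_normed_vector"
  assumes "Ck_on k (A \<times> B) F" "open B" "t \<in> A"
  shows "Ck_on k B (\<lambda>x. F (t, x))"
proof (rule Ck_on_compose[OF assms(2,1)])
  show "Ck_on k B (\<lambda>x. (t, x))"
    by (intro Ck_on_Pair Ck_on_const Ck_on_linear bounded_linear_ident assms(2))
qed (use assms(3) in auto)

text \<open>An iterated integral, to match \<open>action\<close> literally; the order of integration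
  is never exchanged.\<close>

definition st_integral :: "real \<Rightarrow> real \<Rightarrow> real \<Rightarrow> (real \<times> 'a::euclidean_space \<Rightarrow> real) \<Rightarrow> real" where
  "st_integral t1 t2 r g = integral {t1..t2} (\<lambda>t. integral (cball 0 r) (\<lambda>x. g (t, x)))"

lemma continuous_on_st_slice:
  assumes "continuous_on (U \<times> K) g" "t \<in> U"
  shows "continuous_on K (\<lambda>x. g (t, x))"
  by (rule continuous_on_slice[where f="\<lambda>t x. g (t, x)" and U=U]) (use assms in auto)

lemma st_integral_inner_integrable:
  fixes g :: "real \<times> 'a::euclidean_space \<Rightarrow> real"
  assumes "continuous_on ({t1..t2} \<times> cball 0 r) g" "t \<in> {t1..t2}"
  shows "(\<lambda>x. g (t, x)) integrable_on cball 0 (r::real)"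
  by (rule integrable_on_compact(2)[OF _ continuous_on_st_slice[OF assms]]) simp

lemma st_integral_outer_continuous:
  fixes g :: "real \<times> 'a::euclidean_space \<Rightarrow> real"
  assumes "continuous_on ({t1..t2} \<times> cball 0 r) g"
  shows "continuous_on {t1..t2} (\<lambda>t. integral (cball 0 (r::real)) (\<lambda>x. g (t, x)))"
  using assms by (intro continuous_on_integral_compact[where f="\<lambda>t x. g (t, x)"]) auto

lemma st_integral_add:
  assumes "continuous_on ({t1..t2} \<times> cball 0 r) g" "continuous_on ({t1..t2} \<times> cball 0 r) h"
  shows "st_integral t1 t2 r (\<lambda>z. g z + h z) = st_integral t1 t2 r g + st_integral t1 t2 r h"
proof -
  have "st_integral t1 t2 r (\<lambda>z. g z + h z) = integral {t1..t2} (\<lambda>t. integral (cball 0 r) (\<lambda>x. g (t, x))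
      + integral (cball 0 r) (\<lambda>x. h (t, x)))"
    unfolding st_integral_def
    by (intro integral_cong integral_add st_integral_inner_integrable[OF assms(1)] st_integral_inner_integrable[OF assms(2)])
  also have "\<dots> = st_integral t1 t2 r g + st_integral t1 t2 r h"
    unfolding st_integral_def
    by (intro integral_add integrable_continuous_interval st_integral_outer_continuous assms)
  finally show ?thesis .
qed

lemma st_integral_cmult: "st_integral t1 t2 r (\<lambda>z. c * g z) = c * st_integral t1 t2 r g"
  by (simp add: st_integral_def)

lemma st_integral_diff:
  assumes "continuous_on ({t1..t2} \<times> cball 0 r) g" "continuous_on ({t1..t2} \<times> cball 0 r) h"
  shows "st_integral t1 t2 r (\<lambda>z. g z - h z) = st_integral t1 t2 r g - st_integral t1 t2 r h"
  using st_integral_add[OF assms(1), of "\<lambda>z. - 1 * h z"] st_integral_cmult[of t1 t2 r "-1" h] assms(2)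
  by (simp add: continuous_on_minus)

lemma st_integral_sum:
  assumes "\<And>k. k \<in> I \<Longrightarrow> continuous_on ({t1..t2} \<times> cball 0 r) (g k)"
  shows "st_integral t1 t2 r (\<lambda>z. \<Sum>k\<in>I. g k z) = (\<Sum>k\<in>I. st_integral t1 t2 r (g k))"
  using assms
proof (induction I rule: infinite_finite_induct)
  case (insert k I)
  have "st_integral t1 t2 r (\<lambda>z. g k z + (\<Sum>k\<in>I. g k z))
      = st_integral t1 t2 r (g k) + st_integral t1 t2 r (\<lambda>z. \<Sum>k\<in>I. g k z)"
    using insert.prems by (intro st_integral_add continuous_on_sum) auto
  then show ?case using insert by simp
qed (simp_all add: st_integral_def)

lemma st_integral_cong:
  assumes "\<And>t x. t \<in> {t1..t2} \<Longrightarrow> x \<in> cball 0 r \<Longrightarrow> g (t, x) = h (t, x)"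
  shows "st_integral t1 t2 r g = st_integral t1 t2 r h"
  unfolding st_integral_def using assms by (intro integral_cong) blast

lemma st_integral_space_derivative:
  fixes F :: "real \<times> 'a::euclidean_space \<Rightarrow> real"
  assumes F: "Ck_on 1 (T \<times> UNIV) F" and T: "{t1..t2} \<subseteq> T"
    and z: "\<And>t x. t \<in> T \<Longrightarrow> x \<notin> cball 0 (r - 1) \<Longrightarrow> F (t, x) = 0"
  shows "st_integral t1 t2 r (\<lambda>z. fderiv F z (0, v)) = 0"
proof -
  have "integral (cball 0 r) (\<lambda>x. fderiv F (t, x) (0, v)) = 0" if t: "t \<in> {t1..t2}" for t
  proof -
    have "fderiv F (t, x) (0, v) = fderiv (\<lambda>x. F (t, x)) x v" for x
    proof -
      have "(F has_derivative fderiv F (t, x)) (at (t, x))"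
        by (rule Ck_on_has_derivative[of 0 "T \<times> UNIV"]) (use F T t in auto)
      from frechet_derivative_eqI[OF has_derivative_slice[OF this]] show ?thesis by simp
    qed
    moreover have "integral (cball 0 r) (\<lambda>x. fderiv (\<lambda>x. F (t, x)) x v) = 0"
      by (rule integral_derivative_compact_support[OF Ck_on_slice[OF F open_UNIV]]) (use T t z in auto)
    ultimately show ?thesis by simp
  qed
  then have "st_integral t1 t2 r (\<lambda>z. fderiv F z (0, v)) = integral {t1..t2} (\<lambda>t. 0)"
    unfolding st_integral_def by (intro integral_cong) simp
  then show ?thesis by simp
qed

text \<open>The integral over the fixed ball is a function of time whose derivative is found under
  the integral sign; the fundamental theorem of calculus does the rest.\<close>

lemma st_integral_time_derivative:
  fixes F :: "real \<times> 'a::euclidean_space \<Rightarrow> real"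
  assumes F: "Ck_on 1 (T \<times> UNIV) F" and T: "{t1..t2} \<subseteq> T" "open T" "t1 \<le> t2"
  shows "st_integral t1 t2 r (\<lambda>z. fderiv F z (1, 0))
    = integral (cball 0 r) (\<lambda>x. F (t2, x)) - integral (cball 0 r) (\<lambda>x. F (t1, x))"
  unfolding st_integral_def
proof (rule integral_unique, rule fundamental_theorem_of_calculus)
  fix t assume t: "t \<in> {t1..t2}"
  have F1: "Ck_on (Suc 0) (T \<times> UNIV) F" using F by simp
  have "((\<lambda>t. integral (cball 0 r) (\<lambda>x. F (t, x))) has_vector_derivative
      integral (cball 0 r) (\<lambda>x. fderiv F (t, x) (1, 0))) (at t)"
  proof (rule has_vector_derivative_integral_compact[OF compact_cball T(2)])
    show "t \<in> T" using t T by auto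
    show "continuous_on (cball 0 r) (\<lambda>x. F (e, x))" if "e \<in> T" for e
      by (rule continuous_on_subset[OF continuous_on_st_slice[OF Ck_on_continuous[OF F] that]]) simp
    show "((\<lambda>e. F (e, x)) has_vector_derivative fderiv F (e, x) (1, 0)) (at e)" if "e \<in> T" for e x
      by (rule has_vector_derivative_slice, rule Ck_on_has_derivative[OF F1]) (use that in auto)
    show "continuous_on (T \<times> cball 0 r) (\<lambda>(e, x). fderiv F (e, x) (1, 0))"
      unfolding case_prod_beta prod.collapse
      by (rule continuous_on_frechet_derivative[OF F1]) (auto intro!: continuous_intros)
  qed
  then show "((\<lambda>t. integral (cball 0 r) (\<lambda>x. F (t, x))) has_vector_derivative
      integral (cball 0 r) (\<lambda>x. fderiv F (t, x) (1, 0))) (at t within {t1..t2})"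
    by (rule has_vector_derivative_at_within)
qed (use T in auto)

text \<open>The positivity argument runs twice: the inner integral is a nonnegative continuous
  function of time with integral 0, hence 0 at every time, and then the integrand is 0 on the
  ball.\<close>

lemma st_integral_nonneg_0_imp_0:
  fixes g :: "real \<times> 'a::euclidean_space \<Rightarrow> real"
  assumes c: "continuous_on ({t1..t2} \<times> cball 0 r) g"
    and n: "\<And>t x. t \<in> {t1..t2} \<Longrightarrow> x \<in> cball 0 r \<Longrightarrow> g (t, x) \<ge> 0"
    and z: "st_integral t1 t2 r g = 0" and p: "t1 < t2" "r > 0"
    and t: "t \<in> {t1..t2}" and x: "x \<in> cball 0 r"
  shows "g (t, x) = 0"
proof -
  have "integral (cball 0 r) (\<lambda>x. g (t, x)) = 0"
  proof (rule has_integral_0_cbox_imp_0[where a=t1 and b=t2 and x=t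
        and f="\<lambda>t. integral (cball 0 r) (\<lambda>x. g (t, x))"])
    show "continuous_on (cbox t1 t2) (\<lambda>t. integral (cball 0 r) (\<lambda>x. g (t, x)))"
      using st_integral_outer_continuous[OF c] by simp
    show "0 \<le> integral (cball 0 r) (\<lambda>x. g (t, x))" if "t \<in> box t1 t2" for t
      by (rule integral_nonneg[OF st_integral_inner_integrable[OF c]]) (use that n in auto)
    show "((\<lambda>t. integral (cball 0 r) (\<lambda>x. g (t, x))) has_integral 0) (cbox t1 t2)"
      using z integrable_integral[OF integrable_continuous_interval[OF st_integral_outer_continuous[OF c]]]
      by (simp add: st_integral_def)
  qed (use p t in auto)
  then show ?thesis
    by (rule integral_0_imp_0_cball[OF continuous_on_st_slice[OF c t] n[OF t] _ p(2) x, rotated])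
qed

text \<open>The fundamental lemma of the calculus of variations: a bump concentrated where
  \<open>h\<close> keeps its sign would produce a nonzero integral.\<close>

lemma weak_zero_imp_zero:
  fixes h :: "real \<times> 'a::euclidean_space \<Rightarrow> real"
  assumes h: "continuous_on ({t1..t2} \<times> UNIV) h" and t12: "t1 < t2"
    and z: "\<And>z0 \<delta>. \<delta> > 0 \<Longrightarrow> fst z0 - \<delta> > t1 \<Longrightarrow> fst z0 + \<delta> < t2 \<Longrightarrow>
      st_integral t1 t2 (norm (snd z0) + \<delta> + 1) (\<lambda>z. h z * bump z0 \<delta> z) = 0"
    and t: "t \<in> {t1..t2}"
  shows "h (t, x) = 0"
proof -
  have bc: "continuous_on A (bump z0 \<delta>)" for A \<delta> and z0 :: "real \<times> 'a"
    using Ck_on_continuous[OF Ck_on_bump] continuous_on_subset by blast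
  have o: "h (t, x) = 0" if t: "t \<in> {t1<..<t2}" for t
  proof (rule ccontr)
    assume ne: "h (t, x) \<noteq> 0"
    define z0 where "z0 = (t, x)"
    \<comment> \<open>The factor \<open>h z0\<close> makes the function positive near
      \<open>z0\<close>, whatever the sign of \<open>h\<close> there.\<close>
    define g where "g z = h z0 * h z" for z
    have gc: "continuous_on ({t1..t2} \<times> UNIV) g" unfolding g_def by (intro continuous_intros h)
    have gp: "g z0 > 0" using ne by (auto simp: g_def z0_def zero_less_mult_iff)
    have op: "open ({t1<..<t2} \<times> (UNIV :: 'a set))" by (intro open_Times) auto
    have "continuous_on ({t1<..<t2} \<times> UNIV) g" by (rule continuous_on_subset[OF gc]) auto
    then have "isCont g z0" using op t by (auto simp: continuous_on_eq_continuous_at z0_def)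
    then obtain d where d: "d > 0" "\<And>z. dist z z0 < d \<Longrightarrow> dist (g z) (g z0) < g z0"
      using gp unfolding continuous_at_eps_delta by blast
    \<comment> \<open>Half the distances to \<open>t1\<close> and \<open>t2\<close>, because the
      bump has to stay strictly inside the time interval.\<close>
    define \<delta> where "\<delta> = min d (min ((t - t1) / 2) ((t2 - t) / 2))"
    have \<delta>: "\<delta> > 0" "\<delta> \<le> d" "\<delta> \<le> (t - t1) / 2" "\<delta> \<le> (t2 - t) / 2" using d t by (auto simp: \<delta>_def min_def)
    define r where "r = norm x + \<delta> + 1"
    have "st_integral t1 t2 r (\<lambda>z. h z * bump z0 \<delta> z) = 0"
      using z[of \<delta> z0] \<delta> t by (simp add: z0_def r_def)
    then have i: "st_integral t1 t2 r (\<lambda>z. g z * bump z0 \<delta> z) = 0"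
      using st_integral_cmult[of t1 t2 r "h z0" "\<lambda>z. h z * bump z0 \<delta> z"] by (simp add: g_def mult.assoc)
    have nn: "g z * bump z0 \<delta> z \<ge> 0" for z
    proof (cases "\<delta> \<le> dist z0 z")
      case True
      then show ?thesis using bump_eq_0[OF \<delta>(1) True] by simp
    next
      case False
      then have "g z > 0" using d(2)[of z] \<delta> by (auto simp: dist_commute dist_real_def)
      then show ?thesis using bump_nonneg[of z0 \<delta> z] by simp
    qed
    have "g (t, x) * bump z0 \<delta> (t, x) = 0"
    proof (rule st_integral_nonneg_0_imp_0[OF _ _ i t12])
      show "continuous_on ({t1..t2} \<times> cball 0 r) (\<lambda>z. g z * bump z0 \<delta> z)"
        by (intro continuous_on_mult bc continuous_on_subset[OF gc]) auto
    qed (use nn \<delta> t in \<open>auto simp: r_def add_nonneg_pos\<close>)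
    then show False using gp bump_center[OF \<delta>(1), of z0] by (simp add: z0_def)
  qed
  \<comment> \<open>Bumps never reach the endpoints, so \<open>t1\<close> and \<open>t2\<close> are
    handled by continuity.\<close>
  have hc: "continuous_on (closure {t1<..<t2}) (\<lambda>t. h (t, x))"
    using t12 by (auto intro!: continuous_on_compose2[OF h] continuous_intros)
  show ?thesis
    by (rule continuous_constant_on_closure[OF hc, of 0 t]) (use o t t12 in auto)
qed

definition weak_form where
  "weak_form t1 t2 r I a b e c \<phi> = st_integral t1 t2 r (\<lambda>z. a z * fderiv \<phi> z (1, 0)
    + (\<Sum>k\<in>I. b k z * fderiv \<phi> z (0, e k)) + c z * \<phi> z)"

text \<open>Support within radius \<open>r - 1\<close> leaves the unit margin used when spatial
  derivatives are integrated over \<open>cball 0 r\<close>. Class C^2 and the zeros at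
  \<open>t1\<close> and \<open>t2\<close> make constant multiples of \<open>\<phi>\<close>
  admissible as variations.\<close>

definition test_function :: "real \<Rightarrow> real \<Rightarrow> real \<Rightarrow> (real \<times> 'a::euclidean_space \<Rightarrow> real) \<Rightarrow> bool" where
  "test_function t1 t2 r \<phi> \<longleftrightarrow> Ck_on 2 UNIV \<phi> \<and> (\<forall>x. \<phi> (t1, x) = 0 \<and> \<phi> (t2, x) = 0) \<and>
    (\<forall>t. \<forall>x. x \<notin> cball 0 (r - 1) \<longrightarrow> \<phi> (t, x) = 0)"

lemma test_functionD:
  assumes "test_function t1 t2 r \<phi>"
  shows "Ck_on 2 UNIV \<phi>" "\<phi> (t1, x) = 0" "\<phi> (t2, x) = 0" "x \<notin> cball 0 (r - 1) \<Longrightarrow> \<phi> (t, x) = 0"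
  using assms by (auto simp: test_function_def)

text \<open>By the product rule the weak integrand is the space-time divergence of
  \<open>(a \<phi>, b \<phi>)\<close> plus \<open>h \<phi>\<close>, where \<open>h\<close> is
  \<open>c\<close> minus the divergence of \<open>(a, b)\<close>. The first part integrates to 0,
  and testing with bumps then forces \<open>h = 0\<close>. Only \<open>a\<close> and
  \<open>b\<close> get differentiated.\<close>

lemma weak_Euler_Lagrange:
  fixes a c :: "real \<times> 'a::euclidean_space \<Rightarrow> real" and b :: "'k \<Rightarrow> real \<times> 'a \<Rightarrow> real" and e :: "'k \<Rightarrow> 'a"
  assumes T: "open T" "{t1..t2} \<subseteq> T" "t1 < t2" and I: "finite I"
    and a: "Ck_on 1 (T \<times> UNIV) a" and b: "\<And>k. k \<in> I \<Longrightarrow> Ck_on 1 (T \<times> UNIV) (b k)"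
    and c: "continuous_on (T \<times> UNIV) c"
    and weak: "\<And>\<phi> r. test_function t1 t2 r \<phi> \<Longrightarrow> weak_form t1 t2 r I a b e c \<phi> = 0"
    and t: "t \<in> {t1..t2}"
  shows "c (t, x) = fderiv a (t, x) (1, 0) + (\<Sum>k\<in>I. fderiv (b k) (t, x) (0, e k))"
proof -
  have oT: "open (T \<times> (UNIV :: 'a set))" using T by (intro open_Times) auto
  have a1: "Ck_on (Suc 0) (T \<times> UNIV) a" and b1: "\<And>k. k \<in> I \<Longrightarrow> Ck_on (Suc 0) (T \<times> UNIV) (b k)"
    using a b by simp_all
  define h where "h z = c z - fderiv a z (1, 0) - (\<Sum>k\<in>I. fderiv (b k) z (0, e k))" for z
  have sub: "continuous_on ({t1..t2} \<times> A) f" if "continuous_on (T \<times> UNIV) f" for A and f :: "real \<times> 'a \<Rightarrow> real"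
    using that T by (auto elim!: continuous_on_subset)
  have hc: "continuous_on (T \<times> UNIV) h"
    unfolding h_def using Ck_on_continuous[OF Ck_on_Suc_deriv[OF a1]] Ck_on_continuous[OF Ck_on_Suc_deriv[OF b1]]
    by (intro continuous_intros c) auto
  have "h (t, x) = 0"
  proof (rule weak_zero_imp_zero[OF sub[OF hc] T(3) _ t])
    fix z0 :: "real \<times> 'a" and \<delta> :: real
    assume \<delta>: "\<delta> > 0" "fst z0 - \<delta> > t1" "fst z0 + \<delta> < t2"
    \<comment> \<open>The bump vanishes outside the ball of radius \<open>\<delta>\<close> about
      \<open>z0\<close>, so its spatial support lies in \<open>cball 0 (r - 1)\<close>.\<close>
    define r where "r = norm (snd z0) + \<delta> + 1"
    define \<phi> where "\<phi> = bump z0 \<delta>"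
    have \<phi>2: "Ck_on 2 UNIV \<phi>" unfolding \<phi>_def by (rule Ck_on_bump)
    then have \<phi>2': "Ck_on (Suc (Suc 0)) UNIV \<phi>" by (simp only: numeral_2_eq_2)
    have \<phi>1: "Ck_on 1 (T \<times> UNIV) \<phi>" using Ck_on_subset[OF Ck_on_le[OF \<phi>2, of 1]] by simp
    have dz: "\<bar>s - fst z0\<bar> \<le> dist z0 (s, y)" "norm y - norm (snd z0) \<le> dist z0 (s, y)" for s y
    proof -
      have "dist (fst z0) s \<le> dist z0 (s, y)" using dist_fst_le[of z0 "(s, y)"] by simp
      then show "\<bar>s - fst z0\<bar> \<le> dist z0 (s, y)" by (simp add: dist_real_def)
      have "dist (snd z0) y \<le> dist z0 (s, y)" using dist_snd_le[of z0 "(s, y)"] by simp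
      then show "norm y - norm (snd z0) \<le> dist z0 (s, y)"
        using norm_triangle_ineq2[of y "snd z0"] by (simp add: dist_norm norm_minus_commute)
    qed
    have p1: "\<phi> (t1, x) = 0" "\<phi> (t2, x) = 0" for x
      unfolding \<phi>_def using \<delta> dz(1)[of t1 x] dz(1)[of t2 x] by (auto intro!: bump_eq_0)
    have p2: "\<phi> (t, x) = 0" if "x \<notin> cball 0 (r - 1)" for t x
      unfolding \<phi>_def using \<delta> dz(2)[of x t] that by (auto intro!: bump_eq_0 simp: r_def)
    have w: "st_integral t1 t2 r (\<lambda>z. a z * fderiv \<phi> z (1, 0)
        + (\<Sum>k\<in>I. b k z * fderiv \<phi> z (0, e k)) + c z * \<phi> z) = 0"
      using weak[of r \<phi>] \<phi>2 p1 p2 unfolding test_function_def weak_form_def by blast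
    have \<phi>c: "continuous_on (T \<times> UNIV) \<phi>" by (rule Ck_on_continuous[OF \<phi>1])
    have \<phi>d: "continuous_on (T \<times> UNIV) (\<lambda>z. fderiv \<phi> z v)" for v
      by (rule continuous_on_subset[OF Ck_on_continuous[OF Ck_on_Suc_deriv[OF \<phi>2']]]) simp
    have prod: "fderiv (\<lambda>z. f z * \<phi> z) z v
        = f z * fderiv \<phi> z v + fderiv f z v * \<phi> z"
      if f: "Ck_on (Suc 0) (T \<times> UNIV) f" and "z \<in> T \<times> UNIV" for f z v
    proof -
      have "((\<lambda>z. f z * \<phi> z) has_derivative (\<lambda>v. f z * fderiv \<phi> z v + fderiv f z v * \<phi> z)) (at z)"
        by (intro has_derivative_mult Ck_on_has_derivative[OF f that(2)] Ck_on_has_derivative[OF \<phi>2']) simp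
      from frechet_derivative_eqI[OF this] show ?thesis .
    qed
    have C1: "Ck_on 1 (T \<times> UNIV) (\<lambda>z. f z * \<phi> z)" if "Ck_on 1 (T \<times> UNIV) f" for f
      by (rule Ck_on_bilinear[OF oT bounded_bilinear_mult that \<phi>1])
    have dc: "continuous_on (T \<times> UNIV) (\<lambda>z. fderiv (\<lambda>z. f z * \<phi> z) z v)"
      if "Ck_on 1 (T \<times> UNIV) f" for f v
      by (rule Ck_on_continuous[OF Ck_on_Suc_deriv[of 0]]) (use C1[OF that] in simp)
    have ia: "st_integral t1 t2 r (\<lambda>z. fderiv (\<lambda>z. a z * \<phi> z) z (1, 0)) = 0"
      using st_integral_time_derivative[OF C1[OF a] T(2,1)] T(3) p1 by simp
    have ib: "st_integral t1 t2 r (\<lambda>z. fderiv (\<lambda>z. b k z * \<phi> z) z (0, e k)) = 0" if "k \<in> I" for k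
      by (rule st_integral_space_derivative[OF C1[OF b[OF that]] T(2)]) (simp add: p2)
    have ib': "st_integral t1 t2 r (\<lambda>z. \<Sum>k\<in>I. fderiv (\<lambda>z. b k z * \<phi> z) z (0, e k)) = 0"
      using ib by (subst st_integral_sum) (auto intro!: sub dc b)
    have "st_integral t1 t2 r (\<lambda>z. h z * \<phi> z)
        = st_integral t1 t2 r (\<lambda>z. (a z * fderiv \<phi> z (1, 0)
        + (\<Sum>k\<in>I. b k z * fderiv \<phi> z (0, e k)) + c z * \<phi> z)
        - (fderiv (\<lambda>z. a z * \<phi> z) z (1, 0)
        + (\<Sum>k\<in>I. fderiv (\<lambda>z. b k z * \<phi> z) z (0, e k))))"
    proof (rule st_integral_cong)
      fix t and x :: 'a assume "t \<in> {t1..t2}"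
      then have zT: "(t, x) \<in> T \<times> UNIV" using T by auto
      show "h (t, x) * \<phi> (t, x) = (a (t, x) * fderiv \<phi> (t, x) (1, 0)
        + (\<Sum>k\<in>I. b k (t, x) * fderiv \<phi> (t, x) (0, e k)) + c (t, x) * \<phi> (t, x))
        - (fderiv (\<lambda>z. a z * \<phi> z) (t, x) (1, 0)
        + (\<Sum>k\<in>I. fderiv (\<lambda>z. b k z * \<phi> z) (t, x) (0, e k)))"
        using prod[OF a1 zT] prod[OF b1 zT]
        by (simp add: h_def sum.distrib algebra_simps sum_distrib_left)
    qed
    also have "\<dots> = st_integral t1 t2 r (\<lambda>z. a z * fderiv \<phi> z (1, 0)
        + (\<Sum>k\<in>I. b k z * fderiv \<phi> z (0, e k)) + c z * \<phi> z)
        - st_integral t1 t2 r (\<lambda>z. fderiv (\<lambda>z. a z * \<phi> z) z (1, 0)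
        + (\<Sum>k\<in>I. fderiv (\<lambda>z. b k z * \<phi> z) z (0, e k)))"
      by (intro st_integral_diff sub continuous_intros dc a b c \<phi>c \<phi>d Ck_on_continuous[OF a] Ck_on_continuous[OF b])
    also have "st_integral t1 t2 r (\<lambda>z. fderiv (\<lambda>z. a z * \<phi> z) z (1, 0)
        + (\<Sum>k\<in>I. fderiv (\<lambda>z. b k z * \<phi> z) z (0, e k))) = 0"
      by (subst st_integral_add) (use ia ib' in \<open>auto intro!: sub continuous_on_sum dc a b\<close>)
    also note w
    finally show "st_integral t1 t2 (norm (snd z0) + \<delta> + 1) (\<lambda>z. h z * bump z0 \<delta> z) = 0"
      by (simp add: r_def \<phi>_def)
  qed
  then show ?thesis by (simp add: h_def)
qed

subsection \<open>Matrices\<close>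

lemma bounded_bilinear_matrix_mult: "bounded_bilinear ((**) :: mat3 \<Rightarrow> mat3 \<Rightarrow> mat3)"
  unfolding bilinear_conv_bounded_bilinear[symmetric] bilinear_def
  by (auto intro!: linearI simp: matrix_matrix_mult_def vec_eq_iff sum_distrib_left sum.distrib algebra_simps)

lemma bounded_linear_transpose: "bounded_linear (transpose :: mat3 \<Rightarrow> mat3)"
  unfolding linear_conv_bounded_linear[symmetric]
  by (rule linearI) (auto simp: transpose_def vec_eq_iff)

lemmas matrix_mult_minus_left = bounded_bilinear.minus_left[OF bounded_bilinear_matrix_mult]
lemmas matrix_mult_minus_right = bounded_bilinear.minus_right[OF bounded_bilinear_matrix_mult]
lemmas matrix_mult_diff_left = bounded_bilinear.diff_left[OF bounded_bilinear_matrix_mult]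
lemmas matrix_mult_diff_right = bounded_bilinear.diff_right[OF bounded_bilinear_matrix_mult]
lemmas matrix_mult_add_left = bounded_bilinear.add_left[OF bounded_bilinear_matrix_mult]
lemmas matrix_mult_add_right = bounded_bilinear.add_right[OF bounded_bilinear_matrix_mult]
lemmas matrix_mult_scaleR_left = bounded_bilinear.scaleR_left[OF bounded_bilinear_matrix_mult]
lemmas matrix_mult_scaleR_right = bounded_bilinear.scaleR_right[OF bounded_bilinear_matrix_mult]

lemmas matrix_mult_distribs = matrix_mult_minus_left matrix_mult_minus_right matrix_mult_diff_left
  matrix_mult_diff_right matrix_mult_add_left matrix_mult_add_right
  matrix_mult_scaleR_left matrix_mult_scaleR_right

lemma bounded_bilinear_commutator: "bounded_bilinear commutator"
  unfolding bilinear_conv_bounded_bilinear[symmetric] bilinear_def commutator_def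
  by (auto intro!: linearI simp: matrix_mult_distribs algebra_simps)

lemma linear_axis_expand:
  fixes L :: "vec3 \<Rightarrow> 'b::real_vector"
  assumes "linear L" shows "L v = (\<Sum>k\<in>UNIV. v $ k *\<^sub>R L (axis k 1))"
proof -
  have "L v = L (\<Sum>k\<in>UNIV. v $ k *\<^sub>R axis k 1)"
    using basis_expansion[of v] by (simp add: scalar_mult_eq_scaleR)
  then show ?thesis by (simp add: linear_sum[OF assms] linear_cmul[OF assms])
qed

subsection \<open>Delta integrals\<close>

lemma integrable_compact_support:
  fixes f :: "vec3 \<Rightarrow> 'b::euclidean_space"
  assumes "continuous_on UNIV f" "bounded {x. f x \<noteq> 0}"
  shows "f absolutely_integrable_on UNIV" "f integrable_on UNIV"
proof -
  obtain r where r: "{x. f x \<noteq> 0} \<subseteq> cball 0 r" using assms(2) unfolding bounded_iff by (auto simp: subset_iff)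
  have "f absolutely_integrable_on cball 0 r"
    by (rule integrable_on_compact[OF _ continuous_on_subset[OF assms(1)]]) auto
  moreover have "(\<lambda>x. if x \<in> cball 0 r then f x else 0) = f" using r by (auto simp: subset_iff fun_eq_iff)
  ultimately show a: "f absolutely_integrable_on UNIV"
    using absolutely_integrable_restrict_UNIV[of "cball 0 r" f] by simp
  then show "f integrable_on UNIV" by (simp add: absolutely_integrable_on_def)
qed

lemma bounded_bump_support: "\<delta> > 0 \<Longrightarrow> bounded {x. bump z0 \<delta> x \<noteq> 0}"
  by (rule bounded_subset[OF bounded_ball[of z0 \<delta>]]) (use bump_eq_0 in \<open>force simp: not_le[symmetric]\<close>)

lemma continuous_on_bump: "continuous_on A (bump (z0::'a::euclidean_space) \<delta>)"
  using Ck_on_continuous[OF Ck_on_bump] continuous_on_subset by blast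

text \<open>Delta integrals are tested with continuous functions, so \<open>h\<close> itself may be
  a factor of the test function; the integrand becomes \<open>h\<^sup>2\<close> times a
  bump.\<close>

lemma test_integral_zero:
  fixes h :: "vec3 \<Rightarrow> real"
  assumes h: "continuous_on UNIV h"
    and z: "\<And>\<phi>. continuous_on UNIV \<phi> \<Longrightarrow> bounded {x. \<phi> x \<noteq> 0} \<Longrightarrow> integral UNIV (\<lambda>x. \<phi> x * h x) = 0"
  shows "h x = 0"
proof -
  define \<phi> where "\<phi> y = h y * bump x 1 y" for y
  have c: "continuous_on UNIV \<phi>" unfolding \<phi>_def by (intro continuous_intros h continuous_on_bump)
  have b: "bounded {x. \<phi> x \<noteq> 0}"
    by (rule bounded_subset[OF bounded_bump_support[of 1 x]]) (auto simp: \<phi>_def)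
  have "integral (cball x 1) (\<lambda>x. \<phi> x * h x) = integral UNIV (\<lambda>x. \<phi> x * h x)"
    by (rule integral_eq_integral_UNIV) (simp add: \<phi>_def bump_eq_0)
  then have i: "integral (cball x 1) (\<lambda>x. \<phi> x * h x) = 0" using z[OF c b] by simp
  have "\<phi> x * h x = 0"
  proof (rule integral_0_imp_0_cball[OF _ _ i])
    show "continuous_on (cball x 1) (\<lambda>x. \<phi> x * h x)"
      by (intro continuous_on_mult continuous_on_subset[OF c] continuous_on_subset[OF h]) auto
    show "0 \<le> \<phi> y * h y" for y
    proof -
      have "\<phi> y * h y = (h y)\<^sup>2 * bump x 1 y" by (simp add: \<phi>_def power2_eq_square)
      then show ?thesis by (simp add: bump_nonneg)
    qed
  qed auto
  then show ?thesis using bump_center[of 1 x] by (simp add: \<phi>_def)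
qed

text \<open>The preimage lies in the image of a compact ball under the continuous map
  \<open>inv X\<close>; thus test functions pull back to test functions.\<close>

lemma bounded_preimage_support:
  fixes X :: "vec3 \<Rightarrow> vec3" and f :: "vec3 \<Rightarrow> 'b::zero"
  assumes X: "bij X" "continuous_on UNIV (inv X)" and f: "bounded {x. f x \<noteq> 0}"
  shows "bounded {x0. f (X x0) \<noteq> 0}"
proof -
  obtain r where r: "{x. f x \<noteq> 0} \<subseteq> cball 0 r" using f unfolding bounded_iff by (auto simp: subset_iff)
  have "compact (inv X ` cball 0 r)"
    by (intro compact_continuous_image continuous_on_subset[OF X(2)]) auto
  moreover have "{x0. f (X x0) \<noteq> 0} \<subseteq> inv X ` cball 0 r"
  proof
    fix x0 assume "x0 \<in> {x0. f (X x0) \<noteq> 0}"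
    then have "X x0 \<in> cball 0 r" using r by auto
    moreover have "inv X (X x0) = x0" using X(1) by (simp add: bij_is_inj)
    ultimately show "x0 \<in> inv X ` cball 0 r" by (metis image_eqI)
  qed
  ultimately show ?thesis using bounded_subset compact_imp_bounded by blast
qed

text \<open>A change of variables along \<open>inv X\<close> brings the label integral into Eulerian
  form with a Jacobian factor, and test functions then identify the integrands. The formula serves
  to show that \<open>rho\<close> is positive.\<close>

lemma delta_integral_density:
  fixes X :: "vec3 \<Rightarrow> vec3"
  assumes X: "bij X" and Y: "\<And>x. (inv X has_derivative Y' x) (at x)"
    and Y': "\<And>v. continuous_on UNIV (\<lambda>x. Y' x v)"
    and rho0: "continuous_on UNIV rho0" and rho: "continuous_on UNIV rho"
    and d: "is_delta_integral X rho0 rho"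
  shows "rho x = \<bar>det (matrix (Y' x))\<bar> * (rho0 (inv X x) :: real)"
proof -
  have Yc: "continuous_on UNIV (inv X)"
    by (rule has_derivative_continuous_on[OF has_derivative_at_withinI[OF Y]])
  have dc: "continuous_on UNIV (\<lambda>x. det (matrix (Y' x)))"
    unfolding det_def matrix_def
    by (auto intro!: continuous_intros Y')
  define k where "k x = \<bar>det (matrix (Y' x))\<bar> * rho0 (inv X x)" for x
  have kc: "continuous_on UNIV k"
    unfolding k_def by (intro continuous_intros dc continuous_on_compose2[OF rho0 Yc]) auto
  have XY: "X (inv X x) = x" for x using X by (simp add: bij_is_surj surj_f_inv_f)
  have img: "inv X ` UNIV = UNIV" using X by (simp add: bij_imp_bij_inv bij_is_surj)
  have "rho x - k x = 0"
  proof (rule test_integral_zero)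
    show "continuous_on UNIV (\<lambda>x. rho x - k x)" by (intro continuous_intros rho kc)
  next
    fix \<phi> :: "vec3 \<Rightarrow> real" assume \<phi>: "continuous_on UNIV \<phi>" "bounded {x. \<phi> x \<noteq> 0}"
    \<comment> \<open>Real values are wrapped as \<open>real^1\<close> to fit the
      change-of-variables theorem, which speaks of vector-valued integrands.\<close>
    define f where "f x0 = (vec (\<phi> (X x0) * rho0 x0) :: real^1)" for x0
    have eq: "\<bar>det (matrix (Y' x))\<bar> *\<^sub>R f (inv X x) = vec (\<phi> x * k x)" for x
      by (simp add: f_def XY k_def vec_eq_iff)
    have sup: "bounded {x. \<phi> x * g x \<noteq> 0}" for g :: "vec3 \<Rightarrow> real"
      by (rule bounded_subset[OF \<phi>(2)]) auto
    have int: "(\<lambda>x. \<phi> x * g x) integrable_on UNIV" if "continuous_on UNIV g" for g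
      by (rule integrable_compact_support[OF _ sup]) (intro continuous_intros \<phi> that)
    have ai: "(\<lambda>x. (vec (\<phi> x * k x) :: real^1)) absolutely_integrable_on UNIV"
    proof (rule integrable_compact_support)
      show "continuous_on UNIV (\<lambda>x. (vec (\<phi> x * k x) :: real^1))"
        unfolding vec_def by (intro continuous_intros \<phi> kc)
      show "bounded {x. (vec (\<phi> x * k x) :: real^1) \<noteq> 0}"
        by (rule bounded_subset[OF \<phi>(2)]) (auto simp: vec_eq_iff)
    qed
    have "integral (inv X ` UNIV) f = integral UNIV (\<lambda>x. \<bar>det (matrix (Y' x))\<bar> *\<^sub>R f (inv X x))"
    proof (rule integral_change_of_variables)
      show "inj (inv X)" using X by (simp add: bij_imp_bij_inv bij_is_inj)
      show "f absolutely_integrable_on range (inv X) \<or> (\<lambda>x. \<bar>det (matrix (Y' x))\<bar> *\<^sub>R f (inv X x)) absolutely_integrable_on UNIV"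
        using ai by (simp add: eq)
    qed (use Y in auto)
    then have "integral UNIV (\<lambda>x0. \<phi> (X x0) * rho0 x0) = integral UNIV (\<lambda>x. \<phi> x * k x)"
      unfolding img eq by (simp add: integral_on_1_eq f_def vec_eq_iff)
    moreover have "integral UNIV (\<lambda>x. \<phi> x * rho x) = integral UNIV (\<lambda>x0. \<phi> (X x0) * rho0 x0)"
      using d \<phi> by (simp add: is_delta_integral_def)
    ultimately show "integral UNIV (\<lambda>x. \<phi> x * (rho x - k x)) = 0"
      using int[OF rho] int[OF kc] by (simp add: right_diff_distrib integral_diff)
  qed
  then show ?thesis by (simp add: k_def)
qed

text \<open>No Jacobian enters: \<open>(\<phi> G) \<circ> X\<close> is the pullback of a test function for the density.\<close>

lemma delta_integral_multiple:
  fixes X :: "vec3 \<Rightarrow> vec3" and g G :: "vec3 \<Rightarrow> 'b::euclidean_space"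
  assumes X: "bij X" "continuous_on UNIV X" "continuous_on UNIV (inv X)"
    and c: "continuous_on UNIV rho0" "continuous_on UNIV rho" "continuous_on UNIV g" "continuous_on UNIV G"
    and d: "is_delta_integral X rho0 rho"
    and dg: "is_delta_integral X (\<lambda>x0. rho0 x0 *\<^sub>R G (X x0)) (\<lambda>x. rho x *\<^sub>R g x)"
  shows "rho x *\<^sub>R g x = rho x *\<^sub>R G x"
proof (rule euclidean_eqI)
  fix b :: 'b assume "b \<in> Basis"
  have "(rho x *\<^sub>R g x) \<bullet> b - (rho x *\<^sub>R G x) \<bullet> b = 0"
  proof (rule test_integral_zero)
    show "continuous_on UNIV (\<lambda>x. (rho x *\<^sub>R g x) \<bullet> b - (rho x *\<^sub>R G x) \<bullet> b)"
      by (intro continuous_intros c)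
  next
    fix \<phi> :: "vec3 \<Rightarrow> real" assume \<phi>: "continuous_on UNIV \<phi>" "bounded {x. \<phi> x \<noteq> 0}"
    have i1: "(\<lambda>x. \<phi> x *\<^sub>R rho x *\<^sub>R g x) integrable_on UNIV"
      by (rule integrable_compact_support, intro continuous_intros c \<phi>)
        (rule bounded_subset[OF \<phi>(2)], auto)
    have i2: "(\<lambda>x. \<phi> (X x) *\<^sub>R rho0 x *\<^sub>R G (X x)) integrable_on UNIV"
      by (rule integrable_compact_support, intro continuous_intros c continuous_on_compose2[OF \<phi>(1) X(2)]
          continuous_on_compose2[OF c(4) X(2)])
        (auto intro!: bounded_subset[OF bounded_preimage_support[OF X(1,3) \<phi>(2)]])
    have i3: "(\<lambda>x. \<phi> x * ((rho x *\<^sub>R G x) \<bullet> b)) integrable_on UNIV"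
      by (rule integrable_compact_support, intro continuous_intros c \<phi>)
        (rule bounded_subset[OF \<phi>(2)], auto)
    have i4: "(\<lambda>x. \<phi> x * ((rho x *\<^sub>R g x) \<bullet> b)) integrable_on UNIV"
      by (rule integrable_compact_support, intro continuous_intros c \<phi>)
        (rule bounded_subset[OF \<phi>(2)], auto)
    define \<psi> where "\<psi> x = \<phi> x * (G x \<bullet> b)" for x
    have \<psi>: "continuous_on UNIV \<psi>" "bounded {x. \<psi> x \<noteq> 0}"
      unfolding \<psi>_def by (intro continuous_intros c \<phi>) (rule bounded_subset[OF \<phi>(2)], auto)
    have "integral UNIV (\<lambda>x. \<phi> x * ((rho x *\<^sub>R g x) \<bullet> b)) = integral UNIV (\<lambda>x. \<phi> x *\<^sub>R rho x *\<^sub>R g x) \<bullet> b"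
      by (subst integral_component_eq[OF i1, symmetric]) (simp add: mult.assoc)
    also have "\<dots> = integral UNIV (\<lambda>x. \<phi> (X x) *\<^sub>R rho0 x *\<^sub>R G (X x)) \<bullet> b"
      using dg \<phi> by (simp add: is_delta_integral_def)
    also have "\<dots> = integral UNIV (\<lambda>x. \<psi> (X x) *\<^sub>R rho0 x)"
      by (subst integral_component_eq[OF i2, symmetric]) (simp add: \<psi>_def mult_ac)
    also have "\<dots> = integral UNIV (\<lambda>x. \<psi> x *\<^sub>R rho x)"
      using d \<psi> by (simp add: is_delta_integral_def)
    also have "\<dots> = integral UNIV (\<lambda>x. \<phi> x * ((rho x *\<^sub>R G x) \<bullet> b))" by (simp add: \<psi>_def mult_ac)
    finally show "integral UNIV (\<lambda>x. \<phi> x * ((rho x *\<^sub>R g x) \<bullet> b - (rho x *\<^sub>R G x) \<bullet> b)) = 0"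
      using i3 i4 by (simp add: right_diff_distrib integral_diff)
  qed
  then show "(rho x *\<^sub>R g x) \<bullet> b = (rho x *\<^sub>R G x) \<bullet> b" by simp
qed

declare Ck_on.simps(2) [simp del]

subsection \<open>Fields on space-time\<close>

lemma C1_has_derivative:
  "Ck_on 1 S f \<Longrightarrow> x \<in> S \<Longrightarrow> (f has_derivative fderiv f x) (at x)"
  using Ck_on_has_derivative[of 0 S f x] by simp

lemma C1_differentiable: "Ck_on 1 S f \<Longrightarrow> x \<in> S \<Longrightarrow> f differentiable (at x)"
  using C1_has_derivative differentiableI by blast

lemma C1_linear: "Ck_on 1 S f \<Longrightarrow> x \<in> S \<Longrightarrow> linear (fderiv f x)"
  using C1_has_derivative has_derivative_linear by blast

lemma C1_continuous_derivative: "Ck_on 1 S f \<Longrightarrow> continuous_on S (\<lambda>x. fderiv f x v)"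
  using Ck_on_continuous[OF Ck_on_Suc_deriv[of 0 S f v]] by simp

lemma C2_derivative: "Ck_on 2 S f \<Longrightarrow> Ck_on 1 S (\<lambda>x. fderiv f x v)"
  using Ck_on_Suc_deriv[of 1 S f v] by (simp add: numeral_2_eq_2)

lemma C2_C1: "Ck_on 2 S f \<Longrightarrow> Ck_on 1 S f"
  using Ck_on_le[of 2 S f 1] by simp

lemma frechet_derivative_linear_comp:
  assumes "bounded_linear L" "f differentiable (at x)"
  shows "fderiv (\<lambda>x. L (f x)) x v = L (fderiv f x v)"
  by (rule frechet_derivative_eqI[OF bounded_linear.has_derivative[OF assms(1) assms(2)[unfolded frechet_derivative_works]]])

lemma frechet_derivative_bilinear:
  assumes "bounded_bilinear bp" "f differentiable (at x)" "g differentiable (at x)"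
  shows "fderiv (\<lambda>x. bp (f x) (g x)) x v
    = bp (f x) (fderiv g x v) + bp (fderiv f x v) (g x)"
  by (rule frechet_derivative_eqI[OF bounded_bilinear.FDERIV[OF assms(1) assms(2,3)[unfolded frechet_derivative_works]]])

lemma frechet_derivative_cong:
  assumes "open S" "x \<in> S" "\<And>y. y \<in> S \<Longrightarrow> f y = g y" "g differentiable (at x)"
  shows "fderiv f x v = fderiv g x v"
  by (rule frechet_derivative_eqI[OF has_derivative_transform_within_open[OF assms(4)[unfolded frechet_derivative_works] assms(1,2)]])
    (simp add: assms(3))

lemma partial_x_eq:
  assumes "(f has_derivative f') (at x)" shows "partial_x i f x = f' (axis i 1)"
  unfolding partial_x_def
  using has_vector_derivative_along[of f f' x 0 "axis i 1"] assms by (simp add: vector_derivative_at)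

lemma advect_eq:
  assumes "(f has_derivative f') (at x)" shows "advect v f x = f' v"
  unfolding advect_def partial_x_eq[OF assms]
  using linear_axis_expand[OF has_derivative_linear[OF assms]] by metis

text \<open>Every operator of the definitions becomes a directional derivative of one function on
  space-time: \<open>(1, 0)\<close> for time, \<open>(0, v)\<close> for advection,
  \<open>(1, u t x)\<close> for the material derivative. The kinematics and the weak equations are
  computed in this form.\<close>

context
  fixes f :: "real \<Rightarrow> vec3 \<Rightarrow> 'b::real_normed_vector" and F and T :: "real set" and t :: real and x :: vec3
  defines "F \<equiv> \<lambda>z. f (fst z) (snd z)"
  assumes F: "Ck_on 1 (T \<times> UNIV) F" and t: "t \<in> T"
begin

lemma field_has_derivative: "(f t has_derivative (\<lambda>v. fderiv F (t, x) (0, v))) (at x)"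
  using has_derivative_slice[OF C1_has_derivative[OF F]] t by (simp add: F_def)

lemma field_partial_x: "partial_x i (f t) x = fderiv F (t, x) (0, axis i 1)"
  by (rule partial_x_eq[OF field_has_derivative])

lemma field_advect: "advect v (f t) x = fderiv F (t, x) (0, v)"
  by (rule advect_eq[OF field_has_derivative])

lemma field_partial_t: "partial_t f t x = fderiv F (t, x) (1, 0)"
  using has_vector_derivative_slice[OF C1_has_derivative[OF F]] t
  by (simp add: partial_t_def F_def vector_derivative_at)

lemma field_material: "material_derivative u f t x = fderiv F (t, x) (1, u t x)"
  using linear_add[OF C1_linear[OF F], of "(t, x)" "(1, 0)" "(0, u t x)"] t
  by (simp add: material_derivative_def field_partial_t field_advect)

end

lemma matrix_inv_eqI:
  fixes A B :: "real^'n^'n"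
  assumes "A ** B = mat 1" "B ** A = mat 1"
  shows "matrix_inv A = B"
proof -
  have "A ** matrix_inv A = mat 1 \<and> matrix_inv A ** A = mat 1"
    unfolding matrix_inv_def by (rule someI[of _ B]) (use assms in simp)
  then show ?thesis using assms by (metis matrix_mul_assoc matrix_mul_lid matrix_mul_rid)
qed

text \<open>The first hypothesis is the derivative of \<open>R R\<^sup>T = 1\<close>, with
  \<open>A\<close> the derivative of \<open>R\<close>; multiplication by \<open>transpose R\<close>
  from the left solves it for \<open>transpose A\<close>.\<close>

lemma antisymmetric_conjugation:
  fixes A R :: mat3
  assumes "A ** transpose R + R ** transpose A = 0" "transpose R ** R = mat 1"
  shows "transpose A = - (transpose R ** A ** transpose R)"
proof -
  have "transpose R ** (A ** transpose R + R ** transpose A) = 0" using assms(1) by (simp add: matrix_mult_distribs)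
  then have "transpose R ** A ** transpose R + transpose R ** R ** transpose A = 0"
    by (simp add: matrix_mult_distribs matrix_mul_assoc)
  then show ?thesis using assms(2) by (simp add: add_eq_0_iff)
qed

text \<open>Evaluates the wryness tensor as a matrix-valued 1-form, so that a change of coordinates
  is just a change of the vector \<open>v\<close>.\<close>

definition contract :: "wryness \<Rightarrow> vec3 \<Rightarrow> mat3" where
  "contract g v = (\<Sum>k\<in>UNIV. v $ k *\<^sub>R (g $ k))"

lemma bounded_bilinear_contract: "bounded_bilinear contract"
  unfolding bilinear_conv_bounded_bilinear[symmetric] bilinear_def contract_def
  by (auto intro!: linearI simp: scaleR_add_left scaleR_add_right sum.distrib scaleR_sum_right mult_ac)

lemma contract_axis [simp]: "contract g (axis i 1) = g $ i"
proof -
  have "contract g (axis i 1) = (\<Sum>k\<in>UNIV. if k = i then g $ k else 0)"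
    unfolding contract_def by (intro sum.cong) (auto simp: axis_def)
  then show ?thesis by simp
qed

lemma linear_contract: "linear (contract g)"
  using bounded_bilinear.bounded_linear_right[OF bounded_bilinear_contract] bounded_linear.linear by blast

subsection \<open>Kinematics of a Lagrangian path\<close>

locale fluid_path =
  fixes T :: "real set" and X :: "real \<Rightarrow> vec3 \<Rightarrow> vec3" and R :: "real \<Rightarrow> vec3 \<Rightarrow> mat3"
  assumes path: "lagrangian_path T X R"
begin

abbreviation "Xf \<equiv> \<lambda>z. X (fst z) (snd z)"
abbreviation "Rf \<equiv> \<lambda>z. R (fst z) (snd z)"
abbreviation "uf \<equiv> \<lambda>z. eulerian_velocity X (fst z) (snd z)"
abbreviation "nuf \<equiv> \<lambda>z. eulerian_angular_velocity X R (fst z) (snd z)"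
text \<open>\<open>label\<close> is \<open>X\<^sup>-\<^sup>1\<close> and \<open>lab\<close> the change from Eulerian to Lagrangian coordinates \<open>(t, x) \<mapsto> (t, x\<^sub>0)\<close>,
  so that a Lagrangian field composed with \<open>lab\<close> is the Eulerian one.\<close>

abbreviation "TU \<equiv> T \<times> (UNIV :: vec3 set)"
definition "label z = inv (X (fst z)) (snd z)"
definition "lab z = (fst z, label z)"

lemma open_T: "open T" and X2: "Ck_on 2 TU Xf" and label2: "Ck_on 2 TU label"
  and R2: "Ck_on 2 TU Rf" and bij_X: "t \<in> T \<Longrightarrow> bij (X t)"
  and rot: "t \<in> T \<Longrightarrow> rotation_matrix (R t y)"
  using path by (auto simp: lagrangian_path_def case_prod_beta' label_def[abs_def])

lemma open_TU: "open TU"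
  using open_T by (intro open_Times) auto

lemma lab2: "Ck_on 2 TU lab"
  unfolding lab_def[abs_def]
  by (intro Ck_on_Pair open_TU label2 Ck_on_linear bounded_linear_fst)

lemma lab_in: "z \<in> TU \<Longrightarrow> lab z \<in> TU" by (auto simp: lab_def)

lemma lab_image: "lab ` TU \<subseteq> TU" using lab_in by blast

lemma lab_X: "t \<in> T \<Longrightarrow> lab (t, X t y) = (t, y)"
  using bij_X by (simp add: lab_def label_def bij_is_inj)

lemma X_lab: "z \<in> TU \<Longrightarrow> X (fst z) (label z) = snd z"
  using bij_X by (auto simp: label_def bij_is_surj surj_f_inv_f)

lemma Ck_on_lab: "Ck_on k TU F \<Longrightarrow> k \<le> 2 \<Longrightarrow> Ck_on k TU (\<lambda>z. F (lab z))"
  by (rule Ck_on_compose[OF open_TU _ Ck_on_le[OF lab2] lab_image])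

lemma velocity_eq: "z \<in> TU \<Longrightarrow> uf z = fderiv Xf (lab z) (1, 0)"
  by (auto simp: eulerian_velocity_def field_partial_t[OF C2_C1[OF X2]] lab_def label_def)

lemma u1: "Ck_on 1 TU uf"
  by (rule Ck_on_cong[OF open_TU velocity_eq[symmetric]])
    (use Ck_on_lab[OF C2_derivative[OF X2]] in auto)

lemma R_orth: "z \<in> TU \<Longrightarrow> Rf z ** transpose (Rf z) = mat 1" "z \<in> TU \<Longrightarrow> transpose (Rf z) ** Rf z = mat 1"
  using rot by (auto simp: rotation_matrix_def orthogonal_matrix_def)

lemma R_inv: "z \<in> TU \<Longrightarrow> matrix_inv (Rf z) = transpose (Rf z)"
  by (rule matrix_inv_eqI[OF R_orth])

lemma transpose_frechet_R:
  assumes z: "z \<in> TU"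
  shows "transpose (fderiv Rf z v)
    = - (transpose (Rf z) ** fderiv Rf z v ** transpose (Rf z))"
proof (rule antisymmetric_conjugation[OF _ R_orth(2)[OF z]])
  have d: "Rf differentiable (at z)" by (rule C1_differentiable[OF C2_C1[OF R2] z])
  then have d': "(\<lambda>z. transpose (Rf z)) differentiable (at z)"
    using bounded_linear.has_derivative[OF bounded_linear_transpose] unfolding differentiable_def by blast
  have "fderiv (\<lambda>z. Rf z ** transpose (Rf z)) z v = fderiv (\<lambda>z. mat 1 :: mat3) z v"
    by (rule frechet_derivative_cong[OF open_TU z R_orth(1)]) auto
  then show "fderiv Rf z v ** transpose (Rf z) + Rf z ** transpose (fderiv Rf z v) = 0"
    using frechet_derivative_bilinear[OF bounded_bilinear_matrix_mult d d', of v]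
    by (simp add: frechet_derivative_linear_comp[OF bounded_linear_transpose d] add.commute)
qed

text \<open>The angular velocity in labels. With the transpose in place of the matrix inverse it is
  visibly a product of C^1 functions.\<close>

definition "spin z = fderiv Rf z (1, 0) ** transpose (Rf z)"

lemma spin1: "Ck_on 1 TU spin"
  unfolding spin_def[abs_def]
  by (intro Ck_on_bilinear[OF open_TU bounded_bilinear_matrix_mult] C2_derivative[OF R2]
      Ck_on_linear_comp[OF open_TU bounded_linear_transpose] C2_C1[OF R2])

lemma nu_eq: "z \<in> TU \<Longrightarrow> nuf z = spin (lab z)"
  using R_inv[OF lab_in, of z]
  by (auto simp: eulerian_angular_velocity_def field_partial_t[OF C2_C1[OF R2]] lab_def label_def spin_def)

lemma nu1: "Ck_on 1 TU nuf"
  by (rule Ck_on_cong[OF open_TU nu_eq[symmetric]]) (use Ck_on_lab[OF spin1] in auto)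

lemma nu_antisym: "z \<in> TU \<Longrightarrow> antisymmetric (nuf z)"
  unfolding antisymmetric_def nu_eq spin_def
  using transpose_frechet_R[OF lab_in, of z "(1, 0)"] R_orth(1)[OF lab_in, of z]
  by (simp add: matrix_transpose_mul matrix_mult_distribs matrix_mul_assoc)

text \<open>Carries an Eulerian vector at \<open>z\<close> to the label vector whose push-forward
  under \<open>X\<close> it is.\<close>

definition "back z w = fderiv label z (0, w)"

lemma frechet_lab: "z \<in> TU \<Longrightarrow> fderiv lab z v = (fst v, fderiv label z v)"
  unfolding lab_def[abs_def]
  by (rule frechet_derivative_eqI)
    (auto intro!: has_derivative_Pair derivative_eq_intros C1_has_derivative[OF C2_C1[OF label2]])

text \<open>The spatial derivative of the identity
  \<open>X (fst z) (label z) = snd z\<close>.\<close>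

lemma frechet_X_back:
  assumes z: "z \<in> TU" shows "fderiv Xf (lab z) (0, back z w) = w"
proof -
  have "fderiv (\<lambda>z. Xf (lab z)) z (0, w) = fderiv snd z (0, w)"
    by (rule frechet_derivative_cong[OF open_TU z]) (auto simp: lab_def X_lab intro: bounded_linear_imp_differentiable bounded_linear_snd)
  moreover have "fderiv (\<lambda>z. Xf (lab z)) z (0, w) = fderiv Xf (lab z) (fderiv lab z (0, w))"
    by (rule frechet_derivative_chain[OF C1_differentiable[OF C2_C1[OF lab2] z] C1_differentiable[OF C2_C1[OF X2] lab_in[OF z]]])
  moreover have "fderiv snd z (0, w) = w"
    using frechet_derivative_eqI[OF has_derivative_snd[OF has_derivative_ident], of z "(0, w)"] by simp
  ultimately show ?thesis using z by (simp add: frechet_lab back_def)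
qed

text \<open>The derivative of \<open>label (t, X t y) = y\<close> in all space-time directions; for
  \<open>v = (1, 0)\<close> it says that the label is constant along a fluid path.\<close>

lemma frechet_label_X:
  assumes t: "t \<in> T"
  shows "fderiv label (t, X t y) (fst v, fderiv Xf (t, y) v) = snd v"
proof -
  have z: "(t, y) \<in> TU" "(t, X t y) \<in> TU" using t by auto
  define g where "g z = (fst z, Xf z)" for z
  have g: "(g has_derivative (\<lambda>v. (fst v, fderiv Xf (t, y) v))) (at (t, y))"
    unfolding g_def[abs_def]
    by (auto intro!: has_derivative_Pair derivative_eq_intros C1_has_derivative[OF C2_C1[OF X2]] t)
  have gt: "g (t, y) = (t, X t y)" by (simp add: g_def)
  have "fderiv (\<lambda>z. label (g z)) (t, y) v = fderiv snd (t, y) v"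
    by (rule frechet_derivative_cong[OF open_TU z(1)])
      (use lab_X in \<open>auto simp: g_def lab_def intro: bounded_linear_imp_differentiable bounded_linear_snd\<close>)
  moreover have "fderiv snd (t, y) v = snd v"
    using frechet_derivative_eqI[OF has_derivative_snd[OF has_derivative_ident], of "(t, y)" v] by simp
  moreover have "((\<lambda>z. label (g z)) has_derivative
      (\<lambda>v. fderiv label (t, X t y) (fst v, fderiv Xf (t, y) v))) (at (t, y))"
    using has_derivative_compose[OF g, of label] C1_has_derivative[OF C2_C1[OF label2] z(2)] gt by simp
  ultimately show ?thesis by (simp add: frechet_derivative_eqI)
qed

text \<open>The direction \<open>(1, uf z)\<close> is tangent to the fluid path through
  \<open>z\<close>, on which the label does not change. Hence the material derivative of
  \<open>F \<circ> lab\<close> is the time derivative of \<open>F\<close> at a fixed label.\<close>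

lemma frechet_lab_advect:
  assumes z: "z \<in> TU"
  shows "fderiv lab z (1, uf z) = (1, 0)" "fderiv lab z (0, w) = (0, back z w)"
  using frechet_label_X[of "fst z" "label z" "(1, 0)"] z
  by (auto simp: frechet_lab back_def velocity_eq X_lab lab_def)

lemma frechet_comp_lab:
  assumes "Ck_on 1 TU F" "z \<in> TU"
  shows "fderiv (\<lambda>z. F (lab z)) z v = fderiv F (lab z) (fderiv lab z v)"
  by (rule frechet_derivative_chain[OF C1_differentiable[OF C2_C1[OF lab2] assms(2)] C1_differentiable[OF assms(1) lab_in[OF assms(2)]]])

end

lemma linear_space_part: "linear L \<Longrightarrow> linear (\<lambda>v. L (0, v))"
  by (rule linear_compose[of "Pair 0" L, unfolded o_def]) (auto intro: linearI)

context fluid_path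
begin

text \<open>The Lagrangian wryness tensor as a 1-form.\<close>

definition wry :: "(vec3 \<Rightarrow> wryness) \<Rightarrow> real \<times> vec3 \<Rightarrow> vec3 \<Rightarrow> mat3" where
  "wry xi0 z v = - (fderiv Rf z (0, v) ** transpose (Rf z))
    + Rf z ** contract (xi0 (snd z)) v ** transpose (Rf z)"

lemma linear_frechet_R: "z \<in> TU \<Longrightarrow> linear (\<lambda>v. fderiv Rf z (0, v))"
  by (rule linear_space_part[OF C1_linear[OF C2_C1[OF R2]]])

lemma linear_back: "z \<in> TU \<Longrightarrow> linear (back z)"
  unfolding back_def[abs_def] by (rule linear_space_part[OF C1_linear[OF C2_C1[OF label2]]])

lemma linear_wry: "z \<in> TU \<Longrightarrow> linear (wry xi0 z)"
  unfolding wry_def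
  by (rule linearI) (simp_all add: linear_add[OF linear_frechet_R] linear_cmul[OF linear_frechet_R]
    linear_add[OF linear_contract] linear_cmul[OF linear_contract] matrix_mult_distribs algebra_simps)

lemma Ck_on_snd_comp:
  assumes "Ck_on 1 UNIV f" shows "Ck_on 1 TU (\<lambda>z. f (snd z :: vec3))"
  by (rule Ck_on_compose[OF open_TU assms]) (auto intro: Ck_on_linear open_TU bounded_linear_snd)

lemma lagrangian_wryness_eq:
  assumes "t \<in> T"
  shows "lagrangian_wryness (R t) xi0 y $ i = wry xi0 (t, y) (axis i 1)"
  using field_partial_x[OF C2_C1[OF R2] assms, of i y] R_inv[of "(t, y)"] assms
  by (simp add: lagrangian_wryness_def wry_def)

text \<open>The coefficients in \<open>eulerian_components\<close> are the components of one
  pulled-back basis vector, so by linearity the sum is a single evaluation of the 1-form.\<close>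

lemma eulerian_components_eq:
  assumes t: "t \<in> T"
  shows "eulerian_components (X t) (lagrangian_wryness (R t) xi0) y $ i
    = wry xi0 (t, y) (back (t, X t y) (axis i 1))"
proof -
  have z: "(t, X t y) \<in> TU" "(t, y) \<in> TU" using t by auto
  have "((\<lambda>x. label (t, x)) has_derivative (\<lambda>v. fderiv label (t, X t y) (0, v))) (at (X t y))"
    by (rule has_derivative_slice[OF C1_has_derivative[OF C2_C1[OF label2] z(1)]])
  then have "((\<lambda>x. inv (X t) x $ k) has_derivative (\<lambda>v. fderiv label (t, X t y) (0, v) $ k)) (at (X t y))" for k
    unfolding label_def fst_conv snd_conv by (rule bounded_linear.has_derivative[OF bounded_linear_vec_nth])
  then have "partial_x i (\<lambda>x. inv (X t) x $ k) (X t y) = back (t, X t y) (axis i 1) $ k" for k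
    unfolding back_def by (rule partial_x_eq)
  then show ?thesis
    unfolding linear_axis_expand[OF linear_wry[OF z(2)], of _ "back (t, X t y) (axis i 1)"]
    by (simp add: eulerian_components_def lagrangian_wryness_eq[OF t])
qed

lemma C0_back: "continuous_on UNIV (\<lambda>x. back (t, x) w)" if "t \<in> T"
proof -
  have "continuous_on TU (\<lambda>z. fderiv label z (0, w))"
    by (rule C1_continuous_derivative[OF C2_C1[OF label2]])
  from continuous_on_st_slice[OF this that] show ?thesis by (simp add: back_def)
qed

lemma continuous_X: "t \<in> T \<Longrightarrow> continuous_on UNIV (X t)"
  and continuous_inv_X: "t \<in> T \<Longrightarrow> continuous_on UNIV (inv (X t))"
  using continuous_on_st_slice[OF Ck_on_continuous[OF X2], of t] continuous_on_st_slice[OF Ck_on_continuous[OF label2], of t]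
  by (simp_all add: label_def)

end

text \<open>Purely kinematic, so that the locale can be interpreted twice: with \<open>T\<close> as
  the set of times, and with a deformation parameter in the role of time.\<close>

locale liquid_crystal = fluid_path +
  fixes rho0 :: "vec3 \<Rightarrow> real" and xi0 :: "vec3 \<Rightarrow> wryness"
    and rho :: "real \<Rightarrow> vec3 \<Rightarrow> real" and gam :: "real \<Rightarrow> vec3 \<Rightarrow> wryness"
  assumes rho0: "Ck_on 1 UNIV rho0" "\<And>x0. rho0 x0 > 0"
    and xi0: "Ck_on 1 UNIV xi0"
    and rho: "Ck_on 1 TU (\<lambda>(t, x). rho t x)"
      "\<And>t. t \<in> T \<Longrightarrow> is_eulerian_density (X t) rho0 (rho t)"
    and gam: "Ck_on 1 TU (\<lambda>(t, x). gam t x)"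
      "\<And>t. t \<in> T \<Longrightarrow> is_eulerian_wryness (X t) (R t) rho0 xi0 (rho t) (gam t)"
begin

abbreviation "rhof \<equiv> \<lambda>z. rho (fst z) (snd z)"
abbreviation "gamf \<equiv> \<lambda>z. gam (fst z) (snd z)"

lemma rho1: "Ck_on 1 TU rhof" and gam1: "Ck_on 1 TU gamf"
  using rho gam by (simp_all add: case_prod_beta')

text \<open>The Jacobian of \<open>inv X\<close> cannot vanish, because the derivative of
  \<open>X\<close> undoes it and the two determinants multiply to 1. Positivity allows cancelling
  \<open>rho\<close> in the definition of \<open>gam\<close> and keeps the state where
  \<open>U\<close> is smooth.\<close>

lemma rho_pos:
  assumes t: "t \<in> T" shows "rho t x > 0"
proof -
  have z: "(t, x) \<in> TU" for x :: vec3 using t by auto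
  have "(inv (X t) has_derivative back (t, x)) (at x)" for x
    using has_derivative_slice[OF C1_has_derivative[OF C2_C1[OF label2] z]]
    by (simp add: label_def back_def[abs_def])
  then have eq: "rho t x = \<bar>det (matrix (back (t, x)))\<bar> * rho0 (inv (X t) x)"
    using rho(2)[OF t] continuous_on_st_slice[OF Ck_on_continuous[OF rho1] t]
    by (intro delta_integral_density bij_X t C0_back Ck_on_continuous[OF rho0(1)])
      (auto simp: is_eulerian_density_def)
  have l: "linear (back (t, x))"
    by (rule linear_back[OF z])
  have l': "linear (\<lambda>v. fderiv Xf (lab (t, x)) (0, v))"
    by (rule linear_space_part[OF C1_linear[OF C2_C1[OF X2] lab_in[OF z]]])
  have "matrix ((\<lambda>v. fderiv Xf (lab (t, x)) (0, v)) \<circ> back (t, x)) = mat 1"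
    using frechet_X_back[OF z] by (simp add: o_def matrix_id_mat_1[unfolded id_def])
  then have "det (matrix (\<lambda>v. fderiv Xf (lab (t, x)) (0, v))) * det (matrix (back (t, x))) = 1"
    by (simp only: matrix_compose[OF l l'] det_mul[symmetric] det_I)
  then have "det (matrix (back (t, x))) \<noteq> 0" by auto
  then show ?thesis using rho0(2) by (simp add: eq)
qed

text \<open>Replaces the weak definition of \<open>gam\<close> by a pointwise one: \<open>G\<close>
  is the push-forward of the label 1-form, \<open>rho gam\<close> and \<open>rho G\<close> have the
  same delta integrals, and \<open>rho\<close> is positive.\<close>

lemma gam_eq:
  assumes z: "z \<in> TU" shows "contract (gamf z) w = wry xi0 (lab z) (back z w)"
proof -
  obtain t x where zt: "z = (t, x)" by (cases z)
  have t: "t \<in> T" using z zt by auto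
  define G :: "vec3 \<Rightarrow> wryness" where "G x = (\<chi> i. wry xi0 (lab (t, x)) (back (t, x) (axis i 1)))" for x
  have XI: "X t (inv (X t) x) = x" "inv (X t) (X t x) = x" for x
    using bij_X[OF t] by (simp_all add: bij_is_surj surj_f_inv_f bij_is_inj)
  have Rc: "Ck_on 1 TU (\<lambda>z. Rf (lab z))" by (rule Ck_on_lab[OF C2_C1[OF R2]]) simp
  have xc: "Ck_on 1 TU (\<lambda>z. xi0 (snd (lab z)))"
    by (rule Ck_on_lab[OF Ck_on_snd_comp[OF xi0]]) simp
  have bc: "continuous_on TU (\<lambda>z. back z w)" for w
    unfolding back_def by (rule C1_continuous_derivative[OF C2_C1[OF label2]])
  have R2': "Ck_on (Suc 0) TU Rf" using C2_C1[OF R2] by simp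
  have wc: "continuous_on TU (\<lambda>z. wry xi0 (lab z) (back z w))" for w
    unfolding wry_def
    by (intro continuous_on_add continuous_on_minus bounded_bilinear.continuous_on[OF bounded_bilinear_matrix_mult]
        bounded_bilinear.continuous_on[OF bounded_bilinear_contract]
        bounded_linear.continuous_on[OF bounded_linear_transpose] Ck_on_continuous[OF Rc] Ck_on_continuous[OF xc] bc
        continuous_on_frechet_derivative[OF R2' Ck_on_continuous[OF lab2] lab_image] continuous_on_Pair continuous_on_const)
  have Gc: "continuous_on UNIV G"
    unfolding G_def by (intro continuous_on_vec_lambda continuous_on_st_slice[OF wc t])
  \<comment> \<open>The label integrand of \<open>is_eulerian_wryness\<close> is thus
    \<open>rho0\<close> times \<open>G \<circ> X t\<close>, the shape that
    \<open>delta_integral_multiple\<close> expects.\<close>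
  have GE: "eulerian_components (X t) (lagrangian_wryness (R t) xi0) = (\<lambda>x0. G (X t x0))"
    by (simp add: G_def fun_eq_iff vec_eq_iff[of "eulerian_components _ _ _"] eulerian_components_eq[OF t] lab_def label_def XI)
  have "rho t x *\<^sub>R gam t x = rho t x *\<^sub>R G x"
    using gam(2)[OF t] rho(2)[OF t] unfolding is_eulerian_wryness_def is_eulerian_density_def GE
    by (intro delta_integral_multiple[OF bij_X[OF t] continuous_X[OF t] continuous_inv_X[OF t]
        Ck_on_continuous[OF rho0(1)] _ _ Gc])
      (use continuous_on_st_slice[OF Ck_on_continuous[OF rho1] t] continuous_on_st_slice[OF Ck_on_continuous[OF gam1] t] in auto)
  then have "gam t x = G x" using rho_pos[OF t, of x] by simp
  moreover have "linear (\<lambda>w. wry xi0 (lab (t, x)) (back (t, x) w))"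
    using linear_compose[OF linear_back[OF z] linear_wry[OF lab_in[OF z]]] by (simp add: o_def zt)
  ultimately show ?thesis
    unfolding zt using linear_axis_expand[of "\<lambda>w. wry xi0 (lab (t, x)) (back (t, x) w)" w] by (simp add: contract_def G_def)
qed

end

section \<open>Transport of the order tensor\<close>

lemma cancel_right:
  fixes R Rt X :: mat3
  assumes "Rt ** R = mat 1" shows "X ** Rt ** R = X"
  using assms by (metis matrix_mul_assoc matrix_mul_rid)

text \<open>With \<open>A\<close> the derivative of \<open>R\<close> and \<open>At\<close> its
  transpose, the left side is the derivative of \<open>R q R\<^sup>T\<close> for fixed
  \<open>q\<close>; orthogonality makes it a commutator with \<open>A R\<^sup>T\<close>.\<close>

lemma commutator_spin:
  fixes A At R Rt q :: mat3
  assumes "At = - (Rt ** A ** Rt)" "Rt ** R = mat 1"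
  shows "A ** q ** Rt + R ** q ** At = commutator (A ** Rt) (R ** q ** Rt)"
  by (simp add: commutator_def matrix_mult_distribs matrix_mul_assoc assms(1) cancel_right[OF assms(2)])

lemma commutator_conjugate:
  fixes R Rt q c :: mat3
  assumes "Rt ** R = mat 1"
  shows "R ** commutator q c ** Rt = commutator (R ** q ** Rt) (R ** c ** Rt)"
  by (simp add: commutator_def matrix_mult_distribs matrix_mul_assoc cancel_right[OF assms])

lemma commutator_minus_left: "commutator (- A) B = - commutator A B"
  and commutator_minus_right: "commutator A (- B) = - commutator A B"
  and commutator_add_left: "commutator (A + A') B = commutator A B + commutator A' B"
  and commutator_add_right: "commutator A (B + B') = commutator A B + commutator A B'"
  and commutator_scaleR_left: "commutator (r *\<^sub>R A) B = r *\<^sub>R commutator A B"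
  and commutator_scaleR_right: "commutator A (r *\<^sub>R B) = r *\<^sub>R commutator A B"
  using bounded_bilinear_commutator
  by (simp_all add: bounded_bilinear.minus_left bounded_bilinear.minus_right bounded_bilinear.add_left
      bounded_bilinear.add_right
      bounded_bilinear.scaleR_left bounded_bilinear.scaleR_right)

lemma commutator_swap: "commutator A B = - commutator B A"
  by (simp add: commutator_def)

lemma frechet_component:
  fixes f :: "'a::real_normed_vector \<Rightarrow> ('b::real_normed_vector)^'n"
  assumes "f differentiable (at z)"
  shows "fderiv (\<lambda>z. f z $ i) z v = fderiv f z v $ i"
  by (rule frechet_derivative_linear_comp[OF bounded_linear_vec_nth assms])

lemma Ck_on_component: "open S \<Longrightarrow> Ck_on k S f \<Longrightarrow> Ck_on k S (\<lambda>z. f z $ i)"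
  by (rule Ck_on_linear_comp[OF _ bounded_linear_vec_nth])

context fluid_path
begin

definition "lagrangian_order Q0 z = Rf z ** Q0 (snd z) ** transpose (Rf z)"

lemma order_tensor_eq:
  "z \<in> TU \<Longrightarrow> eulerian_order_tensor X R Q0 (fst z) (snd z) = lagrangian_order Q0 (lab z)"
  using R_inv[OF lab_in, of z]
  by (simp add: eulerian_order_tensor_def lagrangian_order_def lab_def label_def Let_def)

lemma lagrangian_order_C1:
  assumes "Ck_on 1 UNIV Q0" shows "Ck_on 1 TU (lagrangian_order Q0)"
  unfolding lagrangian_order_def[abs_def]
  by (intro Ck_on_bilinear[OF open_TU bounded_bilinear_matrix_mult]
      Ck_on_linear_comp[OF open_TU bounded_linear_transpose] C2_C1[OF R2] Ck_on_snd_comp assms)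

lemma order_tensor_C1:
  assumes "Ck_on 1 UNIV Q0" shows "Ck_on 1 TU (\<lambda>z. eulerian_order_tensor X R Q0 (fst z) (snd z))"
  by (rule Ck_on_cong[OF open_TU order_tensor_eq[symmetric]]) (use Ck_on_lab[OF lagrangian_order_C1[OF assms]] in auto)

text \<open>One term comes from the rotation, the other from the label dependence of
  \<open>Q0\<close>; in the time direction the second vanishes.\<close>

lemma frechet_lagrangian_order:
  assumes Q0: "Ck_on 1 UNIV Q0" and z: "z \<in> TU"
  shows "fderiv (lagrangian_order Q0) z v
    = commutator (fderiv Rf z v ** transpose (Rf z)) (lagrangian_order Q0 z)
      + Rf z ** fderiv Q0 (snd z) (snd v) ** transpose (Rf z)"
proof -
  have R': "(Rf has_derivative fderiv Rf z) (at z)"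
    by (rule C1_has_derivative[OF C2_C1[OF R2] z])
  have Q': "((\<lambda>z. Q0 (snd z)) has_derivative (\<lambda>v. fderiv Q0 (snd z) (snd v))) (at z)"
    by (rule has_derivative_compose[OF has_derivative_snd[OF has_derivative_ident] C1_has_derivative[OF Q0 UNIV_I]])
  have "(lagrangian_order Q0 has_derivative (\<lambda>v. (Rf z ** Q0 (snd z)) ** transpose (fderiv Rf z v)
     + (Rf z ** fderiv Q0 (snd z) (snd v) + fderiv Rf z v ** Q0 (snd z)) ** transpose (Rf z))) (at z)"
    unfolding lagrangian_order_def[abs_def]
    by (intro bounded_bilinear.FDERIV[OF bounded_bilinear_matrix_mult] R' Q'
        bounded_linear.has_derivative[OF bounded_linear_transpose])
  from frechet_derivative_eqI[OF this, of v] show ?thesis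
    using commutator_spin[OF transpose_frechet_R[OF z] R_orth(2)[OF z], of v "Q0 (snd z)"]
    by (simp add: lagrangian_order_def matrix_mult_distribs algebra_simps)
qed

text \<open>Along a fluid path the label is fixed, so only the rotation changes.\<close>

lemma order_tensor_transport:
  assumes Q0: "Ck_on 1 UNIV Q0" and t: "t \<in> T"
  shows "material_derivative (eulerian_velocity X) (eulerian_order_tensor X R Q0) t x
    = commutator (eulerian_angular_velocity X R t x) (eulerian_order_tensor X R Q0 t x)"
proof -
  have z: "(t, x) \<in> TU" using t by auto
  have "material_derivative (eulerian_velocity X) (eulerian_order_tensor X R Q0) t x
      = fderiv (\<lambda>z. eulerian_order_tensor X R Q0 (fst z) (snd z)) (t, x) (1, eulerian_velocity X t x)"
    by (rule field_material[OF order_tensor_C1[OF Q0] t])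
  also have "\<dots> = fderiv (\<lambda>z. lagrangian_order Q0 (lab z)) (t, x) (1, eulerian_velocity X t x)"
    by (rule frechet_derivative_cong[OF open_TU z order_tensor_eq])
      (use C1_differentiable[OF Ck_on_lab[OF lagrangian_order_C1[OF Q0]] z] in auto)
  also have "\<dots> = fderiv (lagrangian_order Q0) (lab (t, x)) (1, 0)"
    using frechet_comp_lab[OF lagrangian_order_C1[OF Q0] z] frechet_lab_advect(1)[OF z] by simp
  also have "\<dots> = commutator (spin (lab (t, x))) (lagrangian_order Q0 (lab (t, x)))"
    using linear_0[OF C1_linear[OF Q0 UNIV_I]] bounded_bilinear.zero_left[OF bounded_bilinear_matrix_mult]
      bounded_bilinear.zero_right[OF bounded_bilinear_matrix_mult]
    by (simp add: frechet_lagrangian_order[OF Q0 lab_in[OF z]] spin_def)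
  finally show ?thesis using nu_eq[OF z] order_tensor_eq[OF z] by simp
qed

end

section \<open>Gradient relation and transport of the wryness tensor\<close>

context liquid_crystal
begin

text \<open>In space \<open>R Q0 R\<^sup>T\<close> differentiates to
  \<open>[dR R\<^sup>T, Q] + [Q, R xi0 R\<^sup>T]\<close>. Reversing the first commutator is what
  the minus sign in the Lagrangian wryness accounts for.\<close>

lemma gradient_order_tensor:
  assumes Q0: "Ck_on 1 UNIV Q0" and xi: "\<And>x0 i. partial_x i Q0 x0 = commutator (Q0 x0) (xi0 x0 $ i)"
    and t: "t \<in> T"
  shows "partial_x i (eulerian_order_tensor X R Q0 t) x = commutator (eulerian_order_tensor X R Q0 t x) (gam t x $ i)"
proof -
  have z: "(t, x) \<in> TU" using t by auto
  define y where "y = lab (t, x)"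
  define v where "v = back (t, x) (axis i 1)"
  have y: "y \<in> TU" unfolding y_def by (rule lab_in[OF z])
  have Q0': "fderiv Q0 x0 v = commutator (Q0 x0) (contract (xi0 x0) v)" for x0
  proof -
    have "fderiv Q0 x0 (axis k 1) = commutator (Q0 x0) (xi0 x0 $ k)" for k
      using partial_x_eq[OF C1_has_derivative[OF Q0 UNIV_I], of k x0] xi[of k x0] by simp
    then show ?thesis
      by (subst linear_axis_expand[OF C1_linear[OF Q0 UNIV_I]])
        (simp add: contract_def bounded_bilinear.sum_right[OF bounded_bilinear_commutator] commutator_scaleR_right)
  qed
  have "partial_x i (eulerian_order_tensor X R Q0 t) x
      = fderiv (\<lambda>z. eulerian_order_tensor X R Q0 (fst z) (snd z)) (t, x) (0, axis i 1)"
    by (rule field_partial_x[OF order_tensor_C1[OF Q0] t])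
  also have "\<dots> = fderiv (\<lambda>z. lagrangian_order Q0 (lab z)) (t, x) (0, axis i 1)"
    by (rule frechet_derivative_cong[OF open_TU z order_tensor_eq])
      (use C1_differentiable[OF Ck_on_lab[OF lagrangian_order_C1[OF Q0]] z] in auto)
  also have "\<dots> = fderiv (lagrangian_order Q0) y (0, v)"
    using frechet_comp_lab[OF lagrangian_order_C1[OF Q0] z] frechet_lab_advect(2)[OF z] by (simp add: y_def v_def)
  also have "\<dots> = commutator (fderiv Rf y (0, v) ** transpose (Rf y)) (lagrangian_order Q0 y)
      + commutator (lagrangian_order Q0 y) (Rf y ** contract (xi0 (snd y)) v ** transpose (Rf y))"
    by (simp add: frechet_lagrangian_order[OF Q0 y] Q0' commutator_conjugate[OF R_orth(2)[OF y]] lagrangian_order_def)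
  also have "\<dots> = commutator (lagrangian_order Q0 y) (wry xi0 y v)"
    unfolding wry_def commutator_add_right commutator_minus_right by (metis commutator_swap)
  also have "wry xi0 y v = gam t x $ i"
    using gam_eq[OF z, of "axis i 1"] by (simp add: y_def v_def)
  finally show ?thesis using order_tensor_eq[OF z] by (simp add: y_def)
qed

text \<open>The time derivative of the identity \<open>\<gamma>(D\<^sub>v X) = \<xi>(v)\<close> along a fluid path, with \<open>v\<close> chosen such
  that \<open>D\<^sub>v X = w\<close> at the given time.\<close>

lemma wryness_transport_frechet:
  assumes z: "z \<in> TU"
  shows "contract (fderiv gamf z (1, uf z)) w + contract (gamf z) (fderiv uf z (0, w))
    = commutator (nuf z) (contract (gamf z) w) - fderiv nuf z (0, w)"
proof -
  obtain t x where zt: "z = (t, x)" by (cases z)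
  have t: "t \<in> T" using z zt by auto
  define y where "y = label z"
  have yl: "lab z = (t, y)" by (simp add: lab_def y_def zt)
  have ty: "(t, y) \<in> TU" using t by auto
  have Xy: "X t y = x" using X_lab[OF z] by (simp add: y_def zt)
  define v where "v = back z w"
  have Xv: "fderiv Xf (t, y) (0, v) = w" using frechet_X_back[OF z, of w] by (simp add: v_def yl)
  note X1 = C2_C1[OF X2] and R1 = C2_C1[OF R2]
  define F where "F s = fderiv Xf (s, y) (0, v)" for s
  define A where "A s = fderiv Rf (s, y) (0, v)" for s
  \<comment> \<open>The label \<open>y\<close> and the label vector \<open>v\<close> are frozen, so
    both sides depend on time alone; on the right it enters through \<open>R\<close> and its spatial
    derivative.\<close>
  have pull: "contract (gam s (X s y)) (F s) = wry xi0 (s, y) v" if s: "s \<in> T" for s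
  proof -
    have "(s, X s y) \<in> TU" using s by auto
    from gam_eq[OF this, of "F s"] show ?thesis
      using frechet_label_X[OF s, of y "(0, v)"] lab_X[OF s] by (simp add: back_def F_def)
  qed
  define A' where "A' = fderiv Rf (t, y) (1, 0)"
  define B where "B = fderiv (\<lambda>z. fderiv Rf z (1, 0)) (t, y) (0, v)"
  \<comment> \<open>Mixed derivatives of \<open>R\<close> commute, so the spatial derivative
    \<open>B\<close> of the rotation rate is also the rate of change of \<open>A\<close>.\<close>
  have dA: "(A has_vector_derivative B) (at t)"
    using has_vector_derivative_slice[OF C1_has_derivative[OF C2_derivative[OF R2, of "(0, v)"] ty]]
      frechet_derivative_commute[OF open_TU ty R2, of "(0, v)" "(1, 0)"]
    by (simp add: A_def[abs_def] B_def)
  have dR: "((\<lambda>s. R s y) has_vector_derivative A') (at t)"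
    using has_vector_derivative_slice[OF C1_has_derivative[OF R1 ty]] by (simp add: A'_def)
  have dX: "((\<lambda>s. X s y) has_vector_derivative uf z) (at t)"
    using has_vector_derivative_slice[OF C1_has_derivative[OF X1 ty]] velocity_eq[OF z] by (simp add: yl)
  \<comment> \<open>Likewise the pushed-forward vector changes at the rate given by the velocity
    gradient in direction \<open>w\<close>; this is the source of the term in which
    \<open>gam\<close> is contracted with the derivative of \<open>u\<close>.\<close>
  have dF: "(F has_vector_derivative fderiv uf z (0, w)) (at t)"
  proof -
    have "(F has_vector_derivative fderiv (\<lambda>z. fderiv Xf z (1, 0)) (t, y) (0, v)) (at t)"
      using has_vector_derivative_slice[OF C1_has_derivative[OF C2_derivative[OF X2, of "(0, v)"] ty]]
        frechet_derivative_commute[OF open_TU ty X2, of "(0, v)" "(1, 0)"]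
      by (simp add: F_def[abs_def])
    moreover have "fderiv (\<lambda>z. fderiv Xf z (1, 0)) (lab z) (fderiv lab z (0, w))
        = fderiv uf z (0, w)"
      unfolding frechet_comp_lab[OF C2_derivative[OF X2] z, symmetric]
      by (rule frechet_derivative_cong[OF open_TU z velocity_eq[symmetric] C1_differentiable[OF u1 z]])
    ultimately show ?thesis using frechet_lab_advect(2)[OF z] by (simp add: yl v_def)
  qed
  have dnu: "fderiv nuf z (0, w) = B ** transpose (R t y) + A' ** transpose (A t)"
  proof -
    have "fderiv nuf z (0, w) = fderiv (\<lambda>z. spin (lab z)) z (0, w)"
      by (rule frechet_derivative_cong[OF open_TU z nu_eq C1_differentiable[OF Ck_on_lab[OF spin1] z]]) auto
    also have "\<dots> = fderiv spin (t, y) (0, v)"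
      using frechet_comp_lab[OF spin1 z] frechet_lab_advect(2)[OF z] by (simp add: yl v_def)
    also have "\<dots> = B ** transpose (R t y) + A' ** transpose (A t)"
    proof -
      have "(spin has_derivative (\<lambda>v. fderiv Rf (t, y) (1, 0) ** transpose (fderiv Rf (t, y) v)
          + fderiv (\<lambda>z. fderiv Rf z (1, 0)) (t, y) v ** transpose (Rf (t, y)))) (at (t, y))"
        unfolding spin_def[abs_def]
        by (intro bounded_bilinear.FDERIV[OF bounded_bilinear_matrix_mult] C1_has_derivative[OF R1 ty]
            bounded_linear.has_derivative[OF bounded_linear_transpose] C1_has_derivative[OF C2_derivative[OF R2] ty])
      from frechet_derivative_eqI[OF this, of "(0, v)"] show ?thesis
        by (simp add: B_def A'_def A_def)
    qed
    finally show ?thesis .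
  qed
  have dg: "((\<lambda>s. gam s (X s y)) has_vector_derivative fderiv gamf z (1, uf z)) (at t)"
  proof -
    have "((\<lambda>s. (s, X s y)) has_derivative (\<lambda>h. h *\<^sub>R (1, uf z))) (at t)"
      using dX by (auto intro!: derivative_eq_intros simp: has_vector_derivative_def)
    from has_derivative_compose[OF this, of gamf "fderiv gamf z"]
    show ?thesis
      using C1_has_derivative[OF gam1 z] linear_cmul[OF C1_linear[OF gam1 z]] Xy
      unfolding has_vector_derivative_def by (simp add: zt del: scaleR_Pair)
  qed
  define c where "c = contract (xi0 y) v"
  have "((\<lambda>s. contract (gam s (X s y)) (F s)) has_vector_derivative
      contract (gam t (X t y)) (fderiv uf z (0, w)) + contract (fderiv gamf z (1, uf z)) (F t)) (at t)"
    by (rule bounded_bilinear.has_vector_derivative[OF bounded_bilinear_contract dg dF])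
  then have L: "((\<lambda>s. wry xi0 (s, y) v) has_vector_derivative
      contract (gam t (X t y)) (fderiv uf z (0, w)) + contract (fderiv gamf z (1, uf z)) (F t)) (at t)"
    by (rule has_vector_derivative_transform_within_open[OF _ open_T t pull])
  have "((\<lambda>s. wry xi0 (s, y) v) has_vector_derivative
      - (A t ** transpose A' + B ** transpose (R t y))
      + (R t y ** c ** transpose A' + (R t y ** 0 + A' ** c) ** transpose (R t y))) (at t)"
    unfolding wry_def fst_conv snd_conv c_def[symmetric] A_def[symmetric]
    by (intro has_vector_derivative_add has_vector_derivative_minus
        bounded_bilinear.has_vector_derivative[OF bounded_bilinear_matrix_mult] dA dR
        bounded_linear.has_vector_derivative[OF bounded_linear_transpose] has_vector_derivative_const)
  \<comment> \<open>\<open>L\<close> differentiates the Eulerian side of \<open>pull\<close> and the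
    last fact the label side; both are derivatives of the same function of time.\<close>
  from vector_derivative_unique_at[OF L this]
  have eq: "contract (gamf z) (fderiv uf z (0, w)) + contract (fderiv gamf z (1, uf z)) w
      = - (A t ** transpose A' + B ** transpose (R t y))
      + (R t y ** c ** transpose A' + (R t y ** 0 + A' ** c) ** transpose (R t y))"
    using Xv by (simp add: zt Xy F_def)
  have A't: "transpose A' = - (transpose (R t y) ** A' ** transpose (R t y))"
    and At: "transpose (A t) = - (transpose (R t y) ** A t ** transpose (R t y))"
    using transpose_frechet_R[OF ty] by (simp_all add: A'_def A_def)
  have nuz: "nuf z = A' ** transpose (R t y)" using nu_eq[OF z] by (simp add: yl spin_def A'_def)
  have gz: "contract (gamf z) w = - (A t ** transpose (R t y)) + R t y ** c ** transpose (R t y)"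
    using gam_eq[OF z, of w] by (simp add: yl v_def[symmetric] wry_def A_def c_def)
  \<comment> \<open>Once the transposed derivatives are eliminated by \<open>A't\<close> and
    \<open>At\<close>, only products of \<open>R\<close>, its transpose, \<open>A\<close>,
    \<open>A'\<close>, \<open>B\<close> and \<open>c\<close> remain, and
    \<open>R\<^sup>T R = 1\<close> reduces both sides to the same sum.\<close>
  show ?thesis
    unfolding add.commute[of "contract (fderiv gamf _ _) _"] eq nuz gz dnu commutator_def
    using cancel_right[OF R_orth(2)[OF ty]]
    by (simp add: A't At matrix_mult_distribs matrix_mul_assoc bounded_bilinear.zero_right[OF bounded_bilinear_matrix_mult])
qed

lemma wryness_transport:
  assumes t: "t \<in> T"
  shows "partial_t (\<lambda>t x. gam t x $ i) t x + advect (eulerian_velocity X t x) (\<lambda>y. gam t y $ i) x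
      + (\<Sum>k\<in>UNIV. partial_x i (\<lambda>y. eulerian_velocity X t y $ k) x *\<^sub>R (gam t x $ k))
    = commutator (eulerian_angular_velocity X R t x) (gam t x $ i) - partial_x i (eulerian_angular_velocity X R t) x"
proof -
  have z: "(t, x) \<in> TU" using t by auto
  have "partial_t (\<lambda>t x. gam t x $ i) t x + advect (eulerian_velocity X t x) (\<lambda>y. gam t y $ i) x
      = material_derivative (eulerian_velocity X) (\<lambda>t x. gam t x $ i) t x"
    by (simp add: material_derivative_def)
  also have "\<dots> = fderiv (\<lambda>z. gamf z $ i) (t, x) (1, eulerian_velocity X t x)"
    by (rule field_material[OF Ck_on_component[OF open_TU gam1] t])
  also have "\<dots> = contract (fderiv gamf (t, x) (1, uf (t, x))) (axis i 1)"
    by (simp add: frechet_component[OF C1_differentiable[OF gam1 z]])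
  finally have 1: "partial_t (\<lambda>t x. gam t x $ i) t x + advect (eulerian_velocity X t x) (\<lambda>y. gam t y $ i) x = \<dots>" .
  have "partial_x i (\<lambda>y. eulerian_velocity X t y $ k) x = fderiv uf (t, x) (0, axis i 1) $ k" for k
    by (rule trans[OF field_partial_x[OF Ck_on_component[OF open_TU u1] t] frechet_component[OF C1_differentiable[OF u1 z]]])
  then have 2: "(\<Sum>k\<in>UNIV. partial_x i (\<lambda>y. eulerian_velocity X t y $ k) x *\<^sub>R (gam t x $ k))
      = contract (gamf (t, x)) (fderiv uf (t, x) (0, axis i 1))"
    by (simp add: contract_def)
  show ?thesis unfolding 1 2 field_partial_x[OF nu1 t]
    using wryness_transport_frechet[OF z, of "axis i 1"] by simp
qed

end

section \<open>The continuity equation\<close>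

lemma bounded_subset_cball_0:
  fixes S :: "'a::real_normed_vector set"
  assumes "bounded S" obtains r where "S \<subseteq> cball 0 r"
  using assms unfolding bounded_iff by (auto simp: subset_iff)

lemma frechet_derivative_eq_0:
  assumes "open S" "z \<in> S" "\<And>y. y \<in> S \<Longrightarrow> f y = 0"
  shows "fderiv f z v = 0"
  using frechet_derivative_cong[OF assms(1,2), of f "\<lambda>_. 0" v] assms(3) by simp

context liquid_crystal
begin

text \<open>In labels the weak form of the continuity equation becomes \<open>\<integral>\<integral> \<partial>\<^sub>t (\<phi>(t, X) \<rho>\<^sub>0) dx\<^sub>0 dt = 0\<close>.\<close>

lemma continuity_equation:
  assumes t12: "t1 < t2" "{t1..t2} \<subseteq> T" and t: "t \<in> {t1..t2}"
  shows "fderiv rhof (t, x) (1, 0)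
    + (\<Sum>k\<in>UNIV. fderiv (\<lambda>z. rhof z * uf z $ k) (t, x) (0, axis k 1)) = 0"
proof -
  have "0 = fderiv rhof (t, x) (1, 0)
    + (\<Sum>k\<in>UNIV. fderiv (\<lambda>z. rhof z * uf z $ k) (t, x) (0, axis k 1))"
  proof (rule weak_Euler_Lagrange[OF open_T t12(2,1) _ rho1 _ continuous_on_const _ t])
    show "Ck_on 1 TU (\<lambda>z. rhof z * uf z $ k)" for k
      by (intro Ck_on_bilinear[OF open_TU bounded_bilinear_mult] rho1 Ck_on_component[OF open_TU u1])
  next
    fix \<phi> :: "real \<times> vec3 \<Rightarrow> real" and r
    assume tf: "test_function t1 t2 r \<phi>"
    note \<phi> = test_functionD(1)[OF tf] and \<phi>0 = test_functionD(2,3)[OF tf] and \<phi>s = test_functionD(4)[OF tf]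
    have \<phi>1: "Ck_on 1 UNIV \<phi>" by (rule C2_C1[OF \<phi>])
    \<comment> \<open>The material derivative of \<open>\<phi>\<close>, against which the weak
      equation integrates \<open>rho\<close>.\<close>
    define \<psi> where "\<psi> z = fderiv \<phi> z (1, uf z)" for z
    have \<psi>c: "continuous_on TU \<psi>"
      unfolding \<psi>_def
      by (rule continuous_on_frechet_derivative[of 0 UNIV])
        (use \<phi>1 in \<open>auto intro!: continuous_intros Ck_on_continuous[OF u1]\<close>)
    have \<psi>0: "\<psi> (t, x) = 0" if "x \<notin> cball 0 (r - 1)" for t x
      unfolding \<psi>_def
    proof (rule frechet_derivative_eq_0)
      show "open (UNIV \<times> - cball (0::vec3) (r - 1))" by (intro open_Times) auto
    qed (use that \<phi>s in auto)
    \<comment> \<open>One label ball that contains the preimages of \<open>cball 0 r\<close> for all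
      times of the compact interval.\<close>
    obtain r' where r': "label ` ({t1..t2} \<times> cball 0 r) \<subseteq> cball 0 r'"
    proof -
      have "compact (label ` ({t1..t2} \<times> cball 0 r))"
        using t12(2)
        by (intro compact_continuous_image continuous_on_subset[OF Ck_on_continuous[OF label2]] compact_Times) auto
      then show ?thesis using that compact_imp_bounded by (meson bounded_subset_cball_0)
    qed
    define \<Phi> where "\<Phi> z = \<phi> (fst z, Xf z) * rho0 (snd z)" for z
    have g1: "Ck_on 1 TU (\<lambda>z. (fst z, Xf z))"
      by (intro Ck_on_Pair open_TU C2_C1[OF X2] Ck_on_linear bounded_linear_fst)
    have \<Phi>1: "Ck_on 1 TU \<Phi>"
      unfolding \<Phi>_def[abs_def]
      by (intro Ck_on_bilinear[OF open_TU bounded_bilinear_mult] Ck_on_snd_comp[OF rho0(1)]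
        Ck_on_compose[OF open_TU \<phi>1 g1] subset_UNIV)
    have d\<Phi>: "fderiv \<Phi> (s, y) (1, 0) = \<psi> (s, X s y) * rho0 y" if s: "s \<in> T" for s y
    proof -
      have z: "(s, y) \<in> TU" "(s, X s y) \<in> TU" using s by auto
      have g: "((\<lambda>z. (fst z, Xf z)) has_derivative (\<lambda>v. (fst v, fderiv Xf (s, y) v))) (at (s, y))"
        by (intro has_derivative_Pair has_derivative_fst has_derivative_ident C1_has_derivative[OF C2_C1[OF X2] z(1)])
      have "((\<lambda>z. \<phi> (fst z, Xf z)) has_derivative (\<lambda>v. fderiv \<phi> (s, X s y) (fst v, fderiv Xf (s, y) v))) (at (s, y))"
        using has_derivative_compose[OF g, of \<phi>] C1_has_derivative[OF \<phi>1, of "(s, X s y)"] by simp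
      moreover have "((\<lambda>z. rho0 (snd z)) has_derivative (\<lambda>v. fderiv rho0 y (snd v))) (at (s, y))"
        using has_derivative_compose[OF has_derivative_snd[OF has_derivative_ident], of rho0 "fderiv rho0 y" "(s, y)"]
          C1_has_derivative[OF rho0(1), of y] by simp
      ultimately have "(\<Phi> has_derivative (\<lambda>v. \<phi> (fst (s, y), Xf (s, y)) * fderiv rho0 y (snd v)
          + fderiv \<phi> (s, X s y) (fst v, fderiv Xf (s, y) v) * rho0 (snd (s, y)))) (at (s, y))"
        unfolding \<Phi>_def[abs_def] by (rule has_derivative_mult)
      from frechet_derivative_eqI[OF this, of "(1, 0)"]
      show ?thesis
        using velocity_eq[OF z(2)] lab_X[OF s] linear_0[OF C1_linear[OF rho0(1) UNIV_I]] by (simp add: \<psi>_def)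
    qed
    have inner: "integral (cball 0 r) (\<lambda>x. rhof (s, x) * \<psi> (s, x)) = integral (cball 0 r') (\<lambda>y. fderiv \<Phi> (s, y) (1, 0))"
      if s: "s \<in> {t1..t2}" for s
    proof -
      have sT: "s \<in> T" using s t12 by auto
      have "integral (cball 0 r) (\<lambda>x. rhof (s, x) * \<psi> (s, x)) = integral UNIV (\<lambda>x. \<psi> (s, x) *\<^sub>R rho s x)"
        by (subst integral_eq_integral_UNIV) (use \<psi>0[of _ s] in \<open>auto simp: mult.commute\<close>)
      \<comment> \<open>At a fixed time \<open>\<psi>\<close> is continuous with bounded support,
        hence a test function for the delta integral; no Jacobian has to be differentiated.\<close>
      also have "\<dots> = integral UNIV (\<lambda>y. \<psi> (s, X s y) *\<^sub>R rho0 y)"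
      proof -
        have "bounded {x. \<psi> (s, x) \<noteq> 0}" by (rule bounded_subset[OF bounded_cball[of 0 "r - 1"]]) (use \<psi>0[of _ s] in blast)
        then show ?thesis
          using rho(2)[OF sT] continuous_on_st_slice[OF \<psi>c sT] by (simp add: is_eulerian_density_def is_delta_integral_def)
      qed
      also have "\<dots> = integral (cball 0 r') (\<lambda>y. \<psi> (s, X s y) *\<^sub>R rho0 y)"
      proof (rule integral_eq_integral_UNIV[symmetric])
        fix y :: vec3 assume y: "y \<notin> cball 0 r'"
        have "X s y \<notin> cball 0 r"
        proof
          assume "X s y \<in> cball 0 r"
          then have "label (s, X s y) \<in> cball 0 r'" using r' s by blast
          then show False using y lab_X[OF sT, of y] by (simp add: lab_def)
        qed
        then show "\<psi> (s, X s y) *\<^sub>R rho0 y = 0" using \<psi>0[of "X s y" s] by auto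
      qed
      finally show ?thesis by (simp add: d\<Phi>[OF sT])
    qed
    have "weak_form t1 t2 r UNIV rhof (\<lambda>k z. rhof z * uf z $ k) (\<lambda>k. axis k 1) (\<lambda>_. 0) \<phi>
      = st_integral t1 t2 r (\<lambda>z. rhof z * \<psi> z)"
      unfolding weak_form_def
    proof (rule st_integral_cong)
      fix s x
      have l: "linear (fderiv \<phi> (s, x))" by (rule C1_linear[OF \<phi>1 UNIV_I])
      have "fderiv \<phi> (s, x) (1, uf (s, x)) = fderiv \<phi> (s, x) (1, 0)
          + fderiv \<phi> (s, x) (0, uf (s, x))"
        using linear_add[OF l, of "(1, 0)" "(0, uf (s, x))"] by simp
      also have "fderiv \<phi> (s, x) (0, uf (s, x))
          = (\<Sum>k\<in>UNIV. uf (s, x) $ k *\<^sub>R fderiv \<phi> (s, x) (0, axis k 1))"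
        by (rule linear_axis_expand[OF linear_space_part[OF l]])
      finally show "rhof (s, x) * fderiv \<phi> (s, x) (1, 0)
        + (\<Sum>k\<in>UNIV. rhof (s, x) * uf (s, x) $ k * fderiv \<phi> (s, x) (0, axis k 1)) + 0 * \<phi> (s, x)
        = rhof (s, x) * \<psi> (s, x)"
        by (simp add: \<psi>_def distrib_left sum_distrib_left mult.assoc)
    qed
    also have "\<dots> = st_integral t1 t2 r' (\<lambda>z. fderiv \<Phi> z (1, 0))"
      unfolding st_integral_def using inner by (intro integral_cong) simp
    also have "\<dots> = 0"
      using st_integral_time_derivative[OF \<Phi>1 t12(2) open_T] t12 \<phi>0 by (simp add: \<Phi>_def)
    finally show "weak_form t1 t2 r UNIV rhof (\<lambda>k z. rhof z * uf z $ k) (\<lambda>k. axis k 1) (\<lambda>_. 0) \<phi> = 0" .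
  qed auto
  then show ?thesis by simp
qed

text \<open>The product-rule terms in which \<open>f\<close> is not differentiated add up to
  \<open>f\<close> times the continuity equation. This passes from the conservation form that the
  weak equation delivers to \<open>rho\<close> times a material derivative.\<close>

lemma conservative_material_derivative:
  fixes f :: "real \<times> vec3 \<Rightarrow> real"
  assumes t12: "t1 < t2" "{t1..t2} \<subseteq> T" and t: "t \<in> {t1..t2}" and f: "Ck_on 1 TU f"
  shows "fderiv (\<lambda>z. rhof z * f z) (t, x) (1, 0)
    + (\<Sum>k\<in>UNIV. fderiv (\<lambda>z. rhof z * f z * uf z $ k) (t, x) (0, axis k 1))
    = rho t x * fderiv f (t, x) (1, uf (t, x))"
proof -
  define z where "z = (t, x)"
  have z: "z \<in> TU" using t t12 by (auto simp: z_def)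
  note m = bounded_bilinear_mult[where 'a=real]
  have ru1: "Ck_on 1 TU (\<lambda>z. rhof z * uf z $ k)" for k
    by (intro Ck_on_bilinear[OF open_TU m] rho1 Ck_on_component[OF open_TU u1])
  have 1: "fderiv (\<lambda>z. rhof z * f z) z (1, 0)
    = rhof z * fderiv f z (1, 0) + fderiv rhof z (1, 0) * f z"
    by (rule frechet_derivative_bilinear[OF m C1_differentiable[OF rho1 z] C1_differentiable[OF f z]])
  have "(\<lambda>z. rhof z * f z * uf z $ k) = (\<lambda>z. (rhof z * uf z $ k) * f z)" for k by (simp add: fun_eq_iff)
  then have 2: "fderiv (\<lambda>z. rhof z * f z * uf z $ k) z v
    = rhof z * uf z $ k * fderiv f z v + fderiv (\<lambda>z. rhof z * uf z $ k) z v * f z" for k v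
    using frechet_derivative_bilinear[OF m C1_differentiable[OF ru1 z] C1_differentiable[OF f z]] by simp
  have l: "linear (fderiv f z)" by (rule C1_linear[OF f z])
  have 3: "fderiv f z (1, uf z) = fderiv f z (1, 0)
    + (\<Sum>k\<in>UNIV. uf z $ k * fderiv f z (0, axis k 1))"
    using linear_add[OF l, of "(1, 0)" "(0, uf z)"] linear_axis_expand[OF linear_space_part[OF l], of "uf z"] by simp
  have "fderiv (\<lambda>z. rhof z * f z) z (1, 0)
    + (\<Sum>k\<in>UNIV. fderiv (\<lambda>z. rhof z * f z * uf z $ k) z (0, axis k 1))
    = rhof z * fderiv f z (1, uf z)
     + f z * (fderiv rhof z (1, 0) + (\<Sum>k\<in>UNIV. fderiv (\<lambda>z. rhof z * uf z $ k) z (0, axis k 1)))"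
    unfolding 1 2 3 by (simp add: sum.distrib sum_distrib_left algebra_simps)
  then show ?thesis using continuity_equation[OF t12 t] by (simp add: z_def)
qed

end

subsection \<open>Gradients of the free energy\<close>

lemma trace_pairing_inner: "trace_pairing A B = A \<bullet> B"
  unfolding trace_pairing_def trace_def transpose_def matrix_matrix_mult_def inner_vec_def
  by (subst sum.swap) simp

lemma inner_transpose: "transpose A \<bullet> transpose B = (A \<bullet> B :: real)" for A B :: mat3
  unfolding inner_vec_def by (subst sum.swap) (simp add: transpose_def)

lemma inner_transpose_left: "transpose A \<bullet> B = (A \<bullet> transpose B :: real)" for A B :: mat3
  using inner_transpose[of A "transpose B"] by simp

lemma trace_transpose: "trace (transpose A) = trace A"
  by (simp add: trace_def transpose_def)

lemma inner_matrix_mult: "A \<bullet> (B ** C) = B \<bullet> (A ** transpose C)" "A \<bullet> (C ** B) = B \<bullet> (transpose C ** A)" for A B C :: mat3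
proof -
  have "transpose (transpose B ** (A ** transpose C)) = C ** (transpose A ** B)"
    by (simp add: matrix_transpose_mul matrix_mul_assoc)
  then have "trace (transpose B ** (A ** transpose C)) = trace (C ** (transpose A ** B))"
    using trace_transpose by metis
  also have "\<dots> = trace (transpose A ** (B ** C))" by (subst trace_mul_sym) (simp add: matrix_mul_assoc)
  finally show "A \<bullet> (B ** C) = B \<bullet> (A ** transpose C)"
    unfolding trace_pairing_inner[symmetric] trace_pairing_def by simp
  have "transpose (transpose B ** (transpose C ** A)) = transpose A ** (C ** B)"
    by (simp add: matrix_transpose_mul matrix_mul_assoc)
  then show "A \<bullet> (C ** B) = B \<bullet> (transpose C ** A)"
    unfolding trace_pairing_inner[symmetric] trace_pairing_def using trace_transpose by metis
qed

text \<open>The adjoint of bracketing with \<open>C\<close>. It frees a constant \<open>H\<close>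
  from a commutator, and for symmetric or antisymmetric \<open>C\<close> the transpose amounts to a
  sign.\<close>

lemma inner_commutator: "A \<bullet> commutator B C = B \<bullet> commutator A (transpose C)"
  unfolding commutator_def inner_diff_right
  using inner_matrix_mult(1)[of A B C] inner_matrix_mult(2)[of A C B] by simp

lemma transpose_diff: "transpose (A - B) = transpose A - transpose (B :: mat3)"
  and transpose_uminus: "transpose (- A) = - transpose (A :: mat3)"
  and transpose_plus: "transpose (A + B) = transpose A + transpose (B :: mat3)"
  and transpose_scaleR: "transpose (r *\<^sub>R A) = r *\<^sub>R transpose (A :: mat3)"
  by (simp_all add: transpose_def vec_eq_iff)

lemma transpose_commutator: "transpose (commutator A B) = commutator (transpose B) (transpose A)"
  by (simp add: commutator_def transpose_diff matrix_transpose_mul)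

text \<open>\<open>grad_Q\<close> and \<open>grad_gamma\<close> below are the symmetric and antisymmetric parts of the full gradient.\<close>

definition riesz :: "(mat3 \<Rightarrow> real) \<Rightarrow> mat3" where
  "riesz L = (\<Sum>b\<in>Basis. L b *\<^sub>R b)"

lemma riesz: assumes "linear L" shows "riesz L \<bullet> H = L H"
proof -
  have "L H = L (\<Sum>b\<in>Basis. (H \<bullet> b) *\<^sub>R b)" by (simp add: euclidean_representation)
  then show ?thesis
    unfolding riesz_def inner_sum_left
    by (simp add: linear_sum[OF assms] linear_cmul[OF assms] inner_commute mult.commute)
qed

locale free_energy =
  fixes Psi :: "mat3 \<Rightarrow> wryness \<Rightarrow> real"
  assumes Psi2: "Ck_on 2 UNIV (\<lambda>z. Psi (fst z) (snd z))"
begin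

abbreviation "Psif \<equiv> \<lambda>z. Psi (fst z) (snd z)"

definition "grad_Q z = (let M = riesz (\<lambda>H. fderiv Psif z (H, 0)) in (1/2) *\<^sub>R (M + transpose M))"
definition "grad_gamma l z = (let M = riesz (\<lambda>H. fderiv Psif z (0, axis l H)) in (1/2) *\<^sub>R (M - transpose M))"

lemma linear_Psi: "linear (fderiv Psif z)"
  by (rule C1_linear[OF C2_C1[OF Psi2] UNIV_I])

lemma linear_axis: "linear (\<lambda>H. axis l H :: wryness)"
  by (rule linearI) (auto simp: axis_def vec_eq_iff)

lemma sym_grad_Q: "symmetric (grad_Q z)"
  by (simp add: symmetric_def grad_Q_def Let_def transpose_plus transpose_scaleR add.commute)

lemma antisym_grad_gamma: "antisymmetric (grad_gamma l z)"
  by (simp add: antisymmetric_def grad_gamma_def Let_def transpose_diff transpose_scaleR scaleR_diff_right)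

lemma grad_Q_inner:
  assumes "symmetric H" shows "grad_Q z \<bullet> H = fderiv Psif z (H, 0)"
proof -
  have "linear (\<lambda>H. fderiv Psif z (H, 0))"
    by (rule linear_compose[OF _ linear_Psi, unfolded o_def]) (auto intro: linearI)
  from riesz[OF this, of H] show ?thesis
    using assms by (simp add: grad_Q_def Let_def inner_add_left inner_transpose_left symmetric_def)
qed

lemma grad_gamma_inner:
  assumes "antisymmetric H" shows "grad_gamma l z \<bullet> H = fderiv Psif z (0, axis l H)"
proof -
  have "linear (\<lambda>H. (0::mat3, axis l H :: wryness))"
    using linear_add[OF linear_axis] linear_cmul[OF linear_axis] by (auto intro!: linearI)
  then have "linear (\<lambda>H. fderiv Psif z (0, axis l H))"
    by (rule linear_compose[OF _ linear_Psi, unfolded o_def])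
  from riesz[OF this, of H] show ?thesis
    using assms by (simp add: grad_gamma_def Let_def inner_diff_left inner_transpose_left antisymmetric_def)
qed

text \<open>An equivalence, so that it gives existence as well as uniqueness of the derivatives
  inside the \<open>THE\<close> of the two gradients.\<close>

lemma Psi_directional:
  "((\<lambda>s. Psif (z + s *\<^sub>R v)) has_real_derivative D) (at 0) \<longleftrightarrow> D = fderiv Psif z v"
proof -
  have "((\<lambda>s. Psif (z + s *\<^sub>R v)) has_vector_derivative fderiv Psif z v) (at 0)"
    using has_vector_derivative_along[of Psif _ z 0 v] C1_has_derivative[OF C2_C1[OF Psi2], of z] by simp
  from vector_derivative_unique_at[OF _ this] this show ?thesis
    unfolding has_real_derivative_iff_has_vector_derivative by blast
qed

lemma dPsi_dQ_eq: "dPsi_dQ Psi Q g = grad_Q (Q, g)"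
  unfolding dPsi_dQ_def
proof (rule the_equality)
  have d: "((\<lambda>s. Psi (Q + s *\<^sub>R H) g) has_real_derivative D) (at 0) \<longleftrightarrow> D = fderiv Psif (Q, g) (H, 0)" for H D
    using Psi_directional[of "(Q, g)" "(H, 0)" D] by simp
  then show *: "symmetric (grad_Q (Q, g)) \<and> (\<forall>H. symmetric H \<longrightarrow>
    ((\<lambda>s. Psi (Q + s *\<^sub>R H) g) has_real_derivative trace_pairing (grad_Q (Q, g)) H) (at 0))"
    by (simp add: sym_grad_Q trace_pairing_inner grad_Q_inner)
  fix A assume A: "symmetric A \<and> (\<forall>H. symmetric H \<longrightarrow>
    ((\<lambda>s. Psi (Q + s *\<^sub>R H) g) has_real_derivative trace_pairing A H) (at 0))"
  \<comment> \<open>The difference of two candidates is symmetric, thus an admissible increment;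
    paired with itself it turns out to be zero.\<close>
  have s: "symmetric (A - grad_Q (Q, g))" using A sym_grad_Q by (simp add: symmetric_def transpose_diff)
  then have "A \<bullet> (A - grad_Q (Q, g)) = grad_Q (Q, g) \<bullet> (A - grad_Q (Q, g))"
    using A by (simp add: d trace_pairing_inner grad_Q_inner)
  then have "(A - grad_Q (Q, g)) \<bullet> (A - grad_Q (Q, g)) = 0" by (simp add: inner_diff_left)
  then show "A = grad_Q (Q, g)" by simp
qed

lemma dPsi_dgamma_eq: "dPsi_dgamma Psi l Q g = grad_gamma l (Q, g)"
  unfolding dPsi_dgamma_def
proof (rule the_equality)
  have d: "((\<lambda>s. Psi Q (g + s *\<^sub>R axis l H)) has_real_derivative D) (at 0) \<longleftrightarrow> D = fderiv Psif (Q, g) (0, axis l H)" for H D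
    using Psi_directional[of "(Q, g)" "(0, axis l H)" D] by simp
  then show *: "antisymmetric (grad_gamma l (Q, g)) \<and> (\<forall>H. antisymmetric H \<longrightarrow>
    ((\<lambda>s. Psi Q (g + s *\<^sub>R axis l H)) has_real_derivative trace_pairing (grad_gamma l (Q, g)) H) (at 0))"
    by (simp add: antisym_grad_gamma trace_pairing_inner grad_gamma_inner)
  fix A assume A: "antisymmetric A \<and> (\<forall>H. antisymmetric H \<longrightarrow>
    ((\<lambda>s. Psi Q (g + s *\<^sub>R axis l H)) has_real_derivative trace_pairing A H) (at 0))"
  have s: "antisymmetric (A - grad_gamma l (Q, g))" using A antisym_grad_gamma by (simp add: antisymmetric_def transpose_diff)
  then have "A \<bullet> (A - grad_gamma l (Q, g)) = grad_gamma l (Q, g) \<bullet> (A - grad_gamma l (Q, g))"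
    using A by (simp add: d trace_pairing_inner grad_gamma_inner)
  then have "(A - grad_gamma l (Q, g)) \<bullet> (A - grad_gamma l (Q, g)) = 0" by (simp add: inner_diff_left)
  then show "A = grad_gamma l (Q, g)" by simp
qed

lemma frechet_Psi:
  assumes "symmetric q" "\<And>i. antisymmetric (h $ i)"
  shows "fderiv Psif z (q, h) = grad_Q z \<bullet> q + (\<Sum>i\<in>UNIV. grad_gamma i z \<bullet> (h $ i))"
proof -
  have h: "(\<Sum>i\<in>UNIV. axis i (h $ i)) = h"
    unfolding vec_eq_iff by (simp add: axis_def if_distrib cong: if_cong)
  have "linear (\<lambda>h. (0::mat3, h :: wryness))" by (auto intro: linearI)
  then have l: "linear (\<lambda>h. fderiv Psif z (0, h))"
    by (rule linear_compose[OF _ linear_Psi, unfolded o_def])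
  have "fderiv Psif z (q, h) = fderiv Psif z (q, 0) + fderiv Psif z (0, h)"
    using linear_add[OF linear_Psi[of z], of "(q, 0)" "(0, h)"] by simp
  also have "fderiv Psif z (0, h) = (\<Sum>i\<in>UNIV. fderiv Psif z (0, axis i (h $ i)))"
    by (subst h[symmetric], subst linear_sum[OF l]) simp
  finally show ?thesis using assms by (simp add: grad_Q_inner grad_gamma_inner)
qed

lemma C1_grad_Q: "Ck_on 1 UNIV grad_Q"
proof -
  have M: "Ck_on 1 UNIV (\<lambda>z. riesz (\<lambda>H. fderiv Psif z (H, 0)))"
    unfolding riesz_def
    by (intro Ck_on_sum[OF open_UNIV] Ck_on_bilinear[OF open_UNIV bounded_bilinear_scaleR] C2_derivative[OF Psi2] Ck_on_const)
  show ?thesis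
    unfolding grad_Q_def[abs_def] Let_def
    by (intro Ck_on_linear_comp[OF open_UNIV bounded_linear_scaleR_right] Ck_on_add[OF open_UNIV] M
        Ck_on_linear_comp[OF open_UNIV bounded_linear_transpose])
qed

text \<open>One derivative of \<open>Psi\<close> is spent here: the result enters the coefficients
  \<open>b\<close> of the weak equations, which have to be C^1.\<close>

lemma C1_grad_gamma: "Ck_on 1 UNIV (grad_gamma l)"
proof -
  have M: "Ck_on 1 UNIV (\<lambda>z. riesz (\<lambda>H. fderiv Psif z (0, axis l H)))"
    unfolding riesz_def
    by (intro Ck_on_sum[OF open_UNIV] Ck_on_bilinear[OF open_UNIV bounded_bilinear_scaleR] C2_derivative[OF Psi2] Ck_on_const)
  show ?thesis
    unfolding grad_gamma_def[abs_def] Let_def diff_conv_add_uminus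
    by (intro Ck_on_linear_comp[OF open_UNIV bounded_linear_scaleR_right] Ck_on_add[OF open_UNIV] M
        Ck_on_linear_comp[OF open_UNIV bounded_linear_minus[OF bounded_linear_ident]]
        Ck_on_linear_comp[OF open_UNIV bounded_linear_transpose])
qed

end

lemma Ck_on_mult: "open S \<Longrightarrow> Ck_on k S f \<Longrightarrow> Ck_on k S g \<Longrightarrow> Ck_on k S (\<lambda>x. f x * g x :: real)"
  by (rule Ck_on_bilinear[OF _ bounded_bilinear_mult])

lemma Ck_on_diff: "open S \<Longrightarrow> Ck_on k S f \<Longrightarrow> Ck_on k S g \<Longrightarrow> Ck_on k S (\<lambda>x. f x - g x)"
  unfolding diff_conv_add_uminus
  by (intro Ck_on_add Ck_on_linear_comp[OF _ bounded_linear_minus[OF bounded_linear_ident]])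

text \<open>Putting commutators in place of the gradient of \<open>Q\<close> leaves a polynomial in
  the entries of both arguments.\<close>

lemma Ck_on_landau_de_gennes:
  "Ck_on k UNIV (\<lambda>z. landau_de_gennes \<alpha> L1 L2 P \<beta> c (fst z) (\<chi> i. commutator (fst z) (snd z $ i)))"
proof -
  have Q: "Ck_on k UNIV (\<lambda>z :: mat3 \<times> wryness. fst z)" and g: "Ck_on k UNIV (\<lambda>z :: mat3 \<times> wryness. snd z)"
    by (intro Ck_on_linear[OF open_UNIV] bounded_linear_fst bounded_linear_snd)+
  show ?thesis
    unfolding landau_de_gennes_def vec_lambda_beta power2_eq_square
    by (intro Ck_on_diff Ck_on_add Ck_on_mult Ck_on_sum Ck_on_const open_UNIV
        Ck_on_component Ck_on_bilinear[OF open_UNIV bounded_bilinear_commutator] Q g)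
qed

subsection \<open>The first variation\<close>

text \<open>The Lagrangian is smooth on the open set \<open>\<Omega>\<close>. The unperturbed states
  form a compact part of it, so for small \<open>e\<close> the perturbed states stay inside, and the
  integrals over the ball and over time are differentiated one after the other.\<close>

lemma has_real_derivative_action:
  fixes L :: "'z::euclidean_space \<Rightarrow> real" and z dz :: "real \<times> 'a::euclidean_space \<Rightarrow> 'z"
  assumes \<Omega>: "open \<Omega>" and L: "Ck_on 1 \<Omega> L"
    and z: "continuous_on ({t1..t2} \<times> cball 0 r) z" "z ` ({t1..t2} \<times> cball 0 r) \<subseteq> \<Omega>"
    and dz: "continuous_on ({t1..t2} \<times> cball 0 r) dz"
  shows "((\<lambda>e. st_integral t1 t2 r (\<lambda>p. L (z p + e *\<^sub>R dz p))) has_real_derivative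
    st_integral t1 t2 r (\<lambda>p. fderiv L (z p) (dz p))) (at 0)"
proof -
  define K where "K = {t1..t2} \<times> cball (0::'a) r"
  have K: "compact K" by (auto simp: K_def intro: compact_Times)
  have L': "Ck_on (Suc 0) \<Omega> L" using L by simp
  obtain \<epsilon> where \<epsilon>: "\<epsilon> > 0" "\<And>p. p \<in> K \<Longrightarrow> cball (z p) \<epsilon> \<subseteq> \<Omega>"
  proof -
    have "compact (z ` K)" using K z(1) by (auto simp: K_def intro: compact_continuous_image)
    then obtain \<epsilon> where "\<epsilon> > 0" "(\<Union>x\<in>z ` K. cball x \<epsilon>) \<subseteq> \<Omega>"
      using compact_subset_open_imp_cball_epsilon_subset[OF _ \<Omega>] z(2) unfolding K_def by metis
    then show ?thesis by (intro that[of \<epsilon>]) auto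
  qed
  obtain M where M: "\<And>p. p \<in> K \<Longrightarrow> norm (dz p) \<le> M"
  proof -
    have "compact (dz ` K)" using K dz by (auto simp: K_def intro: compact_continuous_image)
    then have "bounded (dz ` K)" by (rule compact_imp_bounded)
    then show ?thesis using that unfolding bounded_iff by blast
  qed
  \<comment> \<open>The denominator is \<open>\<bar>M\<bar> + 1\<close> because the bound
    \<open>M\<close> may be 0, or even negative when \<open>K\<close> is empty.\<close>
  define d where "d = \<epsilon> / (\<bar>M\<bar> + 1)"
  have d: "d > 0" using \<epsilon>(1) by (simp add: d_def add_nonneg_pos)
  define U where "U = {-d<..<d}"
  have U: "open U" "0 \<in> U" using d by (auto simp: U_def)
  have in\<Omega>: "z p + e *\<^sub>R dz p \<in> \<Omega>" if "e \<in> U" "p \<in> K" for e p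
  proof -
    have "norm (e *\<^sub>R dz p) \<le> d * (\<bar>M\<bar> + 1)"
      unfolding norm_scaleR using that M[OF that(2)] d by (intro mult_mono) (auto simp: U_def)
    also have "\<dots> = \<epsilon>" by (simp add: d_def add_nonneg_pos)
    finally have "z p + e *\<^sub>R dz p \<in> cball (z p) \<epsilon>" by (simp add: dist_norm)
    then show ?thesis using \<epsilon>(2)[OF that(2)] by blast
  qed
  define L1 where "L1 e p = fderiv L (z p + e *\<^sub>R dz p) (dz p)" for e p
  have dL: "((\<lambda>e. L (z p + e *\<^sub>R dz p)) has_vector_derivative L1 e p) (at e)" if "e \<in> U" "p \<in> K" for e p
    unfolding L1_def by (rule has_vector_derivative_along[OF C1_has_derivative[OF L in\<Omega>[OF that]]])
  have zK: "continuous_on A (\<lambda>a. z (f a))" if "continuous_on A f" "f ` A \<subseteq> K" for A and f :: "'x::topological_space \<Rightarrow> _"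
    by (rule continuous_on_compose2[OF z(1)]) (use that in \<open>auto simp: K_def\<close>)
  have dzK: "continuous_on A (\<lambda>a. dz (f a))" if "continuous_on A f" "f ` A \<subseteq> K" for A and f :: "'x::topological_space \<Rightarrow> _"
    by (rule continuous_on_compose2[OF dz]) (use that in \<open>auto simp: K_def\<close>)
  have L1c: "continuous_on A (\<lambda>a. L1 (g a) (f a))"
    if "continuous_on A f" "f ` A \<subseteq> K" "continuous_on A g" "g ` A \<subseteq> U" for A and f :: "'x::topological_space \<Rightarrow> _" and g
    unfolding L1_def
    by (rule continuous_on_frechet_derivative[OF L'])
      (use that in\<Omega> in \<open>auto intro!: continuous_intros zK dzK simp: image_subset_iff\<close>)
  have Lc: "continuous_on A (\<lambda>a. L (z (f a) + e *\<^sub>R dz (f a)))"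
    if "continuous_on A f" "f ` A \<subseteq> K" "e \<in> U" for A and f :: "'x::topological_space \<Rightarrow> _" and e
    by (rule continuous_on_compose2[OF Ck_on_continuous[OF L]])
      (use that in\<Omega> in \<open>auto intro!: continuous_intros zK dzK simp: image_subset_iff\<close>)
  have inner: "((\<lambda>e. integral (cball 0 r) (\<lambda>x. L (z (t, x) + e *\<^sub>R dz (t, x)))) has_vector_derivative
      integral (cball 0 r) (\<lambda>x. L1 e (t, x))) (at e)" if t: "t \<in> {t1..t2}" and e: "e \<in> U" for t e
  proof (rule has_vector_derivative_integral_compact[OF compact_cball U(1) e])
    show "continuous_on (cball 0 r) (\<lambda>x. L (z (t, x) + e *\<^sub>R dz (t, x)))" if "e \<in> U" for e
      by (rule Lc[OF _ _ that]) (use t in \<open>auto intro!: continuous_intros simp: K_def\<close>)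
    show "((\<lambda>e. L (z (t, x) + e *\<^sub>R dz (t, x))) has_vector_derivative L1 e (t, x)) (at e)"
      if "e \<in> U" "x \<in> cball 0 r" for e x
      by (rule dL) (use that t in \<open>auto simp: K_def\<close>)
    show "continuous_on (U \<times> cball 0 r) (\<lambda>(e, x). L1 e (t, x))"
      unfolding case_prod_beta
      by (rule L1c) (use t in \<open>auto intro!: continuous_intros simp: K_def\<close>)
  qed
  have "((\<lambda>e. integral {t1..t2} (\<lambda>t. integral (cball 0 r) (\<lambda>x. L (z (t, x) + e *\<^sub>R dz (t, x))))) has_vector_derivative
      integral {t1..t2} (\<lambda>t. integral (cball 0 r) (\<lambda>x. L1 0 (t, x)))) (at 0)"
  proof (rule has_vector_derivative_integral_compact[OF compact_Icc U _ inner])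
    show "continuous_on {t1..t2} (\<lambda>t. integral (cball 0 r) (\<lambda>x. L (z (t, x) + e *\<^sub>R dz (t, x))))" if "e \<in> U" for e
    proof (rule continuous_on_integral_compact[OF compact_cball])
      show "continuous_on ({t1..t2} \<times> cball 0 r) (\<lambda>(t, x). L (z (t, x) + e *\<^sub>R dz (t, x)))"
        unfolding case_prod_beta by (rule Lc[OF _ _ that]) (auto intro!: continuous_intros simp: K_def)
    qed
    show "continuous_on (U \<times> {t1..t2}) (\<lambda>(e, t). integral (cball 0 r) (\<lambda>x. L1 e (t, x)))"
      unfolding case_prod_beta
    proof (rule continuous_on_integral_compact[OF compact_cball])
      show "continuous_on ((U \<times> {t1..t2}) \<times> cball 0 r) (\<lambda>(p, x). L1 (fst p) (snd p, x))"
        unfolding case_prod_beta by (rule L1c) (auto intro!: continuous_intros simp: K_def)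
    qed
  qed auto
  then show ?thesis
    by (simp add: st_integral_def L1_def has_real_derivative_iff_has_vector_derivative)
qed

context free_energy
begin

text \<open>The five fields are bundled into one state, so that the first variation is a single
  Frechet derivative.\<close>

definition lag :: "real \<Rightarrow> (real \<Rightarrow> real) \<Rightarrow> vec3 \<times> real \<times> mat3 \<times> mat3 \<times> wryness \<Rightarrow> real" where
  "lag J U = (\<lambda>(u, rho, nu, Q, gam). lagrangian_density J U Psi u rho nu Q gam)"

lemma open_pos_density: "open {z :: vec3 \<times> real \<times> mat3 \<times> mat3 \<times> wryness. fst (snd z) > 0}"
  by (intro open_Collect_less continuous_intros)

lemma lag_C1:
  assumes U: "Ck_on 2 {0<..} U"
  shows "Ck_on 1 {z. fst (snd z) > 0} (lag J U)"
proof -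
  let ?S = "{z :: vec3 \<times> real \<times> mat3 \<times> mat3 \<times> wryness. fst (snd z) > 0}"
  note o = open_pos_density
  have p: "Ck_on 1 ?S (\<lambda>z. fst z)" "Ck_on 1 ?S (\<lambda>z. fst (snd z))" "Ck_on 1 ?S (\<lambda>z. fst (snd (snd z)))"
    "Ck_on 1 ?S (\<lambda>z. fst (snd (snd (snd z))))" "Ck_on 1 ?S (\<lambda>z. snd (snd (snd (snd z))))"
    by (intro Ck_on_linear_comp[OF o bounded_linear_fst] Ck_on_linear_comp[OF o bounded_linear_snd]
        Ck_on_linear[OF o bounded_linear_fst] Ck_on_linear[OF o bounded_linear_snd])+
  have Ur: "Ck_on 1 ?S (\<lambda>z. U (fst (snd z)))"
    by (rule Ck_on_compose[OF o C2_C1[OF U] p(2)]) auto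
  have Pr: "Ck_on 1 ?S (\<lambda>z. Psif (fst (snd (snd (snd z))), snd (snd (snd (snd z)))))"
    by (rule Ck_on_compose[OF o C2_C1[OF Psi2] Ck_on_Pair[OF o p(4,5)]]) auto
  have "Ck_on 1 ?S (\<lambda>z. 1 / 2 * fst (snd z) * (fst z \<bullet> fst z)
      + J / 2 * fst (snd z) * (commutator (fst (snd (snd z))) (fst (snd (snd (snd z)))) \<bullet> commutator (fst (snd (snd z))) (fst (snd (snd (snd z)))))
      - fst (snd z) * U (fst (snd z)) - Psif (fst (snd (snd (snd z))), snd (snd (snd (snd z)))))"
    by (intro Ck_on_diff Ck_on_add Ck_on_mult Ck_on_const o Ur Pr p
        Ck_on_bilinear[OF o bounded_bilinear_inner] Ck_on_bilinear[OF o bounded_bilinear_commutator])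
  then show ?thesis
    by (simp add: lag_def lagrangian_density_def case_prod_beta' power2_norm_eq_inner)
qed

text \<open>Both sides are the derivative at 0 along the line through the state in the direction of
  the increment, so one-variable rules and uniqueness suffice.\<close>

lemma frechet_lag:
  assumes U: "Ck_on 2 {0<..} U" and rho: "rho > 0"
  shows "fderiv (lag J U) (u, rho, n, q, g) (a, r, n', q', h)
    = rho * (u \<bullet> a)
      + (1 / 2 * (u \<bullet> u) + J / 2 * (commutator n q \<bullet> commutator n q) - U rho - rho * deriv U rho) * r
      + J * rho * (commutator n q \<bullet> (commutator n' q + commutator n q'))
      - fderiv Psif (q, g) (q', h)"
proof -
  \<comment> \<open>The point is written \<open>rho + 0 * r\<close> to match the inner function of
    the chain rule at parameter 0.\<close>
  have Ud: "(U has_real_derivative deriv U rho) (at (rho + 0 * r))"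
    using C1_differentiable[OF C2_C1[OF U], of rho] rho
    by (simp add: DERIV_deriv_iff_real_differentiable)
  have du: "((\<lambda>s. (u + s *\<^sub>R a) \<bullet> (u + s *\<^sub>R a)) has_real_derivative 2 * (u \<bullet> a)) (at 0)"
    unfolding has_real_derivative_iff_has_vector_derivative
    by (rule has_vector_derivative_eq_rhs, rule bounded_bilinear.has_vector_derivative[OF bounded_bilinear_inner])
      (auto intro!: derivative_eq_intros simp: inner_commute)
  have dm: "((\<lambda>s. commutator (n + s *\<^sub>R n') (q + s *\<^sub>R q')) has_vector_derivative commutator n q' + commutator n' q) (at 0)"
    by (rule has_vector_derivative_eq_rhs, rule bounded_bilinear.has_vector_derivative[OF bounded_bilinear_commutator])
      (auto intro!: derivative_eq_intros)
  have dmm: "((\<lambda>s. commutator (n + s *\<^sub>R n') (q + s *\<^sub>R q') \<bullet> commutator (n + s *\<^sub>R n') (q + s *\<^sub>R q'))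
      has_real_derivative 2 * (commutator n q \<bullet> (commutator n' q + commutator n q'))) (at 0)"
    unfolding has_real_derivative_iff_has_vector_derivative
    by (rule has_vector_derivative_eq_rhs, rule bounded_bilinear.has_vector_derivative[OF bounded_bilinear_inner dm dm])
      (simp add: inner_commute add.commute)
  have dr: "((\<lambda>s. rho + s * r) has_real_derivative r) (at 0)" by (auto intro!: derivative_eq_intros)
  have dU: "((\<lambda>s. U (rho + s * r)) has_real_derivative deriv U rho * r) (at 0)"
    by (rule DERIV_chain2[OF Ud dr])
  have dP: "((\<lambda>s. Psif ((q, g) + s *\<^sub>R (q', h))) has_real_derivative fderiv Psif (q, g) (q', h)) (at 0)"
    by (simp only: Psi_directional)
  have 1: "((\<lambda>s. lag J U ((u, rho, n, q, g) + s *\<^sub>R (a, r, n', q', h))) has_real_derivative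
      rho * (u \<bullet> a)
      + (1 / 2 * (u \<bullet> u) + J / 2 * (commutator n q \<bullet> commutator n q) - U rho - rho * deriv U rho) * r
      + J * rho * (commutator n q \<bullet> (commutator n' q + commutator n q'))
      - fderiv Psif (q, g) (q', h)) (at 0)"
    unfolding lag_def lagrangian_density_def power2_norm_eq_inner
    using dP
    by (auto intro!: derivative_eq_intros du dmm dU simp: inner_commute[of a u] field_simps)
  have 2: "((\<lambda>s. lag J U ((u, rho, n, q, g) + s *\<^sub>R (a, r, n', q', h))) has_vector_derivative
      fderiv (lag J U) (u, rho, n, q, g) (a, r, n', q', h)) (at 0)"
    using has_vector_derivative_along[of "lag J U" _ "(u, rho, n, q, g)" 0 "(a, r, n', q', h)"]
      C1_has_derivative[OF lag_C1[OF U], of "(u, rho, n, q, g)"] rho by simp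
  show ?thesis
    by (rule vector_derivative_unique_at[OF 2 1[unfolded has_real_derivative_iff_has_vector_derivative]])
qed

end

locale liquid_crystal_action = liquid_crystal T X R rho0 xi0 rho gam + free_energy Psi
  for T X R rho0 xi0 rho gam Psi +
  fixes Q0 :: "vec3 \<Rightarrow> mat3" and J :: real and U :: "real \<Rightarrow> real" and t1 t2 :: real
  assumes Q0: "Ck_on 1 UNIV Q0" "\<And>x0. symmetric (Q0 x0)"
    and xi0_antisym: "\<And>x0 i. antisymmetric (xi0 x0 $ i)"
    and U: "Ck_on 2 {0<..} U"
    and times: "t1 < t2" "{t1..t2} \<subseteq> T"
    and stationary: "stationary_action J U Psi T t1 t2 (eulerian_velocity X) rho
      (eulerian_angular_velocity X R) (eulerian_order_tensor X R Q0) gam"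
begin

abbreviation "Qf \<equiv> \<lambda>z. eulerian_order_tensor X R Q0 (fst z) (snd z)"

definition "Zf z = (uf z, rhof z, nuf z, Qf z, gamf z)"

lemma Q1: "Ck_on 1 TU Qf" by (rule order_tensor_C1[OF Q0(1)])

lemma Z1: "Ck_on 1 TU Zf"
  unfolding Zf_def[abs_def] by (intro Ck_on_Pair open_TU u1 rho1 nu1 Q1 gam1)

lemma Q_sym: "z \<in> TU \<Longrightarrow> transpose (Qf z) = Qf z"
  using Q0(2) by (simp add: order_tensor_eq lagrangian_order_def symmetric_def matrix_transpose_mul matrix_mul_assoc)

text \<open>With \<open>c = - 1\<close> this hands antisymmetry on to derivatives.\<close>

lemma transpose_derivative:
  fixes f :: "real \<times> vec3 \<Rightarrow> mat3"
  assumes f: "Ck_on 1 TU f" and z: "z \<in> TU" and s: "\<And>z. z \<in> TU \<Longrightarrow> transpose (f z) = c *\<^sub>R f z"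
  shows "transpose (fderiv f z v) = c *\<^sub>R fderiv f z v"
proof -
  have "fderiv (\<lambda>z. transpose (f z)) z v = fderiv (\<lambda>z. c *\<^sub>R f z) z v"
    by (rule frechet_derivative_cong[OF open_TU z s])
      (use C1_differentiable[OF f z] in \<open>auto intro: differentiable_scaleR\<close>)
  then show ?thesis
    using frechet_derivative_linear_comp[OF bounded_linear_transpose C1_differentiable[OF f z]]
      frechet_derivative_linear_comp[OF bounded_linear_scaleR_right C1_differentiable[OF f z]] by simp
qed

lemma gam_antisym: "z \<in> TU \<Longrightarrow> transpose (gamf z $ i) = - (gamf z $ i)"
proof -
  assume z: "z \<in> TU"
  define y where "y = lab z"
  have y: "y \<in> TU" unfolding y_def by (rule lab_in[OF z])
  have c: "transpose (contract (xi0 (snd y)) v) = - contract (xi0 (snd y)) v" for v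
    using xi0_antisym
    by (simp add: contract_def linear_sum[OF bounded_linear.linear[OF bounded_linear_transpose]]
        transpose_scaleR antisymmetric_def sum_negf)
  have "transpose (wry xi0 y v) = - wry xi0 y v" for v
    unfolding wry_def transpose_plus transpose_uminus matrix_transpose_mul transpose_transpose transpose_frechet_R[OF y] c
    using R_orth(1)[OF y] by (simp add: matrix_mult_distribs matrix_mul_assoc)
  then show ?thesis using gam_eq[OF z, of "axis i 1"] by (simp add: y_def)
qed

text \<open>\<open>constrained_variation\<close> solved for its five outputs, in the order of
  \<open>Zf\<close>. Time derivative and advection by \<open>u\<close> are merged into the direction
  \<open>(1, uf p)\<close>, and the divergence of \<open>rho w\<close> is expanded.\<close>

definition "variation W H p =
  (fderiv W p (1, uf p) - fderiv uf p (0, W p),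
   - (rhof p * (\<Sum>k\<in>UNIV. fderiv W p (0, axis k 1) $ k) + fderiv rhof p (0, W p)),
   fderiv H p (1, uf p) - fderiv nuf p (0, W p) + commutator (H p) (nuf p),
   commutator (H p) (Qf p) - fderiv Qf p (0, W p),
   (\<chi> i. commutator (H p) (gamf p $ i) - fderiv H p (0, axis i 1)
      - fderiv gamf p (0, W p) $ i
      - (\<Sum>k\<in>UNIV. fderiv W p (0, axis i 1) $ k *\<^sub>R gamf p $ k)))"

lemma continuous_variation:
  assumes W: "Ck_on 1 TU W" and H: "Ck_on 1 TU H"
  shows "continuous_on TU (variation W H)"
proof -
  have d: "continuous_on TU (\<lambda>p. fderiv f p (h p))"
    if "Ck_on 1 TU f" "continuous_on TU h" for f :: "real \<times> vec3 \<Rightarrow> 'x::real_normed_vector" and h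
    by (rule continuous_on_frechet_derivative[of 0 "TU"]) (use that in \<open>auto intro: continuous_on_id\<close>)
  note c = Ck_on_continuous[OF u1] Ck_on_continuous[OF rho1] Ck_on_continuous[OF nu1] Ck_on_continuous[OF Q1]
    Ck_on_continuous[OF gam1] Ck_on_continuous[OF W] Ck_on_continuous[OF H]
  show ?thesis
    unfolding variation_def[abs_def]
    by (intro continuous_on_Pair continuous_on_diff continuous_on_add continuous_on_minus continuous_on_mult continuous_on_sum
        continuous_on_scaleR continuous_on_vec_lambda continuous_on_component continuous_on_const d c
        bounded_bilinear.continuous_on[OF bounded_bilinear_commutator] W H u1 rho1 nu1 Q1 gam1)
qed

text \<open>The explicit variation is fed to \<open>stationary_action\<close>; the derivative of the
  action, 0 by assumption, is also the integral of the differential of the Lagrangian.\<close>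

lemma first_variation:
  assumes W: "Ck_on 2 TU W" and H: "Ck_on 2 TU H"
    and H': "\<And>p. p \<in> TU \<Longrightarrow> antisymmetric (H p)"
    and b: "\<And>x. W (t1, x) = 0" "\<And>x. W (t2, x) = 0" "\<And>x. H (t1, x) = 0" "\<And>x. H (t2, x) = 0"
    and s: "\<And>t x. t \<in> T \<Longrightarrow> x \<notin> cball 0 r \<Longrightarrow> W (t, x) = 0 \<and> H (t, x) = 0"
  shows "st_integral t1 t2 r (\<lambda>p. fderiv (lag J U) (Zf p) (variation W H p)) = 0"
proof -
  define w where "w t x = W (t, x)" for t x
  define eta where "eta t x = H (t, x)" for t x
  define du where "du t x = fst (variation W H (t, x))" for t x
  define drho where "drho t x = fst (snd (variation W H (t, x)))" for t x
  define dnu where "dnu t x = fst (snd (snd (variation W H (t, x))))" for t x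
  define dQ where "dQ t x = fst (snd (snd (snd (variation W H (t, x)))))" for t x
  define dgam where "dgam t x = snd (snd (snd (snd (variation W H (t, x)))))" for t x
  note W1 = C2_C1[OF W] and H1 = C2_C1[OF H]
  have wf: "(\<lambda>z. w (fst z) (snd z)) = W" and ef: "(\<lambda>z. eta (fst z) (snd z)) = H"
    by (simp_all add: w_def eta_def)
  have w1: "Ck_on 1 TU (\<lambda>z. w (fst z) (snd z))" and e1: "Ck_on 1 TU (\<lambda>z. eta (fst z) (snd z))"
    using W1 H1 by (simp_all only: wf ef)
  have cv: "constrained_variation T (eulerian_velocity X) rho (eulerian_angular_velocity X R)
      (eulerian_order_tensor X R Q0) gam w eta du drho dnu dQ dgam"
    unfolding constrained_variation_def
  proof (intro ballI allI conjI)
    fix t i and x :: vec3 assume t: "t \<in> T"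
    then have z: "(t, x) \<in> TU" by auto
    note dW = C1_differentiable[OF W1 z]
    have tadv: "fderiv f (t, x) (1, uf (t, x)) = fderiv f (t, x) (1, 0)
        + fderiv f (t, x) (0, uf (t, x))" if "Ck_on 1 TU f" for f :: "_ \<Rightarrow> 'x::real_normed_vector"
      using linear_add[OF C1_linear[OF that z], of "(1, 0)" "(0, uf (t, x))"] by simp
    have pw: "partial_x i (\<lambda>y. w t y $ k) x = fderiv W (t, x) (0, axis i 1) $ k" for i k
      using trans[OF field_partial_x[OF Ck_on_component[OF open_TU w1] t] frechet_component]
        dW by (simp add: wf)
    show "du t x = partial_t w t x + advect (eulerian_velocity X t x) (w t) x - advect (w t x) (eulerian_velocity X t) x"
      using tadv[OF W1]
      by (simp add: du_def variation_def field_partial_t[OF w1 t] field_advect[OF w1 t] field_advect[OF u1 t] wf, simp add: w_def)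
    show "drho t x = - divergence (\<lambda>y. rho t y *\<^sub>R w t y) x"
    proof -
      have rw1: "Ck_on 1 TU (\<lambda>z. rhof z * w (fst z) (snd z) $ k)" for k
        by (intro Ck_on_mult open_TU rho1 Ck_on_component w1)
      have "partial_x k (\<lambda>y. rho t y * w t y $ k) x = rho t x * fderiv W (t, x) (0, axis k 1) $ k
          + fderiv rhof (t, x) (0, axis k 1) * W (t, x) $ k" for k
        unfolding field_partial_x[OF rw1 t]
        using frechet_derivative_bilinear[OF bounded_bilinear_mult C1_differentiable[OF rho1 z] C1_differentiable[OF Ck_on_component[OF open_TU W1] z], of k]
        by (simp add: w_def frechet_component[OF dW])
      moreover have "fderiv rhof (t, x) (0, W (t, x)) = (\<Sum>k\<in>UNIV. W (t, x) $ k * fderiv rhof (t, x) (0, axis k 1))"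
        using linear_axis_expand[OF linear_space_part[OF C1_linear[OF rho1 z]], of "W (t, x)"] by simp
      ultimately show ?thesis
        by (simp add: drho_def variation_def divergence_def sum.distrib sum_distrib_left mult.commute)
    qed
    show "dQ t x = commutator (eta t x) (eulerian_order_tensor X R Q0 t x) - advect (w t x) (eulerian_order_tensor X R Q0 t) x"
      by (simp add: dQ_def variation_def field_advect[OF Q1 t] eta_def w_def)
    show "dnu t x = partial_t eta t x - advect (w t x) (eulerian_angular_velocity X R t) x
        + advect (eulerian_velocity X t x) (eta t) x + commutator (eta t x) (eulerian_angular_velocity X R t x)"
      using tadv[OF H1]
      by (simp add: dnu_def variation_def field_partial_t[OF e1 t] field_advect[OF e1 t] field_advect[OF nu1 t] ef, simp add: w_def eta_def)
    have "advect (w t x) (\<lambda>y. gam t y $ i) x = fderiv gamf (t, x) (0, W (t, x)) $ i"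
      using trans[OF field_advect[OF Ck_on_component[OF open_TU gam1] t] frechet_component] C1_differentiable[OF gam1 z]
      by (simp add: w_def)
    then show "dgam t x $ i + advect (w t x) (\<lambda>y. gam t y $ i) x
        + (\<Sum>k\<in>UNIV. partial_x i (\<lambda>y. w t y $ k) x *\<^sub>R gam t x $ k)
        = commutator (eta t x) (gam t x $ i) - partial_x i (eta t) x"
      by (simp add: dgam_def variation_def pw field_partial_x[OF e1 t] ef, simp add: eta_def)
  qed
  have st: "((\<lambda>e. action J U Psi t1 t2 (cball 0 r)
        (\<lambda>t x. eulerian_velocity X t x + e *\<^sub>R du t x) (\<lambda>t x. rho t x + e * drho t x)
        (\<lambda>t x. eulerian_angular_velocity X R t x + e *\<^sub>R dnu t x) (\<lambda>t x. eulerian_order_tensor X R Q0 t x + e *\<^sub>R dQ t x)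
        (\<lambda>t x. gam t x + e *\<^sub>R dgam t x)) has_real_derivative 0) (at 0)"
  proof (rule stationary[unfolded stationary_action_def, rule_format], intro conjI)
    show "constrained_variation T (eulerian_velocity X) rho (eulerian_angular_velocity X R)
      (eulerian_order_tensor X R Q0) gam w eta du drho dnu dQ dgam" by (rule cv)
    show "Ck_on 2 TU (\<lambda>(t, x). w t x)" "Ck_on 2 TU (\<lambda>(t, x). eta t x)"
      using W H wf ef by (simp_all add: case_prod_beta')
  qed (use b s H' in \<open>auto simp: w_def eta_def\<close>)
  have "action J U Psi t1 t2 (cball 0 r)
        (\<lambda>t x. eulerian_velocity X t x + e *\<^sub>R du t x) (\<lambda>t x. rho t x + e * drho t x)
        (\<lambda>t x. eulerian_angular_velocity X R t x + e *\<^sub>R dnu t x) (\<lambda>t x. eulerian_order_tensor X R Q0 t x + e *\<^sub>R dQ t x)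
        (\<lambda>t x. gam t x + e *\<^sub>R dgam t x)
      = st_integral t1 t2 r (\<lambda>p. lag J U (Zf p + e *\<^sub>R variation W H p))" for e
    unfolding action_def st_integral_def
    by (simp add: lag_def Zf_def du_def drho_def dnu_def dQ_def dgam_def case_prod_beta')
  with st have "((\<lambda>e. st_integral t1 t2 r (\<lambda>p. lag J U (Zf p + e *\<^sub>R variation W H p))) has_real_derivative 0) (at 0)"
    by simp
  moreover have "((\<lambda>e. st_integral t1 t2 r (\<lambda>p. lag J U (Zf p + e *\<^sub>R variation W H p))) has_real_derivative
      st_integral t1 t2 r (\<lambda>p. fderiv (lag J U) (Zf p) (variation W H p))) (at 0)"
  proof (rule has_real_derivative_action[OF open_pos_density lag_C1[OF U]])
    show "continuous_on ({t1..t2} \<times> cball 0 r) Zf"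
      by (rule continuous_on_subset[OF Ck_on_continuous[OF Z1]]) (use times in auto)
    show "Zf ` ({t1..t2} \<times> cball 0 r) \<subseteq> {z. 0 < fst (snd z)}"
      using rho_pos times by (auto simp: Zf_def)
    show "continuous_on ({t1..t2} \<times> cball 0 r) (variation W H)"
      by (rule continuous_on_subset[OF continuous_variation[OF W1 H1]]) (use times in auto)
  qed
  ultimately show ?thesis using DERIV_unique by blast
qed

end

section \<open>Algebra and notation for the equations of motion\<close>

lemma commutator_zero: "commutator 0 A = 0" "commutator A 0 = 0"
  using bounded_bilinear.zero_left[OF bounded_bilinear_commutator] bounded_bilinear.zero_right[OF bounded_bilinear_commutator]
  by auto

lemma transpose_zero: "transpose (0 :: mat3) = 0"
  by (simp add: transpose_def vec_eq_iff)

text \<open>Bracketing with \<open>H\<close> is a derivation: rotating \<open>n\<close> and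
  \<open>Q\<close> together rotates their commutator.\<close>

lemma commutator_Jacobi: "commutator (commutator H n) Q + commutator n (commutator H Q) = commutator H (commutator n Q)"
  by (simp add: commutator_def matrix_mult_distribs matrix_mul_assoc)

lemma C1_deriv:
  assumes U: "Ck_on 2 {0<..} (U :: real \<Rightarrow> real)" shows "Ck_on 1 {0<..} (deriv U)"
proof (rule Ck_on_cong[OF _ _ C2_derivative[OF U, of 1]])
  fix x :: real assume "x \<in> {0<..}"
  then have "U differentiable (at x)" by (rule C1_differentiable[OF C2_C1[OF U]])
  then have "(U has_derivative (\<lambda>h. deriv U x * h)) (at x)"
    using DERIV_deriv_iff_real_differentiable has_field_derivative_def by metis
  then show "fderiv U x 1 = deriv U x" by (simp add: frechet_derivative_eqI)
qed simp

context liquid_crystal_action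
begin

abbreviation "mf z \<equiv> commutator (nuf z) (Qf z)"
definition "G l z = grad_gamma l (Qf z, gamf z)"
definition "GQ z = grad_Q (Qf z, gamf z)"
text \<open>The partial derivative of the Lagrangian density in \<open>rho\<close> at the state
  \<open>Zf z\<close>.\<close>

definition "Lr z = 1 / 2 * (uf z \<bullet> uf z) + J / 2 * (mf z \<bullet> mf z) - U (rhof z) - rhof z * deriv U (rhof z)"
definition "pf z = (rhof z)\<^sup>2 * deriv U (rhof z) - Psi (Qf z) (gamf z)"

lemma rhof_pos: "z \<in> TU \<Longrightarrow> rhof z > 0" using rho_pos by auto

lemma m_sym: "z \<in> TU \<Longrightarrow> transpose (mf z) = mf z"
  using nu_antisym[of z] Q_sym[of z]
  by (simp add: transpose_commutator antisymmetric_def commutator_minus_right, simp add: commutator_def)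

lemma G1: "Ck_on 1 TU (G l)"
  unfolding G_def[abs_def]
  by (rule Ck_on_compose[OF open_TU C1_grad_gamma Ck_on_Pair[OF open_TU Q1 gam1] subset_UNIV])

lemma m1: "Ck_on 1 TU mf"
  by (intro Ck_on_bilinear[OF open_TU bounded_bilinear_commutator] nu1 Q1)

lemma Ur1: "Ck_on 1 TU (\<lambda>z. U (rhof z))" "Ck_on 1 TU (\<lambda>z. deriv U (rhof z))"
  by (rule Ck_on_compose[OF open_TU C2_C1[OF U] rho1] Ck_on_compose[OF open_TU C1_deriv[OF U] rho1];
    use rhof_pos in auto)+

lemma Lr1: "Ck_on 1 TU Lr"
  unfolding Lr_def[abs_def]
  by (intro Ck_on_diff Ck_on_add Ck_on_mult Ck_on_const open_TU Ur1 rho1 m1 u1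
      Ck_on_bilinear[OF open_TU bounded_bilinear_inner])

lemma LZ1: "Ck_on 1 TU (\<lambda>z. lag J U (Zf z))"
  by (rule Ck_on_compose[OF open_TU lag_C1[OF U] Z1]) (use rhof_pos in \<open>auto simp: Zf_def\<close>)

text \<open>Both kinetic terms are linear in the density and cancel; the internal energy contributes
  the term with \<open>deriv U\<close>, and the free energy does not depend on the density.\<close>

lemma lag_pressure: "lag J U (Zf z) - rhof z * Lr z = pf z"
  unfolding lag_def Zf_def lagrangian_density_def Lr_def pf_def power2_norm_eq_inner
  by (simp add: power2_eq_square algebra_simps)

lemma frechet_lag_Z:
  assumes z: "z \<in> TU" and q: "symmetric q" and h: "\<And>i. antisymmetric (h $ i)"
  shows "fderiv (lag J U) (Zf z) (a, r, n, q, h)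
    = rhof z * (uf z \<bullet> a) + Lr z * r + J * rhof z * (mf z \<bullet> (commutator n (Qf z) + commutator (nuf z) q))
      - GQ z \<bullet> q - (\<Sum>i\<in>UNIV. G i z \<bullet> (h $ i))"
  unfolding Zf_def frechet_lag[OF U rhof_pos[OF z]] frechet_Psi[OF q h] by (simp add: Lr_def G_def GQ_def)

subsection \<open>Equations of motion\<close>

lemma linear_momentum_frechet:
  assumes t: "t \<in> {t1..t2}"
  shows "rho t x * fderiv (\<lambda>z. uf z $ j) (t, x) (1, uf (t, x))
    = - fderiv pf (t, x) (0, axis j 1)
      - (\<Sum>k\<in>UNIV. fderiv (\<lambda>z. gamf z $ j \<bullet> G k z) (t, x) (0, axis k 1))"
proof -
  define e :: "3 \<Rightarrow> vec3" where "e k = axis k 1" for k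
  define a where "a z = rhof z * uf z $ j" for z
  \<comment> \<open>Momentum flux, the contribution of the density variation, and the stress due to
    the wryness. The last is positive because the free energy in the Lagrangian and the derivative
    terms in the variation of \<open>gam\<close> both carry a minus sign.\<close>
  define b where "b k z = rhof z * uf z $ j * uf z $ k - (if k = j then 1 else 0) * (rhof z * Lr z) + gamf z $ j \<bullet> G k z" for k z
  \<comment> \<open>The transport part of the variation, minus \<open>\<phi>\<close> times the
    \<open>j\<close>-th derivative of the state, contributes this coefficient through the chain
    rule.\<close>
  define c where "c z = - fderiv (\<lambda>z. lag J U (Zf z)) z (0, e j)" for z
  have uj1: "Ck_on 1 TU (\<lambda>z. uf z $ k)" for k by (rule Ck_on_component[OF open_TU u1])
  have gG1: "Ck_on 1 TU (\<lambda>z. gamf z $ j \<bullet> G k z)" for k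
    by (intro Ck_on_bilinear[OF open_TU bounded_bilinear_inner] Ck_on_component open_TU gam1 G1)
  have ruu1: "Ck_on 1 TU (\<lambda>z. rhof z * uf z $ j * uf z $ k)" for k
    by (intro Ck_on_mult open_TU rho1 uj1)
  have rL1: "Ck_on 1 TU (\<lambda>z. rhof z * Lr z)" by (intro Ck_on_mult open_TU rho1 Lr1)
  have "c (t, x) = fderiv a (t, x) (1, 0) + (\<Sum>k\<in>UNIV. fderiv (b k) (t, x) (0, e k))"
  proof (rule weak_Euler_Lagrange[OF open_T times(2,1) _ _ _ _ _ t])
    show "Ck_on 1 TU a" unfolding a_def[abs_def] by (intro Ck_on_mult open_TU rho1 uj1)
    show "Ck_on 1 TU (b k)" for k
      unfolding b_def[abs_def] by (intro Ck_on_add Ck_on_diff Ck_on_mult[OF open_TU Ck_on_const] open_TU ruu1 rL1 gG1)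
    show "continuous_on TU c"
      unfolding c_def[abs_def] by (intro continuous_on_minus C1_continuous_derivative LZ1)
  next
    fix \<phi> :: "real \<times> vec3 \<Rightarrow> real" and r
    assume tf: "test_function t1 t2 r \<phi>"
    note \<phi> = test_functionD(1)[OF tf] and \<phi>0 = test_functionD(2,3)[OF tf] and \<phi>s = test_functionD(4)[OF tf]
    define W where "W z = \<phi> z *\<^sub>R e j" for z
    have W2: "Ck_on 2 TU W"
      unfolding W_def[abs_def] by (intro Ck_on_linear_comp[OF open_TU bounded_linear_scaleR_left] Ck_on_subset[OF \<phi>]) simp
    have "st_integral t1 t2 r (\<lambda>p. fderiv (lag J U) (Zf p) (variation W (\<lambda>_. 0) p)) = 0"
    proof (rule first_variation[OF W2 Ck_on_const])
      show "W (t, x) = 0 \<and> (0::mat3) = 0" if "x \<notin> cball 0 r" for t x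
        using \<phi>s[of x t] that by (simp add: W_def)
    qed (use \<phi>0 in \<open>simp_all add: W_def antisymmetric_def transpose_def zero_vec_def\<close>)
    moreover have "weak_form t1 t2 r UNIV a b e c \<phi>
      = st_integral t1 t2 r (\<lambda>p. fderiv (lag J U) (Zf p) (variation W (\<lambda>_. 0) p))"
      unfolding weak_form_def
    proof (rule st_integral_cong)
      fix s and y :: vec3 assume s: "s \<in> {t1..t2}"
      define z where "z = (s, y)"
      have z: "z \<in> TU" using s times by (auto simp: z_def)
      have \<phi>d: "\<phi> differentiable (at z)" by (rule C1_differentiable[OF C2_C1[OF \<phi>] UNIV_I])
      have l\<phi>: "linear (fderiv \<phi> z)" by (rule C1_linear[OF C2_C1[OF \<phi>] UNIV_I])
      define d\<phi> where "d\<phi> = fderiv \<phi> z"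
      have dW: "fderiv W z v = d\<phi> v *\<^sub>R e j" for v
        unfolding W_def[abs_def] d\<phi>_def by (rule frechet_derivative_linear_comp[OF bounded_linear_scaleR_left \<phi>d])
      have dZ: "fderiv Zf z v = (fderiv uf z v, fderiv rhof z v,
          fderiv nuf z v, fderiv Qf z v, fderiv gamf z v)" for v
        unfolding Zf_def[abs_def]
        by (rule frechet_derivative_eqI)
          (intro has_derivative_Pair C1_has_derivative[OF _ z] u1 rho1 nu1 Q1 gam1)
      \<comment> \<open>What the variation contains beyond the transport part. For
        \<open>w = \<phi> e_j\<close> and \<open>eta = 0\<close> the fields \<open>nu\<close> and
        \<open>Q\<close> vary by transport alone, hence the two zeros.\<close>
      define V where "V = (d\<phi> (1, uf z) *\<^sub>R e j, - (rhof z * d\<phi> (0, e j)), 0 :: mat3, 0 :: mat3,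
          (\<chi> i. - (d\<phi> (0, e i) *\<^sub>R gamf z $ j)) :: wryness)"
      have lin: "fderiv f z (0, \<phi> z *\<^sub>R e j) = \<phi> z *\<^sub>R fderiv f z (0, e j)"
        if "Ck_on 1 TU f" for f :: "_ \<Rightarrow> 'x::real_normed_vector"
        using linear_cmul[OF linear_space_part[OF C1_linear[OF that z]]] by blast
      have "variation W (\<lambda>_. 0) z = - \<phi> z *\<^sub>R fderiv Zf z (0, e j) + V"
      proof -
        have ej: "d * e j $ k = (if k = j then d else 0)" "(if k = j then d else 0) *\<^sub>R M = (if k = j then d *\<^sub>R M else 0)" for d k and M :: mat3
          by (auto simp: e_def axis_def)
        show ?thesis
          unfolding variation_def dZ V_def
          by (simp add: dW W_def lin[OF u1] lin[OF rho1] lin[OF nu1] lin[OF Q1] lin[OF gam1] commutator_zero ej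
              e_def[symmetric] vec_eq_iff[of "_ :: wryness"])
      qed
      moreover have "linear (fderiv (lag J U) (Zf z))"
        by (rule C1_linear[OF lag_C1[OF U]]) (use rhof_pos[OF z] in \<open>simp add: Zf_def\<close>)
      ultimately have "fderiv (lag J U) (Zf z) (variation W (\<lambda>_. 0) z)
          = - \<phi> z * fderiv (lag J U) (Zf z) (fderiv Zf z (0, e j))
            + fderiv (lag J U) (Zf z) V"
        by (simp add: linear_diff linear_cmul)
      also have "fderiv (lag J U) (Zf z) (fderiv Zf z (0, e j)) = - c z"
        unfolding c_def
        by (subst frechet_derivative_chain[OF C1_differentiable[OF Z1 z] C1_differentiable[OF lag_C1[OF U]]])
          (use rhof_pos[OF z] in \<open>simp_all add: Zf_def\<close>)
      also have "fderiv (lag J U) (Zf z) V = rhof z * (uf z $ j * d\<phi> (1, uf z)) - Lr z * (rhof z * d\<phi> (0, e j))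
          + (\<Sum>k\<in>UNIV. (gamf z $ j \<bullet> G k z) * d\<phi> (0, e k))"
        unfolding V_def
        by (subst frechet_lag_Z[OF z])
          (use gam_antisym[OF z] in \<open>auto simp: symmetric_def antisymmetric_def transpose_uminus transpose_scaleR
            transpose_zero commutator_zero inner_commute[of "G _ z"] sum_negf e_def inner_axis mult.commute\<close>)
      also have "d\<phi> (1, uf z) = d\<phi> (1, 0) + (\<Sum>k\<in>UNIV. uf z $ k * d\<phi> (0, e k))"
        using linear_add[OF l\<phi>, of "(1, 0)" "(0, uf z)"] linear_axis_expand[OF linear_space_part[OF l\<phi>], of "uf z"]
        by (simp add: d\<phi>_def e_def)
      finally have "fderiv (lag J U) (Zf z) (variation W (\<lambda>_. 0) z)
        = a z * d\<phi> (1, 0) + (\<Sum>k\<in>UNIV. b k z * d\<phi> (0, e k)) + c z * \<phi> z"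
      proof -
        have "(\<Sum>k\<in>UNIV. (if k = j then 1 else 0) * (rhof z * Lr z) * d\<phi> (0, e k)) = rhof z * Lr z * d\<phi> (0, e j)"
          by (simp add: if_distrib if_distribR cong: if_cong)
        then show ?thesis if "fderiv (lag J U) (Zf z) (variation W (\<lambda>_. 0) z)
          = - \<phi> z * - c z + (rhof z * (uf z $ j * (d\<phi> (1, 0) + (\<Sum>k\<in>UNIV. uf z $ k * d\<phi> (0, e k)))) - Lr z * (rhof z * d\<phi> (0, e j))
            + (\<Sum>k\<in>UNIV. (gamf z $ j \<bullet> G k z) * d\<phi> (0, e k)))"
          unfolding that a_def b_def distrib_right left_diff_distrib sum.distrib sum_subtractf
          by (simp add: algebra_simps sum_distrib_left)
      qed
      then show "a (s, y) * fderiv \<phi> (s, y) (1, 0)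
        + (\<Sum>k\<in>UNIV. b k (s, y) * fderiv \<phi> (s, y) (0, e k)) + c (s, y) * \<phi> (s, y)
        = fderiv (lag J U) (Zf (s, y)) (variation W (\<lambda>_. 0) (s, y))"
        by (simp add: z_def d\<phi>_def)
    qed
    ultimately show "weak_form t1 t2 r UNIV a b e c \<phi> = 0" by simp
  qed auto
  moreover
  have z: "(t, x) \<in> TU" using t times by auto
  have bd: "fderiv (b k) (t, x) v = fderiv (\<lambda>z. rhof z * uf z $ j * uf z $ k) (t, x) v
      - (if k = j then 1 else 0) * fderiv (\<lambda>z. rhof z * Lr z) (t, x) v
      + fderiv (\<lambda>z. gamf z $ j \<bullet> G k z) (t, x) v" for k v
    unfolding b_def[abs_def]
    by (rule frechet_derivative_eqI)
      (intro has_derivative_add has_derivative_diff has_derivative_mult_right C1_has_derivative[OF _ z] ruu1 rL1 gG1)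
  have "(\<Sum>k\<in>UNIV. fderiv (b k) (t, x) (0, e k))
    = (\<Sum>k\<in>UNIV. fderiv (\<lambda>z. rhof z * uf z $ j * uf z $ k) (t, x) (0, e k))
      - fderiv (\<lambda>z. rhof z * Lr z) (t, x) (0, e j)
      + (\<Sum>k\<in>UNIV. fderiv (\<lambda>z. gamf z $ j \<bullet> G k z) (t, x) (0, e k))"
    unfolding bd sum.distrib sum_subtractf by (simp add: if_distribR if_distrib cong: if_cong)
  moreover have "fderiv a (t, x) (1, 0)
      + (\<Sum>k\<in>UNIV. fderiv (\<lambda>z. rhof z * uf z $ j * uf z $ k) (t, x) (0, e k))
      = rho t x * fderiv (\<lambda>z. uf z $ j) (t, x) (1, uf (t, x))"
    using conservative_material_derivative[OF times t uj1] by (simp add: a_def[abs_def] e_def)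
  \<comment> \<open>The derivative of the Lagrangian in \<open>c\<close> and that of
    \<open>rho Lr\<close> in \<open>b\<close> combine to the pressure gradient.\<close>
  moreover have "fderiv pf (t, x) (0, e j) = fderiv (\<lambda>z. lag J U (Zf z)) (t, x) (0, e j)
      - fderiv (\<lambda>z. rhof z * Lr z) (t, x) (0, e j)"
    unfolding lag_pressure[symmetric, abs_def]
    by (rule frechet_derivative_eqI) (intro has_derivative_diff C1_has_derivative[OF _ z] LZ1 rL1)
  ultimately show ?thesis by (simp add: c_def e_def)
qed

lemma angular_momentum_frechet:
  assumes t: "t \<in> {t1..t2}"
  shows "(rho t x * J) *\<^sub>R fderiv (\<lambda>z. commutator (mf z) (Qf z)) (t, x) (1, uf (t, x))
    = commutator (Qf (t, x)) (GQ (t, x)) + (\<Sum>i\<in>UNIV. commutator (G i (t, x)) (gamf (t, x) $ i))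
      - (\<Sum>i\<in>UNIV. fderiv (G i) (t, x) (0, axis i 1))"
proof -
  have zT: "(t, x) \<in> TU" using t times by auto
  define e :: "3 \<Rightarrow> vec3" where "e k = axis k 1" for k
  \<comment> \<open>\<open>K\<close> is the angular momentum up to the factor \<open>rho J\<close>,
    and \<open>F\<close> is the torque without the divergence of the couple stress
    \<open>G\<close>.\<close>
  define K where "K z = commutator (mf z) (Qf z)" for z
  define F where "F z = commutator (Qf z) (GQ z) + (\<Sum>i\<in>UNIV. commutator (G i z) (gamf z $ i))" for z
  have K1: "Ck_on 1 TU K"
    unfolding K_def[abs_def] by (intro Ck_on_bilinear[OF open_TU bounded_bilinear_commutator] m1 Q1)
  have GQ1: "Ck_on 1 TU GQ"
    unfolding GQ_def[abs_def]
    by (rule Ck_on_compose[OF open_TU C1_grad_Q Ck_on_Pair[OF open_TU Q1 gam1] subset_UNIV])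
  have F1: "Ck_on 1 TU F"
    unfolding F_def[abs_def]
    by (intro Ck_on_add Ck_on_sum Ck_on_bilinear[OF open_TU bounded_bilinear_commutator] open_TU Q1 GQ1 G1 gam1 Ck_on_component)
  have Gt: "transpose (G i z) = - G i z" for i z
    using antisym_grad_gamma by (simp add: G_def antisymmetric_def)
  have GQt: "transpose (GQ z) = GQ z" for z using sym_grad_Q by (simp add: GQ_def symmetric_def)
  have weak: "H \<bullet> F (t, x) = H \<bullet> ((rho t x * J) *\<^sub>R fderiv K (t, x) (1, uf (t, x))
      + (\<Sum>k\<in>UNIV. fderiv (G k) (t, x) (0, e k)))" if H: "antisymmetric H" for H
  proof -
    define f where "f z = J * (H \<bullet> K z)" for z
    define a where "a z = rhof z * f z" for z
    define b where "b k z = rhof z * f z * uf z $ k + H \<bullet> G k z" for k z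
    have f1: "Ck_on 1 TU f"
      unfolding f_def[abs_def] by (intro Ck_on_mult Ck_on_const open_TU Ck_on_linear_comp[OF open_TU bounded_linear_inner_right] K1)
    have HG1: "Ck_on 1 TU (\<lambda>z. H \<bullet> G k z)" for k
      by (intro Ck_on_linear_comp[OF open_TU bounded_linear_inner_right] G1)
    have rfu1: "Ck_on 1 TU (\<lambda>z. rhof z * f z * uf z $ k)" for k
      by (intro Ck_on_mult open_TU rho1 f1 Ck_on_component u1)
    have "H \<bullet> F (t, x) = fderiv a (t, x) (1, 0) + (\<Sum>k\<in>UNIV. fderiv (b k) (t, x) (0, e k))"
    proof (rule weak_Euler_Lagrange[OF open_T times(2,1) _ _ _ _ _ t, where c="\<lambda>z. H \<bullet> F z"])
      show "Ck_on 1 TU a" unfolding a_def[abs_def] by (intro Ck_on_mult open_TU rho1 f1)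
      show "Ck_on 1 TU (b k)" for k
        unfolding b_def[abs_def] by (intro Ck_on_add open_TU rfu1 HG1)
      show "continuous_on TU (\<lambda>z. H \<bullet> F z)"
        by (intro continuous_intros Ck_on_continuous[OF F1])
    next
      fix \<phi> :: "real \<times> vec3 \<Rightarrow> real" and r
      assume tf: "test_function t1 t2 r \<phi>"
      note \<phi> = test_functionD(1)[OF tf] and \<phi>0 = test_functionD(2,3)[OF tf] and \<phi>s = test_functionD(4)[OF tf]
      define E where "E z = \<phi> z *\<^sub>R H" for z
      have E2: "Ck_on 2 TU E"
        unfolding E_def[abs_def] by (intro Ck_on_linear_comp[OF open_TU bounded_linear_scaleR_left] Ck_on_subset[OF \<phi>]) simp
      have "st_integral t1 t2 r (\<lambda>p. fderiv (lag J U) (Zf p) (variation (\<lambda>_. 0) E p)) = 0"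
      proof (rule first_variation[OF Ck_on_const E2])
        show "(0::vec3) = 0 \<and> E (t, x) = 0" if "x \<notin> cball 0 r" for t x
          using \<phi>s[of x t] that by (simp add: E_def)
      qed (use \<phi>0 H in \<open>simp_all add: E_def antisymmetric_def transpose_scaleR\<close>)
      moreover have "weak_form t1 t2 r UNIV a b e (\<lambda>z. H \<bullet> F z) \<phi>
        = st_integral t1 t2 r (\<lambda>p. fderiv (lag J U) (Zf p) (variation (\<lambda>_. 0) E p))"
        unfolding weak_form_def
      proof (rule st_integral_cong)
        fix s and y :: vec3 assume s: "s \<in> {t1..t2}"
        define z where "z = (s, y)"
        have z: "z \<in> TU" using s times by (auto simp: z_def)
        have \<phi>d: "\<phi> differentiable (at z)" by (rule C1_differentiable[OF C2_C1[OF \<phi>] UNIV_I])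
        have l\<phi>: "linear (fderiv \<phi> z)" by (rule C1_linear[OF C2_C1[OF \<phi>] UNIV_I])
        define d\<phi> where "d\<phi> = fderiv \<phi> z"
        have dE: "fderiv E z v = d\<phi> v *\<^sub>R H" for v
          unfolding E_def[abs_def] d\<phi>_def by (rule frechet_derivative_linear_comp[OF bounded_linear_scaleR_left \<phi>d])
        have lin0: "fderiv g z (0, 0) = 0"
          if "Ck_on 1 TU g" for g :: "_ \<Rightarrow> 'x::real_normed_vector"
          using linear_0[OF C1_linear[OF that z]] by (simp add: zero_prod_def)
        define n' where "n' = d\<phi> (1, uf z) *\<^sub>R H + \<phi> z *\<^sub>R commutator H (nuf z)"
        define h :: wryness where "h = (\<chi> i. \<phi> z *\<^sub>R commutator H (gamf z $ i) - d\<phi> (0, e i) *\<^sub>R H)"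
        have v: "variation (\<lambda>_. 0) E z = (0, 0, n', \<phi> z *\<^sub>R commutator H (Qf z), h)"
          unfolding variation_def n'_def h_def
          by (simp add: dE E_def lin0[OF u1] lin0[OF rho1] lin0[OF nu1] lin0[OF Q1] lin0[OF gam1] commutator_scaleR_left
              e_def[symmetric])
        have q: "symmetric (\<phi> z *\<^sub>R commutator H (Qf z))"
          using H Q_sym[OF z] unfolding symmetric_def antisymmetric_def
          by (simp add: transpose_scaleR transpose_commutator commutator_minus_right, simp add: commutator_def scaleR_diff_right)
        have ha: "antisymmetric (h $ i)" for i
          using H gam_antisym[OF z, of i] unfolding h_def antisymmetric_def
          by (simp add: transpose_scaleR transpose_diff transpose_commutator commutator_minus_right commutator_minus_left,
              simp add: commutator_def scaleR_diff_right)
        have i1: "mf z \<bullet> commutator H (Qf z) = H \<bullet> K z"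
          using inner_commutator[of "mf z" H "Qf z"] Q_sym[OF z] by (simp add: K_def)
        \<comment> \<open>A rotation does not change the norm of \<open>[nu, Q]\<close>: this
          symmetric matrix commutes with its transpose. So only the derivative of
          \<open>\<phi>\<close> enters through the kinetic term.\<close>
        have i2: "mf z \<bullet> commutator H (mf z) = 0"
          using inner_commutator[of "mf z" H "mf z"] m_sym[OF z] by (simp add: commutator_def)
        have i3: "GQ z \<bullet> commutator H (Qf z) = - (H \<bullet> commutator (Qf z) (GQ z))"
          using inner_commutator[of "GQ z" H "Qf z"] Q_sym[OF z] commutator_swap[of "GQ z"] by simp
        have i4: "G i z \<bullet> commutator H (gamf z $ i) = - (H \<bullet> commutator (G i z) (gamf z $ i))" for i
          using inner_commutator[of "G i z" H "gamf z $ i"] gam_antisym[OF z, of i] by (simp add: commutator_minus_right)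
        have jac: "commutator n' (Qf z) + commutator (nuf z) (\<phi> z *\<^sub>R commutator H (Qf z))
            = d\<phi> (1, uf z) *\<^sub>R commutator H (Qf z) + \<phi> z *\<^sub>R commutator H (mf z)"
          unfolding n'_def commutator_add_left commutator_scaleR_left commutator_scaleR_right
            commutator_Jacobi[of H "nuf z" "Qf z", symmetric] by (simp add: scaleR_add_right)
        have "fderiv (lag J U) (Zf z) (variation (\<lambda>_. 0) E z)
            = J * rhof z * (d\<phi> (1, uf z) * (H \<bullet> K z)) + \<phi> z * (H \<bullet> commutator (Qf z) (GQ z))
              - (\<Sum>i\<in>UNIV. - \<phi> z * (H \<bullet> commutator (G i z) (gamf z $ i)) - d\<phi> (0, e i) * (H \<bullet> G i z))"
          unfolding v frechet_lag_Z[OF z q ha] jac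
          by (simp add: inner_add_right i1 i2 i3 h_def inner_diff_right i4 inner_commute[of _ H])
        also have "\<dots> = J * rhof z * (d\<phi> (1, uf z) * (H \<bullet> K z)) + \<phi> z * (H \<bullet> F z) + (\<Sum>i\<in>UNIV. d\<phi> (0, e i) * (H \<bullet> G i z))"
          by (simp add: F_def inner_add_right inner_sum_right sum_subtractf sum_negf sum_distrib_left distrib_left)
        also have "d\<phi> (1, uf z) = d\<phi> (1, 0) + (\<Sum>k\<in>UNIV. uf z $ k * d\<phi> (0, e k))"
          using linear_add[OF l\<phi>, of "(1, 0)" "(0, uf z)"] linear_axis_expand[OF linear_space_part[OF l\<phi>], of "uf z"]
          by (simp add: d\<phi>_def e_def)
        finally show "a (s, y) * fderiv \<phi> (s, y) (1, 0)
          + (\<Sum>k\<in>UNIV. b k (s, y) * fderiv \<phi> (s, y) (0, e k)) + H \<bullet> F (s, y) * \<phi> (s, y)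
          = fderiv (lag J U) (Zf (s, y)) (variation (\<lambda>_. 0) E (s, y))"
          unfolding z_def[symmetric] d\<phi>_def[symmetric] a_def b_def f_def
          by (simp add: distrib_right distrib_left sum.distrib sum_distrib_left sum_distrib_right mult_ac)
      qed
      ultimately show "weak_form t1 t2 r UNIV a b e (\<lambda>z. H \<bullet> F z) \<phi> = 0" by simp
    qed auto
    moreover have "fderiv (b k) (t, x) v = fderiv (\<lambda>z. rhof z * f z * uf z $ k) (t, x) v
        + H \<bullet> fderiv (G k) (t, x) v" for k v
      unfolding b_def[abs_def]
      by (rule frechet_derivative_eqI)
        (intro has_derivative_add has_derivative_inner_right C1_has_derivative[OF _ zT] rfu1 G1)
    moreover have "fderiv f (t, x) v = J * (H \<bullet> fderiv K (t, x) v)" for v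
      unfolding f_def[abs_def]
      by (rule frechet_derivative_eqI)
        (intro has_derivative_mult_right has_derivative_inner_right C1_has_derivative[OF K1 zT])
    ultimately show ?thesis
      using conservative_material_derivative[OF times t f1, of x]
      by (simp add: a_def[abs_def] e_def sum.distrib inner_add_right inner_sum_right algebra_simps)
  qed
  \<comment> \<open>Antisymmetric \<open>H\<close> detect only the antisymmetric part of an
    equation, so every term has to be antisymmetric: commutators of two symmetric or of two
    antisymmetric matrices are, and so are the derivatives of antisymmetric fields.\<close>
  have Kt: "transpose (K z) = (- 1) *\<^sub>R K z" if "z \<in> TU" for z
    unfolding K_def using m_sym[OF that] Q_sym[OF that] by (simp add: transpose_commutator, simp add: commutator_def)
  define D where "D = F (t, x) - ((rho t x * J) *\<^sub>R fderiv K (t, x) (1, uf (t, x))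
      + (\<Sum>k\<in>UNIV. fderiv (G k) (t, x) (0, e k)))"
  have ts: "transpose (\<Sum>k\<in>A. g k) = (\<Sum>k\<in>A. transpose (g k))" for A and g :: "3 \<Rightarrow> mat3"
    by (rule linear_sum[OF bounded_linear.linear[OF bounded_linear_transpose]])
  have "transpose (F (t, x)) = - F (t, x)"
    unfolding F_def transpose_plus ts transpose_commutator Gt gam_antisym[OF zT] GQt Q_sym[OF zT]
    by (simp add: commutator_minus_left commutator_minus_right commutator_swap[of "GQ (t, x)"]
        commutator_swap[of "gam t x $ _"] sum_negf)
  moreover have "transpose (fderiv K (t, x) (1, uf (t, x))) = - fderiv K (t, x) (1, uf (t, x))"
    using transpose_derivative[OF K1 zT Kt] by simp
  moreover have "transpose (fderiv (G k) (t, x) (0, e k)) = - fderiv (G k) (t, x) (0, e k)" for k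
    using transpose_derivative[OF G1 zT, where c="-1"] Gt by simp
  ultimately have "antisymmetric D"
    unfolding D_def antisymmetric_def by (simp add: transpose_diff transpose_plus transpose_scaleR ts sum_negf)
  \<comment> \<open>\<open>D\<close> is itself an admissible \<open>H\<close>\<close>
  from weak[OF this] have "D \<bullet> D = 0" by (subst (2) D_def) (simp add: inner_diff_right)
  then have "D = 0" by simp
  then show ?thesis by (simp add: D_def F_def K_def[abs_def] e_def algebra_simps)
qed

end

section \<open>The equations in the notation of the definitions\<close>

context liquid_crystal
begin

text \<open>Expresses \<open>gam\<close> through \<open>X\<close>, \<open>R\<close> and
  \<open>xi0\<close>, so that wryness fields belonging to the same path coincide; this identifies
  the undeformed member of a family with \<open>gam\<close>.\<close>

lemma gam_components:
  assumes t: "t \<in> T"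
  shows "gam t x = eulerian_components (X t) (lagrangian_wryness (R t) xi0) (inv (X t) x)"
proof -
  have z: "(t, x) \<in> T \<times> UNIV" using t by auto
  have "X t (inv (X t) x) = x" using X_lab[OF z] by (simp add: label_def)
  then have "gam t x $ i = eulerian_components (X t) (lagrangian_wryness (R t) xi0) (inv (X t) x) $ i" for i
    using gam_eq[OF z, of "axis i 1"] eulerian_components_eq[OF t, of xi0 "inv (X t) x" i]
    by (simp add: lab_def label_def)
  then show ?thesis by (simp add: vec_eq_iff[of "gam t x"])
qed

end

context liquid_crystal_action
begin

lemma pf1: "Ck_on 1 (T \<times> UNIV) pf"
  unfolding lag_pressure[symmetric, abs_def] by (intro Ck_on_diff Ck_on_mult open_TU LZ1 rho1 Lr1)

lemma linear_momentum_equation: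
  assumes t: "t \<in> {t1..t2}" and p: "p = (\<lambda>t x. (rho t x)\<^sup>2 * deriv U (rho t x) - Psi (eulerian_order_tensor X R Q0 t x) (gam t x))"
  shows "rho t x * material_derivative (eulerian_velocity X) (\<lambda>t x. eulerian_velocity X t x $ i) t x
    = - partial_x i (p t) x - (\<Sum>l\<in>UNIV. partial_x l
      (\<lambda>y. trace_pairing (gam t y $ i) (dPsi_dgamma Psi l (eulerian_order_tensor X R Q0 t y) (gam t y))) x)"
proof -
  have tT: "t \<in> T" using t times by auto
  have pe: "(\<lambda>z. p (fst z) (snd z)) = pf" by (simp add: p pf_def fun_eq_iff)
  have p1: "Ck_on 1 (T \<times> UNIV) (\<lambda>z. p (fst z) (snd z))" unfolding pe by (rule pf1)
  define S where "S l t y = gam t y $ i \<bullet> G l (t, y)" for l t y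
  have Se: "(\<lambda>z. S l (fst z) (snd z)) = (\<lambda>z. gamf z $ i \<bullet> G l z)" for l by (simp add: S_def)
  have S1: "Ck_on 1 (T \<times> UNIV) (\<lambda>z. S l (fst z) (snd z))" for l
    unfolding Se by (intro Ck_on_bilinear[OF open_TU bounded_bilinear_inner] Ck_on_component open_TU gam1 G1)
  have St: "(\<lambda>y. trace_pairing (gam t y $ i) (dPsi_dgamma Psi l (eulerian_order_tensor X R Q0 t y) (gam t y))) = S l t" for l
    by (simp add: S_def trace_pairing_inner dPsi_dgamma_eq G_def fun_eq_iff)
  show ?thesis
    unfolding St field_partial_x[OF S1 tT] Se field_partial_x[OF p1 tT] pe
      field_material[OF Ck_on_component[OF open_TU u1] tT]
    using linear_momentum_frechet[OF t, of x i] by simp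
qed

lemma angular_momentum_equation:
  assumes t: "t \<in> {t1..t2}"
  defines "nu \<equiv> eulerian_angular_velocity X R" and "Q \<equiv> eulerian_order_tensor X R Q0"
  shows "(rho t x * J) *\<^sub>R material_derivative (eulerian_velocity X) (\<lambda>t x. commutator (commutator (nu t x) (Q t x)) (Q t x)) t x
    = commutator (Q t x) (dPsi_dQ Psi (Q t x) (gam t x))
      + (\<Sum>i\<in>UNIV. commutator (dPsi_dgamma Psi i (Q t x) (gam t x)) (gam t x $ i))
      - (\<Sum>i\<in>UNIV. partial_x i (\<lambda>y. dPsi_dgamma Psi i (Q t y) (gam t y)) x)"
proof -
  have tT: "t \<in> T" using t times by auto
  define S where "S l t y = G l (t, y)" for l t y
  have Se: "(\<lambda>z. S l (fst z) (snd z)) = G l" for l by (simp add: S_def)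
  have S1: "Ck_on 1 (T \<times> UNIV) (\<lambda>z. S l (fst z) (snd z))" for l unfolding Se by (rule G1)
  have St: "(\<lambda>y. dPsi_dgamma Psi l (Q t y) (gam t y)) = S l t" for l
    by (simp add: S_def dPsi_dgamma_eq G_def fun_eq_iff Q_def)
  have K1: "Ck_on 1 (T \<times> UNIV) (\<lambda>z. commutator (mf z) (Qf z))"
    by (intro Ck_on_bilinear[OF open_TU bounded_bilinear_commutator] m1 Q1)
  show ?thesis
    unfolding St field_partial_x[OF S1 tT] Se
    unfolding nu_def Q_def field_material[OF K1 tT]
    using angular_momentum_frechet[OF t, of x] by (simp add: dPsi_dgamma_eq dPsi_dQ_eq G_def GQ_def)
qed

end

section \<open>Deformations of a path\<close>

lemma Ck_on_parameter_slice:
  fixes F :: "real \<Rightarrow> real \<Rightarrow> vec3 \<Rightarrow> 'b::real_normed_vector"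
  assumes F: "Ck_on k (E \<times> T \<times> UNIV) (\<lambda>(e, t, x). F e t x)" and E: "open E" and t: "t \<in> T"
  shows "Ck_on k (E \<times> UNIV) (\<lambda>(e, x). F e t x)"
proof -
  have o: "open (E \<times> (UNIV :: vec3 set))" using E by (intro open_Times) auto
  have "Ck_on k (E \<times> (UNIV :: vec3 set)) (\<lambda>z. (fst z, t, snd z))"
    by (intro Ck_on_Pair[OF o] Ck_on_const Ck_on_linear[OF o bounded_linear_fst] Ck_on_linear[OF o bounded_linear_snd])
  from Ck_on_compose[OF o F this] t show ?thesis by (simp add: case_prod_beta' image_subset_iff)
qed

text \<open>With the physical time \<open>t\<close> frozen, the deformation parameter takes over the
  role of time.\<close>

lemma path_variation_slice:
  assumes "path_variation E T X R XV RV" "t \<in> T"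
  shows "lagrangian_path E (\<lambda>e. XV e t) (\<lambda>e. RV e t)"
proof -
  have E: "open E" and C: "Ck_on 2 (E \<times> T \<times> UNIV) (\<lambda>(e, t, x0). XV e t x0)"
    "Ck_on 2 (E \<times> T \<times> UNIV) (\<lambda>(e, t, x). inv (XV e t) x)" "Ck_on 2 (E \<times> T \<times> UNIV) (\<lambda>(e, t, x0). RV e t x0)"
    using assms(1) by (simp_all add: path_variation_def)
  show ?thesis
    using assms Ck_on_parameter_slice[OF C(1) E assms(2)] Ck_on_parameter_slice[OF C(2) E assms(2)]
      Ck_on_parameter_slice[OF C(3) E assms(2)]
    by (simp add: lagrangian_path_def path_variation_def)
qed

lemma wryness_variation:
  assumes pv: "path_variation E T X R XV RV"
    and rho0: "Ck_on 1 UNIV rho0" "\<And>x0. rho0 x0 > 0" and xi0: "Ck_on 1 UNIV xi0"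
    and rhoV: "Ck_on 1 (E \<times> T \<times> UNIV) (\<lambda>(e, t, x). rhoV e t x)"
    and gamV: "Ck_on 1 (E \<times> T \<times> UNIV) (\<lambda>(e, t, x). gamV e t x)"
    and euler: "\<And>e t. e \<in> E \<Longrightarrow> t \<in> T \<Longrightarrow> is_eulerian_density (XV e t) rho0 (rhoV e t)"
      "\<And>e t. e \<in> E \<Longrightarrow> t \<in> T \<Longrightarrow> is_eulerian_wryness (XV e t) (RV e t) rho0 xi0 (rhoV e t) (gamV e t)"
    and gam: "\<And>t x. t \<in> T \<Longrightarrow> gam t x = eulerian_components (X t) (lagrangian_wryness (R t) xi0) (inv (X t) x)"
    and w: "w = (\<lambda>t x. vector_derivative (\<lambda>e. XV e t (inv (X t) x)) (at 0))"
    and eta: "eta = (\<lambda>t x. vector_derivative (\<lambda>e. RV e t (inv (X t) x)) (at 0) ** matrix_inv (R t (inv (X t) x)))"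
    and dgam: "dgam = (\<lambda>t x. vector_derivative (\<lambda>e. gamV e t x) (at 0))"
    and t: "t \<in> T"
  shows "dgam t x $ i + advect (w t x) (\<lambda>y. gam t y $ i) x
    + (\<Sum>k\<in>UNIV. partial_x i (\<lambda>y. w t y $ k) x *\<^sub>R (gam t x $ k))
    = commutator (eta t x) (gam t x $ i) - partial_x i (eta t) x"
proof -
  have E: "open E" "0 \<in> E" and V0: "XV 0 t = X t" "RV 0 t = R t"
    using pv t by (auto simp: path_variation_def)
  interpret V: liquid_crystal E "\<lambda>e. XV e t" "\<lambda>e. RV e t" rho0 xi0 "\<lambda>e. rhoV e t" "\<lambda>e. gamV e t"
    by unfold_locales
      (use path_variation_slice[OF pv t] rho0 xi0 euler t Ck_on_parameter_slice[OF rhoV E(1) t]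
        Ck_on_parameter_slice[OF gamV E(1) t] in auto)
  have g0: "gamV 0 t = gam t" using V.gam_components[OF E(2)] gam[OF t] by (simp add: V0 fun_eq_iff)
  have w0: "eulerian_velocity (\<lambda>e. XV e t) 0 = w t"
    by (simp add: fun_eq_iff eulerian_velocity_def partial_t_def w V0)
  have e0: "eulerian_angular_velocity (\<lambda>e. XV e t) (\<lambda>e. RV e t) 0 = eta t"
    by (simp add: fun_eq_iff eulerian_angular_velocity_def partial_t_def eta V0)
  have z: "(0, x) \<in> E \<times> UNIV" using E by auto
  have "partial_t (\<lambda>e x. gamV e t x $ i) 0 x = partial_t (\<lambda>e x. gamV e t x) 0 x $ i"
    unfolding field_partial_t[OF Ck_on_component[OF V.open_TU V.gam1] E(2)] field_partial_t[OF V.gam1 E(2)]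
    by (rule frechet_component[OF C1_differentiable[OF V.gam1 z]])
  then have d0: "partial_t (\<lambda>e x. gamV e t x $ i) 0 x = dgam t x $ i"
    by (simp add: partial_t_def dgam)
  show ?thesis using V.wryness_transport[OF E(2), of i x] unfolding g0 w0 e0 d0 by simp
qed

theorem mainTheorem4:
  fixes X :: "real \<Rightarrow> vec3 \<Rightarrow> vec3" and R :: "real \<Rightarrow> vec3 \<Rightarrow> mat3"
    and rho0 :: "vec3 \<Rightarrow> real" and Q0 :: "vec3 \<Rightarrow> mat3" and xi0 :: "vec3 \<Rightarrow> wryness"
    and u :: "real \<Rightarrow> vec3 \<Rightarrow> vec3" and rho :: "real \<Rightarrow> vec3 \<Rightarrow> real"
    and nu Q :: "real \<Rightarrow> vec3 \<Rightarrow> mat3" and gam :: "real \<Rightarrow> vec3 \<Rightarrow> wryness"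
    and T :: "real set" and t1 t2 J \<alpha> L1 L2 P \<beta> c :: real and U :: "real \<Rightarrow> real"
    and Psi :: "mat3 \<Rightarrow> wryness \<Rightarrow> real" and p :: "real \<Rightarrow> vec3 \<Rightarrow> real"
  assumes path: "lagrangian_path T X R"
    and times: "t1 < t2" "{t1..t2} \<subseteq> T"
    and rho0: "Ck_on 1 UNIV rho0" "\<And>x0. rho0 x0 > 0"
    and Q0: "Ck_on 1 UNIV Q0" "\<And>x0. symmetric (Q0 x0)" "\<And>x0. trace (Q0 x0) = 0"
    and xi0: "Ck_on 1 UNIV xi0" "\<And>x0 i. antisymmetric (xi0 x0 $ i)"
      "\<And>x0 i. partial_x i Q0 x0 = commutator (Q0 x0) (xi0 x0 $ i)"
    and u: "u = eulerian_velocity X"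
    and nu: "nu = eulerian_angular_velocity X R"
    and Q: "Q = eulerian_order_tensor X R Q0"
    and rho: "Ck_on 1 (T \<times> UNIV) (\<lambda>(t, x). rho t x)"
      "\<And>t. t \<in> T \<Longrightarrow> is_eulerian_density (X t) rho0 (rho t)"
    and gam: "Ck_on 1 (T \<times> UNIV) (\<lambda>(t, x). gam t x)"
      "\<And>t. t \<in> T \<Longrightarrow> is_eulerian_wryness (X t) (R t) rho0 xi0 (rho t) (gam t)"
    and U: "Ck_on 2 {0<..} U"
    and P: "P \<noteq> 0"
    and Psi: "Psi = (\<lambda>A g. landau_de_gennes \<alpha> L1 L2 P \<beta> c A (\<chi> i. commutator A (g $ i)))"
    and p: "p = (\<lambda>t x. (rho t x)\<^sup>2 * deriv U (rho t x) - Psi (Q t x) (gam t x))"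
  shows "(\<forall>t\<in>T. \<forall>x i. partial_x i (Q t) x = commutator (Q t x) (gam t x $ i))
    \<and> (\<forall>t\<in>T. \<forall>x i.
        partial_t (\<lambda>t x. gam t x $ i) t x + advect (u t x) (\<lambda>y. gam t y $ i) x
          + (\<Sum>k\<in>UNIV. partial_x i (\<lambda>y. u t y $ k) x *\<^sub>R (gam t x $ k))
        = commutator (nu t x) (gam t x $ i) - partial_x i (nu t) x)
    \<and> (\<forall>E XV RV rhoV gamV w eta dgam.
        path_variation E T X R XV RV
        \<and> Ck_on 1 (E \<times> T \<times> UNIV) (\<lambda>(e, t, x). rhoV e t x)
        \<and> Ck_on 1 (E \<times> T \<times> UNIV) (\<lambda>(e, t, x). gamV e t x)
        \<and> (\<forall>e\<in>E. \<forall>t\<in>T. is_eulerian_density (XV e t) rho0 (rhoV e t)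
              \<and> is_eulerian_wryness (XV e t) (RV e t) rho0 xi0 (rhoV e t) (gamV e t))
        \<and> w = (\<lambda>t x. vector_derivative (\<lambda>e. XV e t (inv (X t) x)) (at 0))
        \<and> eta = (\<lambda>t x. vector_derivative (\<lambda>e. RV e t (inv (X t) x)) (at 0)
                          ** matrix_inv (R t (inv (X t) x)))
        \<and> dgam = (\<lambda>t x. vector_derivative (\<lambda>e. gamV e t x) (at 0))
        \<longrightarrow> (\<forall>t\<in>T. \<forall>x i.
              dgam t x $ i + advect (w t x) (\<lambda>y. gam t y $ i) x
                + (\<Sum>k\<in>UNIV. partial_x i (\<lambda>y. w t y $ k) x *\<^sub>R (gam t x $ k))
              = commutator (eta t x) (gam t x $ i) - partial_x i (eta t) x))
    \<and> (stationary_action J U Psi T t1 t2 u rho nu Q gam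
        \<longrightarrow> (\<forall>t\<in>{t1..t2}. \<forall>x.
              (\<forall>i. rho t x * material_derivative u (\<lambda>t x. u t x $ i) t x
                 = - partial_x i (p t) x
                   - (\<Sum>l\<in>UNIV. partial_x l
                       (\<lambda>y. trace_pairing (gam t y $ i) (dPsi_dgamma Psi l (Q t y) (gam t y))) x))
            \<and> material_derivative u Q t x = commutator (nu t x) (Q t x)
            \<and> (rho t x * J) *\<^sub>R
                 material_derivative u
                   (\<lambda>t x. commutator (commutator (nu t x) (Q t x)) (Q t x)) t x
               = commutator (Q t x) (dPsi_dQ Psi (Q t x) (gam t x))
                 + (\<Sum>i\<in>UNIV. commutator (dPsi_dgamma Psi i (Q t x) (gam t x)) (gam t x $ i))
                 - (\<Sum>i\<in>UNIV. partial_x i (\<lambda>y. dPsi_dgamma Psi i (Q t y) (gam t y)) x)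
            \<and> (\<forall>i. material_derivative u (\<lambda>t x. gam t x $ i) t x
                   + (\<Sum>k\<in>UNIV. partial_x i (\<lambda>y. u t y $ k) x *\<^sub>R (gam t x $ k))
                 = commutator (nu t x) (gam t x $ i) - partial_x i (nu t) x)))"
proof -
  interpret lc: liquid_crystal T X R rho0 xi0 rho gam
    by unfold_locales (use path rho0 xi0 rho gam in auto)
  interpret fe: free_energy Psi
    by unfold_locales (simp add: Psi Ck_on_landau_de_gennes)
  have transport: "partial_t (\<lambda>t x. gam t x $ i) t x + advect (u t x) (\<lambda>y. gam t y $ i) x
      + (\<Sum>k\<in>UNIV. partial_x i (\<lambda>y. u t y $ k) x *\<^sub>R (gam t x $ k))
    = commutator (nu t x) (gam t x $ i) - partial_x i (nu t) x" if "t \<in> T" for t x i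
    unfolding u nu by (rule lc.wryness_transport[OF that])
  have lca: "liquid_crystal_action T X R rho0 xi0 rho gam Psi Q0 J U t1 t2"
    if "stationary_action J U Psi T t1 t2 u rho nu Q gam"
    by unfold_locales (use that Q0 xi0 U times in \<open>auto simp: u nu Q\<close>)
  show ?thesis
  proof (intro conjI ballI allI impI, goal_cases)
    case (1 t x i)
    then show ?case unfolding Q by (rule lc.gradient_order_tensor[OF Q0(1) xi0(3)])
  next
    case (2 t x i)
    then show ?case by (rule transport)
  next
    case (3 E XV RV rhoV gamV w eta dgam t x i)
    then show ?case
      by (elim conjE) (rule wryness_variation[OF _ rho0 xi0(1) _ _ _ _ lc.gam_components], (assumption | blast)+)
  next
    case (4 t x i)
    then show ?case
      unfolding u Q using liquid_crystal_action.linear_momentum_equation[OF lca _ p[unfolded Q]] by (simp add: u Q)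
  next
    case (5 t x)
    then have "t \<in> T" using times by auto
    then show ?case unfolding u Q nu by (rule lc.order_tensor_transport[OF Q0(1)])
  next
    case (6 t x)
    then show ?case
      using liquid_crystal_action.angular_momentum_equation[OF lca] by (simp add: u Q nu)
  next
    case (7 t x i)
    then have "t \<in> T" using times by auto
    then show ?case unfolding material_derivative_def by (rule transport)
  qed
qed

end
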